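(* Assume SETH. For any constants $\varepsilon,\delta>0$, there is no $(2-\delta)$-approximation algorithm for Product-Metric Diameter running in time $O(N^{2-\varepsilon})$, where $N$ is the number of input vectors.
   Context: Product-Metric Diameter: the input is a set $X\subset\mathbb{R}^{d_2\times d_\infty}$ of $N$ vectors; the goal is to find (the value of) $\max_{x,y\in X}\Delta_{2,\infty}(x,y)$, where $\Delta_{2,\infty}(x,y)=\sqrt{\sum_{i=1}^{d_2}\left(\max_{j=1}^{d_\infty}|x_{i,j}-y_{i,j}|\right)^2}$. A $c$-approximation algorithm returns a value $L$ with $OPT/c\le L\le OPT$. SETH: for every $\varepsilon>0$ there exists $k\ge3$ such that $k$-SAT on $n$ variables cannot be solved in time $O(2^{(1-\varepsilon)n})$. *)

theory Defs
  imports
    Complex_Main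
    "HOL-Library.Log_Nat"
    "HOL-Library.Landau_Symbols"
    "Jordan_Normal_Form.Matrix"
begin

section \<open>Random access machines with logarithmic cost\<close>

text \<open>
  Algorithms are deterministic random access machine programs, written in structured form.  A program
  has finitely many integer registers and finitely many unbounded arrays with indirect addressing.
  Every step is charged the total bit length of the numbers it handles, addresses included.  Up to
  factors polylogarithmic in the running time and the input length this agrees with the word RAM
  with words of logarithmic length; such factors do not matter below, because
  every slack \<open>\<epsilon>\<close> in an exponent is quantified.
\<close>

datatype arith = Add | Sub | Mul | Quo | Rem

fun arith_val :: "arith \<Rightarrow> int \<Rightarrow> int \<Rightarrow> int" where
  "arith_val Add x y = x + y"
| "arith_val Sub x y = x - y"
| "arith_val Mul x y = x * y"
| "arith_val Quo x y = x div y"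
| "arith_val Rem x y = x mod y"

datatype prog =
    Skip
  | Const nat int              \<comment> \<open>\<open>r := c\<close>\<close>
  | Arith arith nat nat nat    \<comment> \<open>\<open>r := s op t\<close>\<close>
  | Load nat nat nat           \<comment> \<open>\<open>r := A[s]\<close>\<close>
  | Store nat nat nat          \<comment> \<open>\<open>A[s] := r\<close>, written \<open>Store A s r\<close>\<close>
  | Seq prog prog
  | Cond nat prog prog         \<comment> \<open>branch on \<open>0 < r\<close>\<close>
  | Loop nat prog              \<comment> \<open>repeat while \<open>0 < r\<close>\<close>

type_synonym state = "(nat \<Rightarrow> int) \<times> (nat \<Rightarrow> int \<Rightarrow> int)"

text \<open>One bit is added for the sign, so that every number, including 0, has positive length.\<close>

definition bits :: "int \<Rightarrow> nat" where
  "bits x = nat (bitlen \<bar>x\<bar>) + 1"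

inductive exec :: "prog \<Rightarrow> state \<Rightarrow> nat \<Rightarrow> state \<Rightarrow> bool" where
  skip: "exec Skip s 1 s"
| const: "exec (Const r c) (R, M) (bits c) (R(r := c), M)"
| arith: "v = arith_val f (R s) (R t) \<Longrightarrow>
    exec (Arith f r s t) (R, M) (bits (R s) + bits (R t) + bits v) (R(r := v), M)"
| load: "v = M A (R s) \<Longrightarrow>
    exec (Load r A s) (R, M) (bits (R s) + bits v) (R(r := v), M)"
| store: "exec (Store A s r) (R, M) (bits (R s) + bits (R r)) (R, M(A := (M A)(R s := R r)))"
| seq: "exec p s t s' \<Longrightarrow> exec q s' t' s'' \<Longrightarrow> exec (Seq p q) s (t + t') s''"
| cond_pos: "0 < R r \<Longrightarrow> exec p (R, M) t s' \<Longrightarrow>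
    exec (Cond r p q) (R, M) (bits (R r) + t) s'"
| cond_nonpos: "R r \<le> 0 \<Longrightarrow> exec q (R, M) t s' \<Longrightarrow>
    exec (Cond r p q) (R, M) (bits (R r) + t) s'"
| loop_pos: "0 < R r \<Longrightarrow> exec p (R, M) t s' \<Longrightarrow> exec (Loop r p) s' t' s'' \<Longrightarrow>
    exec (Loop r p) (R, M) (bits (R r) + t + t') s''"
| loop_nonpos: "R r \<le> 0 \<Longrightarrow> exec (Loop r p) (R, M) (bits (R r)) (R, M)"

text \<open>The input is a list of integers stored in array 0; everything else is initially 0.\<close>

definition initial :: "int list \<Rightarrow> state" where
  "initial w = ((\<lambda>_. 0),
     (\<lambda>A i. if A = 0 \<and> 0 \<le> i \<and> i < int (length w) then w ! nat i else 0))"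

text \<open>\<open>runs P w t R\<close>: on input \<open>w\<close>, \<open>P\<close> halts after time \<open>t\<close> with register contents \<open>R\<close>.\<close>

definition runs :: "prog \<Rightarrow> int list \<Rightarrow> nat \<Rightarrow> (nat \<Rightarrow> int) \<Rightarrow> bool" where
  "runs P w t R \<longleftrightarrow> (\<exists>M. exec P (initial w) t (R, M))"

inductive_cases exec_elims:
  "exec Skip s t s'" "exec (Const r c) s t s'" "exec (Arith f r a b) s t s'"
  "exec (Load r A a) s t s'" "exec (Store A a r) s t s'" "exec (Seq p q) s t s'"
  "exec (Cond r p q) s t s'" "exec (Loop r p) s t s'"

lemma exec_deterministic:
  "exec P s t s' \<Longrightarrow> exec P s u s'' \<Longrightarrow> u = t \<and> s'' = s'"
proof (induction arbitrary: u s'' rule: exec.induct)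
  case skip
  from skip.prems show ?case by (rule exec_elims(1)) auto
next
  case const
  from const.prems show ?case by (rule exec_elims(2)) auto
next
  case arith
  from arith.prems show ?case by (rule exec_elims(3)) (use arith.hyps in auto)
next
  case load
  from load.prems show ?case by (rule exec_elims(4)) (use load.hyps in auto)
next
  case store
  from store.prems show ?case by (rule exec_elims(5)) auto
next
  case (seq p s t s' q t' s2)
  from seq.prems show ?case
  proof (rule exec_elims(6))
    fix t1 s1 t2
    assume *: "u = t1 + t2" "exec p s t1 s1" "exec q s1 t2 s''"
    with seq.IH(1) have "t1 = t" "s1 = s'" by blast+
    with * seq.IH(2) show ?thesis by blast
  qed
next
  case (cond_pos R r p M t s' q)
  from cond_pos.prems show ?case
  proof (rule exec_elims(7))
    fix R' M' t1
    assume *: "(R, M) = (R', M')" "u = bits (R' r) + t1" "exec p (R', M') t1 s''"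
    with cond_pos.IH have "t1 = t" "s'' = s'" by blast+
    with * show ?thesis by simp
  qed (use cond_pos.hyps in simp_all)
next
  case (cond_nonpos R r q M t s' p)
  from cond_nonpos.prems show ?case
  proof (rule exec_elims(7))
    fix R' M' t1
    assume *: "(R, M) = (R', M')" "u = bits (R' r) + t1" "exec q (R', M') t1 s''"
    with cond_nonpos.IH have "t1 = t" "s'' = s'" by blast+
    with * show ?thesis by simp
  qed (use cond_nonpos.hyps in simp_all)
next
  case (loop_pos R r p M t s' t' s2)
  from loop_pos.prems show ?case
  proof (rule exec_elims(8))
    fix R' M' t1 s1 t2
    assume *: "(R, M) = (R', M')" "u = bits (R' r) + t1 + t2"
      "exec p (R', M') t1 s1" "exec (Loop r p) s1 t2 s''"
    with loop_pos.IH(1) have "t1 = t" "s1 = s'" by blast+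
    moreover from this * loop_pos.IH(2) have "t2 = t'" "s'' = s2" by blast+
    ultimately show ?thesis using *(1,2) by simp
  qed (use loop_pos.hyps in simp_all)
next
  case (loop_nonpos R r p M)
  from loop_nonpos.prems show ?case
  proof (rule exec_elims(8))
  qed (use loop_nonpos.hyps in simp_all)
qed

section \<open>The strong exponential time hypothesis\<close>

text \<open>
  Literals are nonzero integers: \<open>v\<close> and \<open>- v\<close> are the positive and negative literals of the variable
  \<open>v\<close>, where \<open>1 \<le> v \<le> n\<close>.  A formula is a set of clauses and a clause a set of literals, both given
  by duplicate-free lists; otherwise the length of a formula would not be bounded in terms of \<open>n\<close>
  and a time bound in terms of \<open>n\<close> alone would be meaningless.
\<close>

definition is_kcnf :: "nat \<Rightarrow> nat \<Rightarrow> int list list \<Rightarrow> bool" where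
  "is_kcnf k n F \<longleftrightarrow> distinct (map set F) \<and>
     (\<forall>c\<in>set F. distinct c \<and> length c \<le> k \<and> (\<forall>l\<in>set c. l \<noteq> 0 \<and> \<bar>l\<bar> \<le> int n))"

definition satisfiable :: "int list list \<Rightarrow> bool" where
  "satisfiable F \<longleftrightarrow>
     (\<exists>\<alpha> :: nat \<Rightarrow> bool. \<forall>c\<in>set F. \<exists>l\<in>set c. if 0 < l then \<alpha> (nat l) else \<not> \<alpha> (nat (- l)))"

definition encode_cnf :: "nat \<Rightarrow> int list list \<Rightarrow> int list" where
  "encode_cnf n F = int n # int (length F) # concat (map (\<lambda>c. int (length c) # c) F)"

definition solves_ksat :: "nat \<Rightarrow> prog \<Rightarrow> bool" where
  "solves_ksat k P \<longleftrightarrow> (\<forall>n F. is_kcnf k n F \<longrightarrow>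
     (\<exists>t R. runs P (encode_cnf n F) t R \<and> (R 0 \<noteq> 0 \<longleftrightarrow> satisfiable F)))"

definition ksat_time :: "nat \<Rightarrow> prog \<Rightarrow> (nat \<Rightarrow> real) \<Rightarrow> bool" where
  "ksat_time k P f \<longleftrightarrow> (\<exists>T \<in> O(f). \<forall>n F t R.
     is_kcnf k n F \<and> runs P (encode_cnf n F) t R \<longrightarrow> real t \<le> T n)"

definition SETH :: bool where
  "SETH \<longleftrightarrow> (\<forall>\<epsilon>::real. \<epsilon> > 0 \<longrightarrow> (\<exists>k\<ge>3.
     \<not> (\<exists>P. solves_ksat k P \<and> ksat_time k P (\<lambda>n. 2 powr ((1 - \<epsilon>) * real n)))))"

section \<open>Product-Metric Diameter\<close>

definition product_dist :: "nat \<Rightarrow> nat \<Rightarrow> real mat \<Rightarrow> real mat \<Rightarrow> real" where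
  "product_dist d2 dinf x y =
     sqrt (\<Sum>i<d2. (Max ((\<lambda>j. \<bar>x $$ (i, j) - y $$ (i, j)\<bar>) ` {..<dinf}))\<^sup>2)"

definition product_diameter :: "nat \<Rightarrow> nat \<Rightarrow> real mat set \<Rightarrow> real" where
  "product_diameter d2 dinf X = Max {product_dist d2 dinf x y | x y. x \<in> X \<and> y \<in> X}"

text \<open>
  The instances that can be given to a machine are those with rational coordinates.  The set of \<open>N\<close>
  vectors is presented as a duplicate-free list, in arbitrary order.
\<close>

definition is_instance :: "nat \<Rightarrow> nat \<Rightarrow> rat mat list \<Rightarrow> bool" where
  "is_instance d2 dinf xs \<longleftrightarrow>
     1 \<le> d2 \<and> 1 \<le> dinf \<and> xs \<noteq> [] \<and> distinct xs \<and> set xs \<subseteq> carrier_mat d2 dinf"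

definition points :: "rat mat list \<Rightarrow> real mat set" where
  "points xs = map_mat real_of_rat ` set xs"

definition encode_rat :: "rat \<Rightarrow> int list" where
  "encode_rat q = [fst (quotient_of q), snd (quotient_of q)]"

definition encode_vector :: "rat mat \<Rightarrow> int list" where
  "encode_vector x =
     concat [encode_rat (x $$ (i, j)). i \<leftarrow> [0..<dim_row x], j \<leftarrow> [0..<dim_col x]]"

definition encode_instance :: "nat \<Rightarrow> nat \<Rightarrow> rat mat list \<Rightarrow> int list" where
  "encode_instance d2 dinf xs =
     int (length xs) # int d2 # int dinf # concat (map encode_vector xs)"

definition vector_bits :: "rat mat \<Rightarrow> nat" where
  "vector_bits x = sum_list (map bits (encode_vector x))"

text \<open>
  The value \<open>L\<close> returned by a program is given through its square, as the quotient of registers 0 and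
  1.  Every nonnegative rational can be returned in this way, and so can the optimum itself, which
  for rational points is the square root of a rational.
\<close>

definition returned_value :: "(nat \<Rightarrow> int) \<Rightarrow> real" where
  "returned_value R = sqrt (of_int (R 0) / of_int (R 1))"

text \<open>Without \<open>1 \<le> c\<close>, returning 0 would be a \<open>c\<close>-approximation for every \<open>c \<le> 0\<close>.\<close>

definition diameter_approximation :: "real \<Rightarrow> prog \<Rightarrow> bool" where
  "diameter_approximation c P \<longleftrightarrow> 1 \<le> c \<and> (\<forall>d2 dinf xs. is_instance d2 dinf xs \<longrightarrow>
     (\<exists>t R. runs P (encode_instance d2 dinf xs) t R \<and>
        product_diameter d2 dinf (points xs) / c \<le> returned_value R \<and>
        returned_value R \<le> product_diameter d2 dinf (points xs)))"

definition subpolynomial :: "(nat \<Rightarrow> nat) \<Rightarrow> bool" where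
  "subpolynomial D \<longleftrightarrow>
     (\<forall>\<gamma>::real. \<gamma> > 0 \<longrightarrow> (\<lambda>N. real (D N)) \<in> O(\<lambda>N. real N powr \<gamma>))"

text \<open>
  A running time stated in terms of the number \<open>N\<close> of vectors alone follows the usual convention that a
  single vector has description size \<open>N\<^bsup>o(1)\<^esup>\<close>, which covers both its dimension and the
  lengths of its coordinates.  With vectors of unbounded size no program could even read its input
  within such a bound.  A program with a bound valid for vectors of all sizes meets this definition
  in particular.
\<close>

definition diameter_time :: "prog \<Rightarrow> (nat \<Rightarrow> real) \<Rightarrow> bool" where
  "diameter_time P f \<longleftrightarrow> (\<forall>D. subpolynomial D \<longrightarrow> (\<exists>T \<in> O(f). \<forall>d2 dinf xs t R.
     is_instance d2 dinf xs \<and> (\<forall>x\<in>set xs. vector_bits x \<le> D (length xs)) \<and>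
     runs P (encode_instance d2 dinf xs) t R \<longrightarrow> real t \<le> T (length xs)))"

end

theory Submission
  imports Defs "HOL-Computational_Algebra.Polynomial" "HOL-Number_Theory.Cong" "HOL-Real_Asymp.Real_Asymp"
begin

text \<open>
  A \<open>k\<close>-CNF formula on \<open>n\<close> variables is turned into a single instance with \<open>2\<^bsup>n/2 + o(n)\<^esup>\<close> vectors of
  dimension \<open>2\<^bsup>o(n)\<^esup>\<close>.  The variables are split into \<open>h\<close> = polylog(\<open>n\<close>) blocks, so that every clause lies
  in one of \<open>E = h\<^bsup>k\<^esup>\<close> batches of \<open>k\<close> blocks; a batch involves only \<open>w = O(k n / h) = o(n)\<close> variables.  For
  an assignment \<open>z\<close> let the polynomials \<open>\<zeta>\<^sub>\<sigma>\<close> (\<open>\<sigma> < w\<close>) interpolate the variables of the batches \<open>0, ..., E - 1\<close>.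
  The number of violated clauses of a batch is a polynomial of degree \<open>k\<close> in its variables, which gives a
  polynomial \<open>V\<close> of degree \<open>O(k E)\<close> in one variable that vanishes at \<open>0, ..., E - 1\<close> iff \<open>z\<close> satisfies the
  formula, and then \<open>V = Z H\<close> with \<open>Z = (X - 0) ... (X - (E - 1))\<close>.  All this is reduced modulo a prime \<open>q\<close>
  that exceeds the number of clauses.

  Alice's vectors are indexed by an assignment \<open>x\<close> of the first half of the variables and a guess for \<open>H\<close>, Bob's
  by an assignment \<open>y\<close> of the second half.  The rows are the points \<open>r < q\<close>.  In row \<open>r\<close>, the columns are the
  messages that Alice can send: Alice has 1 at her message \<open>(\<zeta>\<^sub>\<sigma>(r) for x, Z(r) H(r))\<close> and 0
  elsewhere, and Bob has -1 at the messages for which \<open>V(r) = Z(r) H(r)\<close> together with his share of \<open>\<zeta>\<^sub>\<sigma>(r)\<close>.  The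
  maximum over row \<open>r\<close> is 2 if Bob accepts Alice's message at \<open>r\<close> and at most 1 otherwise.  For a satisfying
  assignment Bob accepts at all \<open>r\<close>; for an unsatisfiable formula he accepts only at \<open>O(k E) = o(q)\<close> points, as
  \<open>V - Z H\<close> is nonzero.  This is a gap of almost 2 between the diameters, and as
  the number of clauses does not affect the dimension much, no sparsification is needed.
\<close>

text \<open>The matrices carry out a Merlin-Arthur protocol between two players who hold half of an
  assignment each: the guess for \<open>H\<close> is Merlin's advice, a row is a random point, a
  column is a possible message. The squared distance of an Alice vector from a Bob vector
  essentially counts accepting rows, so acceptance probability turns into diameter. The message can
  be that simple because \<open>zeta\<close> is linear in the assignment: the values for
  \<open>x\<close> and for \<open>y\<close> just add up, and everything of higher degree is left to
  Bob.

  Two costs pull against each other. There are q^(w + 1) columns, and w log q is about k n log n /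
  h, which is o(n) only if \<open>h\<close> outgrows log n. The advice consists of about k h^k
  residues modulo \<open>q\<close>, so h^k must stay well below n / log n. Hence \<open>h\<close> is
  the square of a logarithm. Rows are cheap, so all residues modulo \<open>q\<close> are used;
  \<open>q\<close> exceeds the number of batches by at least a constant factor chosen from \<delta>,
  and that factor brings the gap close to 2.\<close>

section \<open>A prime in every interval from B to 2 B^2 + 1\<close>

text \<open>
  The entries \<open>1 / (i * (i - 1 choose j))\<close> of Leibniz's harmonic triangle are differences of neighbouring
  entries, starting from \<open>1 / i\<close>; hence a common multiple of the \<open>i\<close> clears all their denominators.
\<close>

lemma Lcm_times_leibniz_Ints:
  assumes "j < i" "i \<le> n"
  shows "real (Lcm {1..n}) / (real i * real ((i - 1) choose j)) \<in> \<int>"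
  using assms
proof (induction j arbitrary: i)
  case 0
  then have "i dvd Lcm {1..n}" by (intro dvd_Lcm) auto
  then obtain c where "Lcm {1..n} = i * c" by (auto elim: dvdE)
  then show ?case using 0 by simp
next
  case (Suc j)
  obtain a where i: "i = Suc (Suc a)" and ja: "j \<le> a" using Suc.prems by (cases i; cases "i - 1") auto
  define X where "X = real (a choose j)"
  have X: "X > 0" using ja by (simp add: X_def)
  have 1: "real ((i - 1) choose Suc j) = (real a + 1) / (real j + 1) * X"
  proof -
    have "real (Suc j * (Suc a choose Suc j)) = real (Suc a * (a choose j))"
      by (simp only: Suc_times_binomial_eq mult.commute)
    then have "(real j + 1) * real (Suc a choose Suc j) = (real a + 1) * X"
      unfolding X_def of_nat_mult by (simp del: binomial_Suc_Suc add: add.commute)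
    then show ?thesis unfolding i by (simp del: binomial_Suc_Suc add: field_simps)
  qed
  have 3: "real a + 1 - real j > 0" using ja by simp
  have 2: "real ((i - 1) choose j) = (real a + 1) / (real a + 1 - real j) * X"
  proof -
    have "real ((Suc a - j) * (Suc a choose j)) = real (Suc a * (a choose j))"
      using binomial_absorb_comp[of "Suc a" j] by simp
    then have "(real a + 1 - real j) * real (Suc a choose j) = (real a + 1) * X"
      unfolding X_def of_nat_mult using ja by (simp add: of_nat_diff algebra_simps)
    then show ?thesis unfolding i using 3 by (simp add: field_simps)
  qed
  \<comment> \<open>All three binomials are multiples of \<open>X\<close>, so the recurrence of the
    triangle is an identity of rational functions; up to the common factor \<open>K\<close> it reads
    J + 1 = (A + 2) - (A + 1 - J).\<close>
  have e: "L / ((A + 2) * ((A + 1) / (J + 1) * x)) =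
      L / ((A + 1) * x) - L / ((A + 2) * ((A + 1) / (A + 1 - J) * x))"
    if "x > 0" "A + 1 - J > 0" "J \<ge> 0" for L A J x :: real
  proof -
    have nz: "A + 1 \<noteq> 0" "A + 2 \<noteq> 0" "J + 1 \<noteq> 0" "x \<noteq> 0" "A + 1 - J \<noteq> 0" using that by auto
    define K where "K = L / ((A + 1) * (A + 2) * x)"
    have "L / ((A + 2) * ((A + 1) / (J + 1) * x)) = K * (J + 1)"
      "L / ((A + 1) * x) = K * (A + 2)"
      "L / ((A + 2) * ((A + 1) / (A + 1 - J) * x)) = K * (A + 1 - J)"
      unfolding K_def using nz by simp_all
    then show ?thesis by (simp add: algebra_simps)
  qed
  have r: "real i = real a + 2" "real (Suc a) = real a + 1" using i by simp_all
  have "real (Lcm {1..n}) / (real i * real ((i - 1) choose Suc j)) =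
      real (Lcm {1..n}) / (real (Suc a) * real ((Suc a - 1) choose j)) - real (Lcm {1..n}) / (real i * real ((i - 1) choose j))"
    unfolding 1 2 r diff_Suc_1 X_def[symmetric] by (rule e) (use X 3 in auto)
  then show ?case
    by (simp only:) (intro Ints_diff Suc.IH; use Suc.prems i ja in auto)
qed

text \<open>The central entry of a row of the triangle shows that the Lcm is a positive multiple of
  (2 m + 1) (2 m choose m), and the central binomial coefficient is at least 4^m / (2 m).\<close>

lemma Lcm_ge_power4: "4 ^ m \<le> Lcm {1..2 * m + 1}"
proof (cases "m = 0")
  case False
  let ?n = "2 * m + 1"
  define x where "x = real (Lcm {1..?n}) / (real ?n * real ((?n - 1) choose m))"
  have "Lcm {1..?n} > 0" by (intro Nat.gr0I) (auto simp: Lcm_0_iff)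
  then have "x > 0" by (simp add: x_def)
  moreover have "x \<in> \<int>"
    unfolding x_def by (rule Lcm_times_leibniz_Ints) auto
  ultimately have "1 \<le> x" using Ints_nonzero_abs_ge1[of x] by simp
  then have "real ?n * real ((2 * m) choose m) \<le> real (Lcm {1..?n})"
    by (simp add: x_def le_divide_eq)
  moreover have "4 ^ m / (2 * real m) \<le> real ((2 * m) choose m)"
    using False by (intro central_binomial_lower_bound) auto
  then have "4 ^ m \<le> real ((2 * m) choose m) * (2 * real m)" using False by (simp add: field_simps)
  moreover have "\<dots> \<le> real ?n * real ((2 * m) choose m)" by (simp add: algebra_simps)
  ultimately have "real (4 ^ m) \<le> real (Lcm {1..?n})" unfolding of_nat_power of_nat_numeral by linarith
  then show ?thesis by (simp only: of_nat_le_iff)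
next
  case True
  then show ?thesis by simp
qed

lemma prime_power_dvd_Lcm:
  fixes S :: "nat set"
  assumes "finite S" "0 \<notin> S" "prime p" "p ^ a dvd Lcm S" "a > 0"
  shows "\<exists>x\<in>S. p ^ a dvd x"
  using assms
proof (induction S)
  case (insert x S)
  have nz: "x \<noteq> 0" "Lcm S \<noteq> 0" using insert by (auto simp: Lcm_0_iff)
  have "p ^ a dvd lcm x (Lcm S)" using insert by simp
  then have "a \<le> multiplicity p (lcm x (Lcm S))"
    using nz insert by (intro multiplicity_geI) (auto simp: lcm_eq_0_iff)
  also have "\<dots> = max (multiplicity p x) (multiplicity p (Lcm S))"
    using nz insert by (intro multiplicity_lcm) auto
  finally have "p ^ a dvd x \<or> p ^ a dvd Lcm S"
    unfolding le_max_iff_disj using multiplicity_dvd' by blast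
  then show ?case using insert by auto
next
  case empty
  then have "p ^ a = 1" by (simp only: Lcm_empty nat_dvd_1_iff_1)
  then have "p = 1" using \<open>a > 0\<close> by (simp add: nat_power_eq_Suc_0_iff)
  then show ?case using \<open>prime p\<close> by simp
qed

text \<open>Each maximal prime power in the Lcm divides one of the numbers up to \<open>n\<close>,
  hence is at most \<open>n\<close>; the primes lie in {1..B}, so there are at most \<open>B\<close>
  such factors.\<close>

lemma Lcm_le_power:
  assumes no: "\<And>p. prime p \<Longrightarrow> p \<le> n \<Longrightarrow> p \<le> B" and n: "n \<ge> 1"
  shows "Lcm {1..n} \<le> n ^ B"
proof -
  let ?L = "Lcm {1..n}"
  have L: "?L \<noteq> 0" by (auto simp: Lcm_0_iff)
  have le: "p ^ multiplicity p ?L \<le> n \<and> p \<le> n" if "p \<in> prime_factors ?L" for p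
  proof -
    have p: "prime p" "p dvd ?L" using that by auto
    then have "multiplicity p ?L > 0" using L by (simp add: prime_multiplicity_gt_zero_iff)
    then obtain x where "x \<in> {1..n}" "p ^ multiplicity p ?L dvd x"
      using prime_power_dvd_Lcm[OF _ _ p(1) multiplicity_dvd[of p ?L]] by fastforce
    moreover from this have "p ^ multiplicity p ?L \<le> x" by (intro dvd_imp_le) auto
    moreover have "p \<le> p ^ multiplicity p ?L"
      using \<open>multiplicity p ?L > 0\<close> prime_ge_1_nat[OF p(1)] by (intro self_le_power)
    ultimately show ?thesis by auto
  qed
  have "?L = (\<Prod>p\<in>prime_factors ?L. p ^ multiplicity p ?L)"
    using prime_factorization_nat[of ?L] L by blast
  also have "\<dots> \<le> (\<Prod>p\<in>prime_factors ?L. n)" by (rule prod_mono) (use le in blast)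
  also have "\<dots> = n ^ card (prime_factors ?L)" by simp
  also have "\<dots> \<le> n ^ card {1..B}"
  proof (intro power_increasing card_mono)
    show "prime_factors ?L \<subseteq> {1..B}"
    proof
      fix p assume p: "p \<in> prime_factors ?L"
      then have "prime p" by auto
      then show "p \<in> {1..B}" using le[OF p] no[of p] prime_ge_1_nat[of p] by auto
    qed
  qed (use n in auto)
  finally show ?thesis by simp
qed

text \<open>Without such a prime, the two bounds on the Lcm of 1, ..., 2 B^2 + 1 contradict each
  other: 4^(B^2) from below and (2 B^2 + 1)^B from above. The modulus only has to be polynomial in
  \<open>n\<close>, so a quadratic interval is as good as Bertrand's.\<close>

lemma exists_prime_between:
  assumes "B \<ge> 1"
  shows "\<exists>p. prime p \<and> B < p \<and> p \<le> 2 * B ^ 2 + (1::nat)"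
proof (rule ccontr)
  assume "\<not> ?thesis"
  then have "p \<le> B" if "prime p" "p \<le> 2 * B ^ 2 + 1" for p using that by (meson not_le)
  then have "Lcm {1..2 * B ^ 2 + 1} \<le> (2 * B ^ 2 + 1) ^ B" by (intro Lcm_le_power) simp_all
  moreover have "4 ^ (B ^ 2) \<le> Lcm {1..2 * B ^ 2 + 1}" by (rule Lcm_ge_power4)
  moreover have "2 * B ^ 2 + 1 < 4 ^ B"
    using assms
  proof (induction B rule: dec_induct)
    case (step B)
    have "B \<le> B * B" by simp
    then have "2 * (Suc B) ^ 2 + 1 \<le> 4 * (2 * B ^ 2 + 1)" by (simp add: power2_eq_square, linarith)
    then show ?case using step by simp
  qed auto
  then have "(2 * B ^ 2 + 1) ^ B < (4 ^ B) ^ B" using assms by (intro power_strict_mono) auto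
  moreover have "(4 ^ B) ^ B = (4 :: nat) ^ (B ^ 2)" by (simp add: power2_eq_square power_mult)
  ultimately show False by linarith
qed

section \<open>Digits and polynomials\<close>

definition dig :: "nat \<Rightarrow> nat \<Rightarrow> nat \<Rightarrow> nat" where
  "dig b a v = (a div b ^ v) mod b"

lemma dig_less: "b > 0 \<Longrightarrow> dig b a v < b"
  by (simp add: dig_def)

lemma digits_sum:
  assumes "\<And>i. i < l \<Longrightarrow> f i < b"
  shows "(\<Sum>i<l. f i * b ^ i) < b ^ l" and "\<And>i. i < l \<Longrightarrow> dig b (\<Sum>i<l. f i * b ^ i) i = f i"
proof -
  have "(\<Sum>i<l. f i * b ^ i) < b ^ l \<and> (\<forall>i<l. dig b (\<Sum>i<l. f i * b ^ i) i = f i)"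
    using assms
  proof (induction l)
    case (Suc l)
    define S where "S = (\<Sum>i<l. f i * b ^ i)"
    have S: "S < b ^ l" "\<And>i. i < l \<Longrightarrow> dig b S i = f i" using Suc by (auto simp: S_def)
    have b: "f l < b" "b > 0" using Suc.prems[of l] by auto
    have "S + f l * b ^ l < b ^ l + f l * b ^ l" using S by simp
    also have "\<dots> = Suc (f l) * b ^ l" by simp
    also have "\<dots> \<le> b * b ^ l" using b by (intro mult_right_mono) auto
    finally have "S + f l * b ^ l < b ^ Suc l" by simp
    moreover have "dig b (S + f l * b ^ l) i = f i" if "i < Suc l" for i
    proof (cases "i = l")
      case True
      then show ?thesis using S b by (simp add: dig_def)
    next
      case False
      then have i: "i < l" using that by simp
      then have "b ^ l = b * b ^ (l - Suc i) * b ^ i"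
        by (metis Suc_leI le_add_diff_inverse2 mult.commute power_Suc power_add add_Suc_right mult.assoc)
      then have "(S + f l * b ^ l) div b ^ i = S div b ^ i + f l * (b * b ^ (l - Suc i))"
        using b by (simp add: mult.assoc[symmetric])
      then have "dig b (S + f l * b ^ l) i = dig b S i"
        by (simp add: dig_def mult.left_commute)
      then show ?thesis using S(2)[OF i] by simp
    qed
    ultimately show ?case by (simp add: S_def)
  qed auto
  then show "(\<Sum>i<l. f i * b ^ i) < b ^ l" and "\<And>i. i < l \<Longrightarrow> dig b (\<Sum>i<l. f i * b ^ i) i = f i" by auto
qed

text \<open>Lagrange's root bound, carried out with integer polynomials: at a root \<open>a\<close>
  modulo \<open>q\<close>, the polynomial f - f(a) splits off X - a over the integers, and the
  quotient inherits the point \<open>x0\<close> of non-vanishing. Soundness supplies such a point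
  rather than a nonzero coefficient.\<close>

lemma card_roots_mod_prime:
  fixes f :: "int poly"
  assumes "prime q" "\<not> int q dvd poly f x0"
  shows "card {r. r < q \<and> int q dvd poly f (int r)} \<le> degree f"
  using assms(2)
proof (induction "degree f" arbitrary: f)
  case 0
  then obtain c where "f = [:c:]" by (metis degree_eq_zeroE)
  then show ?case using 0 by auto
next
  case (Suc D)
  show ?case
  proof (cases "\<exists>a<q. int q dvd poly f (int a)")
    case False
    then have "{r. r < q \<and> int q dvd poly f (int r)} = {}" by auto
    then show ?thesis by (simp only: card.empty)
  next
    case True
    then obtain a where a: "a < q" "int q dvd poly f (int a)" by auto
    have "poly (f - [:poly f (int a):]) (int a) = 0" by simp
    then obtain g where "f - [:poly f (int a):] = [:- int a, 1:] * g"
      unfolding poly_eq_0_iff_dvd by (auto elim: dvdE)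
    then have f: "f = [:- int a, 1:] * g + [:poly f (int a):]" by (simp add: algebra_simps)
    have pf: "poly f x = (x - int a) * poly g x + poly f (int a)" for x
      by (subst f) (simp add: algebra_simps)
    have g0: "g \<noteq> 0"
    proof
      assume "g = 0"
      with f have "f = [:poly f (int a):]" by simp
      then have "degree f = 0" by (metis degree_pCons_0)
      then show False using Suc(2) by simp
    qed
    have dg1: "degree ([:- int a, 1:] * g) = Suc (degree g)" using g0 by (subst degree_mult_eq) auto
    have dg: "degree f = Suc (degree g)"
      by (subst f, subst degree_add_eq_left) (simp_all only: dg1 degree_pCons_0 zero_less_Suc)
    have "\<not> int q dvd poly g x0"
    proof
      assume "int q dvd poly g x0"
      then have "int q dvd (x0 - int a) * poly g x0 + poly f (int a)" using a(2) by simp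
      then show False using Suc.prems pf[of x0] by metis
    qed
    then have IH: "card {r. r < q \<and> int q dvd poly g (int r)} \<le> degree g"
      using Suc.hyps(1)[of g] Suc.hyps(2) dg by simp
    have "{r. r < q \<and> int q dvd poly f (int r)} \<subseteq> insert a {r. r < q \<and> int q dvd poly g (int r)}"
    proof
      fix r assume r: "r \<in> {r. r < q \<and> int q dvd poly f (int r)}"
      show "r \<in> insert a {r. r < q \<and> int q dvd poly g (int r)}"
      proof (cases "r = a")
        case False
        have "int q dvd (int r - int a) * poly g (int r) + poly f (int a)"
          using r pf[of "int r"] by (metis mem_Collect_eq)
        then have "int q dvd (int r - int a) * poly g (int r)"
          using a(2) dvd_add_left_iff by blast
        moreover have "\<not> int q dvd int r - int a"
        proof
          assume "int q dvd int r - int a"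
          moreover have "int r - int a \<noteq> 0" using False by simp
          ultimately have "\<bar>int q\<bar> \<le> \<bar>int r - int a\<bar>" by (rule dvd_imp_le_int[rotated])
          then show False using r a(1) by (auto simp: abs_if split: if_splits)
        qed
        moreover have "prime (int q)" using assms(1) by simp
        ultimately have "int q dvd poly g (int r)" using prime_dvd_multD by blast
        then show ?thesis using r by blast
      qed simp
    qed
    then have "card {r. r < q \<and> int q dvd poly f (int r)} \<le> card (insert a {r. r < q \<and> int q dvd poly g (int r)})"
      by (intro card_mono) auto
    also have "\<dots> \<le> Suc (card {r. r < q \<and> int q dvd poly g (int r)})" by (rule card_insert_le_m1) auto
    finally show ?thesis using IH dg by simp
  qed
qed

lemma prod_linear_dvd:
  fixes p :: "int poly"
  assumes "\<And>i. i < E \<Longrightarrow> poly p (int i) = 0"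
  shows "(\<Prod>i<E. [:- int i, 1:]) dvd p"
  using assms
proof (induction E)
  case (Suc E)
  then obtain g where g: "p = (\<Prod>i<E. [:- int i, 1:]) * g" by (auto elim: dvdE)
  have "poly p (int E) = 0" using Suc by simp
  then have "(\<Prod>i<E. int E - int i) * poly g (int E) = 0" unfolding g by (simp add: poly_prod)
  moreover have "(\<Prod>i<E. int E - int i) \<noteq> 0" by auto
  ultimately have "[:- int E, 1:] dvd g" by (simp add: poly_eq_0_iff_dvd)
  then show ?case unfolding g prod.lessThan_Suc by (intro mult_dvd_mono dvd_refl)
qed simp

text \<open>Clauses are padded to length \<open>k\<close> by the literal 0, which is always false.\<close>

definition lit :: "int list list \<Rightarrow> nat \<Rightarrow> nat \<Rightarrow> int" where
  "lit F c j = (if j < length (F ! c) then F ! c ! j else 0)"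

text \<open>Zero-based. The padding literal 0 gets index 0, so that every place of a clause has a
  block.\<close>

definition var :: "int \<Rightarrow> nat" where
  "var l = nat (\<bar>l\<bar> - 1)"

definition falsity :: "(nat \<Rightarrow> int) \<Rightarrow> int \<Rightarrow> int" where
  "falsity z l = (if l > 0 then 1 - z (var l) else if l < 0 then z (var l) else 1)"

text \<open>
  The Lagrange basis for the nodes \<open>0, ..., E - 1\<close> without its denominators, so that no inverses modulo \<open>q\<close>
  are needed.  The polynomial \<open>up E\<close> accordingly interpolates the constant 1, and arithmetized formulas are
  kept homogeneous.
\<close>

definition mp :: "nat \<Rightarrow> nat \<Rightarrow> int poly" where
  "mp E e = (\<Prod>i<E. if i = e then 1 else [:- int i, 1:])"

definition up :: "nat \<Rightarrow> int poly" where
  "up E = (\<Sum>e<E. mp E e)"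

definition zp :: "nat \<Rightarrow> int poly" where
  "zp E = (\<Prod>i<E. [:- int i, 1:])"

lemma poly_mp: "poly (mp E e) x = (\<Prod>i<E. if i = e then 1 else x - int i)"
  by (auto simp: mp_def poly_prod intro!: prod.cong)

lemma poly_up: "poly (up E) x = (\<Sum>e<E. poly (mp E e) x)"
  by (simp add: up_def poly_sum)

lemma poly_zp: "poly (zp E) x = (\<Prod>i<E. x - int i)"
  by (simp add: zp_def poly_prod)

lemma degree_mp: "degree (mp E e) \<le> E"
proof -
  have "degree (mp E e) \<le> sum (degree \<circ> (\<lambda>i. if i = e then 1 else [:- int i, 1:])) {..<E}"
    unfolding mp_def by (rule degree_prod_sum_le) auto
  also have "\<dots> \<le> (\<Sum>i<E. 1)" by (intro sum_mono) auto
  finally show ?thesis by simp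
qed

lemma degree_zp: "degree (zp E) = E"
  unfolding zp_def by (subst degree_prod_eq_sum_degree) auto

lemma mp_other: "e' < E \<Longrightarrow> e' \<noteq> e \<Longrightarrow> poly (mp E e) (int e') = 0"
  unfolding poly_mp by (rule prod_zero[OF _ bexI[of _ e']]) auto

text \<open>Without the Lagrange denominators every value at a node carries this factor. It is
  harmless modulo \<open>q\<close>, being a product of nonzero differences smaller than
  \<open>q\<close>.\<close>

lemma mp_self_coprime:
  assumes "prime q" "e < E" "E \<le> q"
  shows "\<not> int q dvd poly (mp E e) (int e)"
proof
  assume "int q dvd poly (mp E e) (int e)"
  then have "\<exists>i\<in>{..<E}. int q dvd (if i = e then 1 else int e - int i)"
    unfolding poly_mp using assms(1) by (subst (asm) prime_dvd_prod_iff) auto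
  then obtain i where i: "i < E" "int q dvd (if i = e then 1 else int e - int i)" by auto
  show False
  proof (cases "i = e")
    case True
    then show ?thesis using i assms(1) by auto
  next
    case False
    then have "int q dvd int e - int i" "int e - int i \<noteq> 0" using i by auto
    then have "\<bar>int q\<bar> \<le> \<bar>int e - int i\<bar>" by (intro dvd_imp_le_int)
    then show False using i assms by auto
  qed
qed

lemma up_at: "e < E \<Longrightarrow> poly (up E) (int e) = poly (mp E e) (int e)"
  unfolding poly_up by (subst sum.remove[of _ e]) (auto simp: mp_other intro!: sum.neutral)

section \<open>The arithmetized formula\<close>

text \<open>\<open>length F < q\<close> keeps the number of violated clauses of a batch nonzero
  modulo \<open>q\<close>, and \<open>h ^ k < q\<close> keeps the nodes distinct modulo
  \<open>q\<close>.\<close>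

locale protocol =
  fixes n k :: nat and F :: "int list list" and h q hn :: nat
  assumes k: "k \<ge> 1" and h: "h \<ge> 1" and hn: "n \<le> 2 * hn" and q: "prime q"
    and Fq: "length F < q" and Eq: "h ^ k < q" and F: "is_kcnf k n F"
begin

definition "E = h ^ k"
definition "W = n div h + 1"
definition "w = k * W"
text \<open>The number of coefficients reserved for the quotient \<open>H\<close>, from the degree
  of \<open>V\<close>.\<close>

definition "d = (k + 1) * E + 1"
definition "m = length F"

text \<open>The \<open>i\<close>-th base \<open>h\<close> digit of the batch names the block of the
  \<open>i\<close>-th literal. So the \<open>i\<close>-th block of a batch is reserved for the
  \<open>i\<close>-th literals of its clauses.\<close>

definition bat :: "nat \<Rightarrow> nat" where
  "bat c = (\<Sum>i<k. (var (lit F c i) mod h) * h ^ i)"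

text \<open>
  Variable \<open>v\<close> has index \<open>v div h\<close> in block \<open>v mod h\<close>.  Batch \<open>e\<close> consists of the blocks given by the base
  \<open>h\<close> digits of \<open>e\<close>, and \<open>slot \<sigma> e\<close> is the variable at place \<open>\<sigma> < w\<close> of batch \<open>e\<close>.
\<close>

definition slot :: "nat \<Rightarrow> nat \<Rightarrow> nat" where
  "slot \<sigma> e = dig h e (\<sigma> div W) + h * (\<sigma> mod W)"

definition zeta :: "(nat \<Rightarrow> int) \<Rightarrow> nat \<Rightarrow> int poly" where
  "zeta z \<sigma> = (\<Sum>e<E. smult (z (slot \<sigma> e)) (mp E e))"

text \<open>The numeric version is what Bob computes from the values he is sent. Its polynomial
  counterparts \<open>litp\<close> and \<open>viol\<close> serve the arguments about degrees and
  divisibility.\<close>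

definition litv :: "int \<Rightarrow> (nat \<Rightarrow> int) \<Rightarrow> nat \<Rightarrow> nat \<Rightarrow> int" where
  "litv x \<zeta> c i = (let l = lit F c i; \<sigma> = i * W + var l div h in
     if l > 0 then poly (up E) x - \<zeta> \<sigma> else if l < 0 then \<zeta> \<sigma> else poly (up E) x)"

definition violv :: "int \<Rightarrow> (nat \<Rightarrow> int) \<Rightarrow> int" where
  "violv x \<zeta> = (\<Sum>c<m. poly (mp E (bat c)) x * (\<Prod>i<k. litv x \<zeta> c i))"

definition litp :: "(nat \<Rightarrow> int poly) \<Rightarrow> nat \<Rightarrow> nat \<Rightarrow> int poly" where
  "litp \<zeta> c i = (let l = lit F c i; \<sigma> = i * W + var l div h in
     if l > 0 then up E - \<zeta> \<sigma> else if l < 0 then \<zeta> \<sigma> else up E)"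

definition viol :: "(nat \<Rightarrow> int poly) \<Rightarrow> int poly" where
  "viol \<zeta> = (\<Sum>c<m. mp E (bat c) * (\<Prod>i<k. litp \<zeta> c i))"

lemma poly_viol: "poly (viol \<zeta>) x = violv x (\<lambda>\<sigma>. poly (\<zeta> \<sigma>) x)"
  by (simp add: viol_def violv_def poly_sum poly_prod litp_def litv_def Let_def if_distrib[of "\<lambda>p. poly p x"] cong: if_cong)

lemma W_pos: "W > 0" and h_pos: "h > 0"
  using h by (simp_all add: W_def)

lemma clause:
  assumes "c < m"
  shows "length (F ! c) \<le> k" "l \<in> set (F ! c) \<Longrightarrow> l \<noteq> 0 \<and> \<bar>l\<bar> \<le> int n"
  using F assms by (auto simp: is_kcnf_def m_def)

lemma var_lit_div: "c < m \<Longrightarrow> var (lit F c i) div h < W"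
proof -
  assume c: "c < m"
  have "var (lit F c i) \<le> n"
  proof (cases "i < length (F ! c)")
    case True
    then show ?thesis using clause(2)[OF c, of "F ! c ! i"] by (auto simp: lit_def var_def)
  qed (auto simp: lit_def var_def)
  then show ?thesis using div_le_mono by (auto simp: W_def less_Suc_eq_le)
qed

lemma bat_less: "bat c < E" and dig_bat: "i < k \<Longrightarrow> dig h (bat c) i = var (lit F c i) mod h"
  unfolding bat_def E_def using digits_sum[of k "\<lambda>i. var (lit F c i) mod h" h] h_pos by auto

lemma poly_zeta: "poly (zeta z \<sigma>) x = (\<Sum>e<E. z (slot \<sigma> e) * poly (mp E e) x)"
  by (simp add: zeta_def poly_sum)

lemma zeta_at: "e < E \<Longrightarrow> poly (zeta z \<sigma>) (int e) = poly (mp E e) (int e) * z (slot \<sigma> e)"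
  unfolding poly_zeta by (subst sum.remove[of _ e]) (auto simp: mp_other intro!: sum.neutral)

lemma zeta_add: "zeta (\<lambda>v. z v + z' v) \<sigma> = zeta z \<sigma> + zeta z' \<sigma>"
  by (simp add: zeta_def smult_add_left sum.distrib)

text \<open>At its own node a clause finds its \<open>i\<close>-th variable \<open>v\<close> at
  place \<open>i * W + v div h\<close>, because the \<open>i\<close>-th digit of its batch is
  \<open>v mod h\<close>. All cases of a literal pick up the same factor, which is why
  \<open>up E\<close> replaces the constant 1.\<close>

lemma litp_at_bat:
  assumes "c < m" "i < k"
  shows "poly (litp (zeta z) c i) (int (bat c)) = poly (mp E (bat c)) (int (bat c)) * falsity z (lit F c i)"
proof -
  let ?v = "var (lit F c i)"
  have "slot (i * W + ?v div h) (bat c) = ?v"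
    using var_lit_div[OF assms(1), of i] W_pos dig_bat[OF assms(2)] by (simp add: slot_def)
  then show ?thesis
    by (simp add: litp_def Let_def falsity_def zeta_at[OF bat_less] up_at[OF bat_less] algebra_simps)
qed

lemma prod_falsity:
  assumes z: "\<And>v. z v \<in> {0, 1}"
  shows "(\<Prod>i<k. falsity z (lit F c i)) = of_bool (\<forall>i<k. falsity z (lit F c i) = 1)"
proof (cases "\<forall>i<k. falsity z (lit F c i) = 1")
  case True
  then show ?thesis by simp
next
  case False
  then obtain i where i: "i < k" "falsity z (lit F c i) \<noteq> 1" by auto
  moreover have "falsity z l \<in> {0, 1}" for l using z[of "var l"] by (auto simp: falsity_def)
  ultimately have "falsity z (lit F c i) = 0" by blast
  then have "(\<Prod>i<k. falsity z (lit F c i)) = 0" using i by (intro prod_zero) auto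
  then show ?thesis using False by simp
qed

definition falsified :: "(nat \<Rightarrow> int) \<Rightarrow> nat \<Rightarrow> bool" where
  "falsified z c \<longleftrightarrow> (\<forall>i<k. falsity z (lit F c i) = 1)"

text \<open>At any other node a clause is killed by its selector \<open>mp E (bat c)\<close>. At its
  own node it contributes 1 if falsified and 0 otherwise, times one factor from the selector and
  \<open>k\<close> from the literals.\<close>

lemma viol_at:
  assumes z: "\<And>v. z v \<in> {0, 1}" and e: "e < E"
  shows "poly (viol (zeta z)) (int e) = poly (mp E e) (int e) ^ Suc k * int (card {c. c < m \<and> bat c = e \<and> falsified z c})"
proof -
  let ?c = "poly (mp E e) (int e)"
  have "poly (viol (zeta z)) (int e) = (\<Sum>c<m. poly (mp E (bat c)) (int e) * (\<Prod>i<k. poly (litp (zeta z) c i) (int e)))"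
    by (simp add: viol_def poly_sum poly_prod)
  also have "\<dots> = (\<Sum>c<m. ?c ^ Suc k * of_bool (bat c = e \<and> falsified z c))"
  proof (rule sum.cong[OF refl])
    fix c assume c: "c \<in> {..<m}"
    show "poly (mp E (bat c)) (int e) * (\<Prod>i<k. poly (litp (zeta z) c i) (int e)) = ?c ^ Suc k * of_bool (bat c = e \<and> falsified z c)"
    proof (cases "bat c = e")
      case False
      then show ?thesis using mp_other[OF e, of "bat c"] by simp
    next
      case True
      have "(\<Prod>i<k. poly (litp (zeta z) c i) (int e)) = (\<Prod>i<k. ?c * falsity z (lit F c i))"
        using c litp_at_bat[of c _ z] True by (intro prod.cong) auto
      also have "\<dots> = ?c ^ k * of_bool (falsified z c)"
        by (simp add: prod.distrib prod_falsity[of z, OF z] falsified_def)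
      finally show ?thesis using True by simp
    qed
  qed
  also have "\<dots> = ?c ^ Suc k * (\<Sum>c<m. of_bool (bat c = e \<and> falsified z c))"
    by (simp add: sum_distrib_left)
  also have "(\<Sum>c<m. of_bool (bat c = e \<and> falsified z c)) = int (card {c. c < m \<and> bat c = e \<and> falsified z c})"
    by (simp add: of_bool_def sum.If_cases Int_def)
  finally show ?thesis .
qed

lemma degree_zeta: "degree (zeta z \<sigma>) \<le> E"
  unfolding zeta_def by (rule degree_sum_le) (auto intro: degree_mp)

lemma degree_up: "degree (up E) \<le> E"
  unfolding up_def by (rule degree_sum_le) (auto intro: degree_mp)

lemma degree_viol: "degree (viol (zeta z)) \<le> (k + 1) * E"
  unfolding viol_def
proof (rule degree_sum_le)
  fix c
  have l: "degree (litp (zeta z) c i) \<le> E" for i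
    using degree_diff_le[OF degree_up degree_zeta] degree_up degree_zeta by (auto simp: litp_def Let_def)
  have "degree (\<Prod>i<k. litp (zeta z) c i) \<le> sum (degree \<circ> litp (zeta z) c) {..<k}"
    by (rule degree_prod_sum_le) auto
  also have "\<dots> \<le> (\<Sum>i<k. E)" using l by (intro sum_mono) auto
  finally show "degree (mp E (bat c) * (\<Prod>i<k. litp (zeta z) c i)) \<le> (k + 1) * E"
    using degree_mult_le[of "mp E (bat c)" "\<Prod>i<k. litp (zeta z) c i"] degree_mp[of E "bat c"] by simp
qed simp

definition assignment :: "(nat \<Rightarrow> int) \<Rightarrow> nat \<Rightarrow> bool" where
  "assignment z v = (z (v - 1) = 1)"

lemma falsified_iff:
  assumes z: "\<And>v. z v \<in> {0, 1}" and c: "c < m"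
  shows "falsified z c \<longleftrightarrow> \<not> (\<exists>l\<in>set (F ! c). if 0 < l then assignment z (nat l) else \<not> assignment z (nat (- l)))"
proof -
  have v: "var l = nat l - 1" if "l > 0" for l using that by (simp add: var_def nat_diff_distrib)
  have v': "var l = nat (- l) - 1" if "l < 0" for l using that by (simp add: var_def nat_diff_distrib)
  have f: "falsity z l = 1 \<longleftrightarrow> \<not> (if 0 < l then assignment z (nat l) else \<not> assignment z (nat (- l)))" if "l \<noteq> 0" for l
    using that z[of "nat l - 1"] z[of "nat (- l) - 1"] by (auto simp: falsity_def assignment_def v v')
  have "falsified z c \<longleftrightarrow> (\<forall>i<length (F ! c). falsity z (F ! c ! i) = 1)"
    unfolding falsified_def using clause(1)[OF c] by (auto simp: lit_def falsity_def)
  also have "\<dots> \<longleftrightarrow> (\<forall>l\<in>set (F ! c). falsity z l = 1)" by (simp add: all_set_conv_all_nth)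
  also have "\<dots> \<longleftrightarrow> (\<forall>l\<in>set (F ! c). \<not> (if 0 < l then assignment z (nat l) else \<not> assignment z (nat (- l))))"
    using f clause(2)[OF c] by blast
  finally show ?thesis by blast
qed

lemma not_falsified_satisfiable:
  assumes z: "\<And>v. z v \<in> {0, 1}" and "\<And>c. c < m \<Longrightarrow> \<not> falsified z c"
  shows "satisfiable F"
  unfolding satisfiable_def
proof (rule exI[of _ "assignment z"], rule ballI)
  fix cl assume "cl \<in> set F"
  then obtain c where "c < m" "cl = F ! c" by (auto simp: in_set_conv_nth m_def)
  then show "\<exists>l\<in>set cl. if 0 < l then assignment z (nat l) else \<not> assignment z (nat (- l))"
    using assms(2)[of c] falsified_iff[of z c, OF z] by blast
qed

lemma satisfiable_not_falsified:
  assumes "satisfiable F"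
  obtains z where "\<And>v. z v \<in> {0, 1 :: int}" "\<And>c. c < m \<Longrightarrow> \<not> falsified z c"
proof -
  obtain \<alpha> where \<alpha>: "\<forall>c\<in>set F. \<exists>l\<in>set c. if 0 < l then \<alpha> (nat l) else \<not> \<alpha> (nat (- l))"
    using assms by (auto simp: satisfiable_def)
  define z where "z v = (of_bool (\<alpha> (Suc v)) :: int)" for v
  have z: "z v \<in> {0, 1}" for v by (simp add: z_def)
  have a: "assignment z v = \<alpha> v" if "v > 0" for v using that by (simp add: assignment_def z_def)
  have "\<not> falsified z c" if c: "c < m" for c
  proof -
    obtain l where l: "l \<in> set (F ! c)" "if 0 < l then \<alpha> (nat l) else \<not> \<alpha> (nat (- l))"
      using \<alpha> c nth_mem[of c F] unfolding m_def by blast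
    then have "if 0 < l then assignment z (nat l) else \<not> assignment z (nat (- l))"
      using clause(2)[OF c l(1)] a by auto
    then show ?thesis using falsified_iff[of z c, OF z c] l(1) by blast
  qed
  then show ?thesis using that[of z] z by blast
qed

text \<open>\<open>V\<close> vanishes at the nodes as an integer, not just modulo \<open>q\<close>,
  so the monic \<open>Z\<close> divides it over the integers. The quotient is reduced modulo
  \<open>q\<close> only when it is written down as a guess.\<close>

lemma completeness:
  assumes z: "\<And>v. z v \<in> {0, 1}" and "\<And>c. c < m \<Longrightarrow> \<not> falsified z c"
  obtains g where "viol (zeta z) = zp E * g" "degree g < d"
proof -
  have "poly (viol (zeta z)) (int e) = 0" if "e < E" for e
    using viol_at[of z e, OF z that] assms(2) by auto
  then have "zp E dvd viol (zeta z)" unfolding zp_def by (rule prod_linear_dvd)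
  then obtain g where g: "viol (zeta z) = zp E * g" by (auto elim: dvdE)
  have "degree g < d"
  proof (cases "g = 0")
    case False
    have "zp E \<noteq> 0" by (auto simp: zp_def)
    then have "degree (viol (zeta z)) = degree (zp E) + degree g" using g False by (simp add: degree_mult_eq)
    then show ?thesis using degree_viol[of z] by (simp add: d_def)
  qed (simp add: d_def)
  then show ?thesis using that g by blast
qed

text \<open>Some batch has between 1 and \<open>m < q\<close> falsified clauses. At its node
  \<open>V\<close> is nonzero modulo \<open>q\<close>, whereas Z g vanishes there for every guess
  \<open>g\<close>; so V - Z g survives modulo \<open>q\<close>, and its degree bounds the accepting
  points.\<close>

lemma soundness:
  assumes z: "\<And>v. z v \<in> {0, 1}" and unsat: "\<not> satisfiable F" and g: "degree g < d"
  shows "card {r. r < q \<and> int q dvd violv (int r) (\<lambda>\<sigma>. poly (zeta z \<sigma>) (int r)) - poly (zp E) (int r) * poly g (int r)} \<le> (k + 2) * E"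
proof -
  obtain c where c: "c < m" "falsified z c" using not_falsified_satisfiable[of z, OF z] unsat by blast
  let ?e = "bat c"
  let ?S = "{c. c < m \<and> bat c = ?e \<and> falsified z c}"
  have "card ?S \<le> card {..<m}" by (intro card_mono) auto
  moreover have "c \<in> ?S" "finite ?S" using c by simp_all
  then have "0 < card ?S" unfolding card_gt_0_iff by blast
  ultimately have S: "0 < card ?S" "card ?S < q" using Fq unfolding m_def by simp_all
  have pq: "prime (int q)" using q by simp
  have "\<not> int q dvd int (card ?S)" unfolding int_dvd_int_iff using S by (simp only: nat_dvd_not_less not_False_eq_True)
  moreover have "\<not> int q dvd poly (mp E ?e) (int ?e) ^ Suc k"
    using mp_self_coprime[OF q bat_less, of c] less_imp_le[OF Eq] prime_dvd_power[OF pq] unfolding E_def by blast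
  ultimately have nv: "\<not> int q dvd poly (viol (zeta z)) (int ?e)"
    unfolding viol_at[of z ?e, OF z bat_less] using prime_dvd_multD[OF pq] by blast
  let ?f = "viol (zeta z) - zp E * g"
  have "poly (zp E) (int ?e) = 0" unfolding poly_zp by (rule prod_zero[OF _ bexI[of _ ?e]]) (use bat_less[of c] in simp_all)
  then have "\<not> int q dvd poly ?f (int ?e)" using nv by (simp only: poly_diff poly_mult mult_zero_left diff_0_right not_False_eq_True)
  then have "card {r. r < q \<and> int q dvd poly ?f (int r)} \<le> degree ?f" by (rule card_roots_mod_prime[OF q])
  also have "degree ?f \<le> (k + 2) * E"
  proof (rule degree_diff_le)
    show "degree (viol (zeta z)) \<le> (k + 2) * E" using degree_viol[of z] by simp
    show "degree (zp E * g) \<le> (k + 2) * E"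
      using degree_mult_le[of "zp E" g] g unfolding degree_zp d_def by simp
  qed
  finally show ?thesis unfolding poly_diff poly_mult poly_viol .
qed

end

section \<open>The instance and its diameter\<close>

lemma dig_2_in: "int (dig 2 a v) \<in> {0, 1}"
  using dig_less[of 2 a v] by auto

context protocol begin

text \<open>An index of Alice is \<open>x + 2 ^ hn * H\<close>, where the base \<open>q\<close>
  digits of \<open>H\<close> are the guessed coefficients. In the list of vectors Bob's indices
  follow, shifted by \<open>NA\<close>.\<close>

definition "NA = 2 ^ hn * q ^ d"
definition "NB = (2 :: nat) ^ hn"
definition "N = NA + NB"
definition "ncols = q ^ (w + 1)"

text \<open>The flag selects Bob's half. Variables of the other half get 0, so that the two shares
  add up to one assignment.\<close>

definition xbit :: "bool \<Rightarrow> nat \<Rightarrow> nat \<Rightarrow> int" where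
  "xbit s a v = (if s then if v < hn then 0 else int (dig 2 a (v - hn))
     else if v < hn then int (dig 2 a v) else 0)"

definition hpoly :: "nat \<Rightarrow> int poly" where
  "hpoly H = (\<Sum>i<d. monom (int (dig q H i)) i)"

definition msg :: "nat \<Rightarrow> nat \<Rightarrow> nat \<Rightarrow> int" where
  "msg a r \<sigma> = (if \<sigma> < w then poly (zeta (xbit False (a mod 2 ^ hn)) \<sigma>) (int r)
     else poly (zp E) (int r) * poly (hpoly (a div 2 ^ hn)) (int r)) mod int q"

definition entA :: "nat \<Rightarrow> nat \<Rightarrow> nat \<Rightarrow> int" where
  "entA a r j = of_bool (\<forall>\<sigma><Suc w. int (dig q j \<sigma>) = msg a r \<sigma>)"

definition entB :: "nat \<Rightarrow> nat \<Rightarrow> nat \<Rightarrow> int" where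
  "entB b r j = - of_bool (int q dvd violv (int r) (\<lambda>\<sigma>. int (dig q j \<sigma>) + poly (zeta (xbit True b) \<sigma>) (int r)) - int (dig q j w))"

text \<open>The last row holds the bits of the index and serves only to make the vectors distinct.\<close>

definition ent :: "nat \<Rightarrow> nat \<Rightarrow> nat \<Rightarrow> int" where
  "ent i r j = (if r < q then if i < NA then entA i r j else entB (i - NA) r j else int (dig 2 i j))"

lemma q_pos: "q > 0" using q prime_gt_0_nat by blast

lemma slot_index_less: "i < k \<Longrightarrow> c < m \<Longrightarrow> i * W + var (lit F c i) div h < w"
proof -
  assume "i < k" "c < m"
  then have "i * W + var (lit F c i) div h < i * W + W" using var_lit_div by simp
  also have "\<dots> = Suc i * W" by simp
  also have "\<dots> \<le> w" unfolding w_def using \<open>i < k\<close> by (intro mult_right_mono) auto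
  finally show ?thesis .
qed

text \<open>Bob receives residues instead of integers, and only \<open>w\<close> of them; his test
  must not depend on more.\<close>

lemma violv_cong:
  assumes "\<And>\<sigma>. \<sigma> < w \<Longrightarrow> [\<zeta> \<sigma> = \<zeta>' \<sigma>] (mod Q)"
  shows "[violv x \<zeta> = violv x \<zeta>'] (mod Q)"
  unfolding violv_def
proof (intro cong_sum cong_mult cong_refl cong_prod)
  fix c i assume "c \<in> {..<m}" "i \<in> {..<k}"
  then have "[\<zeta> (i * W + var (lit F c i) div h) = \<zeta>' (i * W + var (lit F c i) div h)] (mod Q)"
    using assms slot_index_less by auto
  then show "[litv x \<zeta> c i = litv x \<zeta>' c i] (mod Q)"
    by (auto simp: litv_def Let_def intro: cong_diff)
qed

definition merge :: "nat \<Rightarrow> nat \<Rightarrow> nat \<Rightarrow> int" where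
  "merge a b v = xbit False (a mod 2 ^ hn) v + xbit True b v"

lemma merge_in: "merge a b v \<in> {0, 1}"
  using dig_2_in[of "a mod 2 ^ hn" v] dig_2_in[of b "v - hn"] by (auto simp: merge_def xbit_def)

lemma zeta_merge: "poly (zeta (merge a b) \<sigma>) x = poly (zeta (xbit False (a mod 2 ^ hn)) \<sigma>) x + poly (zeta (xbit True b) \<sigma>) x"
proof -
  have "merge a b = (\<lambda>v. xbit False (a mod 2 ^ hn) v + xbit True b v)" by (rule ext) (simp add: merge_def)
  then show ?thesis using zeta_add[of "xbit False (a mod 2 ^ hn)" "xbit True b" \<sigma>] by simp
qed

text \<open>\<open>merge\<close> reproduces a given satisfying assignment only below
  \<open>n\<close>; beyond that the assignment is arbitrary.\<close>

lemma falsified_cong: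
  assumes "\<And>v. v < n \<Longrightarrow> z v = z' v" "c < m"
  shows "falsified z c = falsified z' c"
proof -
  have "falsity z (lit F c i) = falsity z' (lit F c i)" for i
  proof (cases "i < length (F ! c)")
    case True
    then have "lit F c i \<noteq> 0" "\<bar>lit F c i\<bar> \<le> int n" using clause(2)[OF assms(2), of "F ! c ! i"] by (auto simp: lit_def)
    then have "var (lit F c i) < n" by (auto simp: var_def)
    then show ?thesis using assms(1) by (simp add: falsity_def)
  qed (simp add: lit_def falsity_def)
  then show ?thesis by (simp add: falsified_def)
qed

text \<open>At the column of the message that Alice really sends, Bob's test is the divisibility
  that \<open>soundness\<close> bounds, for the merged assignment and Alice's guess.\<close>

lemma accept_cong:
  assumes "\<And>\<sigma>. \<sigma> < Suc w \<Longrightarrow> int (dig q j \<sigma>) = msg a r \<sigma>"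
  shows "int q dvd violv (int r) (\<lambda>\<sigma>. int (dig q j \<sigma>) + poly (zeta (xbit True b) \<sigma>) (int r)) - int (dig q j w) \<longleftrightarrow>
    int q dvd violv (int r) (\<lambda>\<sigma>. poly (zeta (merge a b) \<sigma>) (int r)) - poly (zp E) (int r) * poly (hpoly (a div 2 ^ hn)) (int r)"
proof -
  have 1: "[violv (int r) (\<lambda>\<sigma>. int (dig q j \<sigma>) + poly (zeta (xbit True b) \<sigma>) (int r))
      = violv (int r) (\<lambda>\<sigma>. poly (zeta (merge a b) \<sigma>) (int r))] (mod int q)"
  proof (rule violv_cong)
    fix \<sigma> assume "\<sigma> < w"
    then have "[int (dig q j \<sigma>) = poly (zeta (xbit False (a mod 2 ^ hn)) \<sigma>) (int r)] (mod int q)"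
      using assms[of \<sigma>] by (simp add: msg_def cong_def)
    then show "[int (dig q j \<sigma>) + poly (zeta (xbit True b) \<sigma>) (int r) = poly (zeta (merge a b) \<sigma>) (int r)] (mod int q)"
      unfolding zeta_merge by (intro cong_add cong_refl)
  qed
  have 2: "[int (dig q j w) = poly (zp E) (int r) * poly (hpoly (a div 2 ^ hn)) (int r)] (mod int q)"
    using assms[of w] by (simp add: msg_def cong_def)
  show ?thesis using cong_diff[OF 1 2] by (rule cong_dvd_iff)
qed

lemma degree_hpoly: "degree (hpoly H) < d"
proof -
  have "degree (hpoly H) \<le> d - 1" unfolding hpoly_def
    by (rule degree_sum_le) (auto intro: order_trans[OF degree_monom_le])
  then show ?thesis by (simp add: d_def)
qed

lemma poly_hpoly: "poly (hpoly H) x = (\<Sum>i<d. int (dig q H i) * x ^ i)"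
  by (simp add: hpoly_def poly_sum poly_monom)

lemma unsat_few_rows:
  assumes "\<not> satisfiable F"
  shows "card {r. r < q \<and> (\<exists>j. entA a r j = 1 \<and> entB b r j = - 1)} \<le> (k + 2) * E"
proof -
  let ?g = "hpoly (a div 2 ^ hn)"
  let ?R = "{r. r < q \<and> int q dvd violv (int r) (\<lambda>\<sigma>. poly (zeta (merge a b) \<sigma>) (int r)) - poly (zp E) (int r) * poly ?g (int r)}"
  have "{r. r < q \<and> (\<exists>j. entA a r j = 1 \<and> entB b r j = - 1)} \<subseteq> ?R"
    using accept_cong by (fastforce simp: entA_def entB_def)
  then have "card {r. r < q \<and> (\<exists>j. entA a r j = 1 \<and> entB b r j = - 1)} \<le> card ?R"
    by (intro card_mono) auto
  also have "\<dots> \<le> (k + 2) * E"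
    by (rule soundness[of "merge a b", OF merge_in assms degree_hpoly])
  finally show ?thesis .
qed

lemma sat_pair:
  assumes "satisfiable F"
  obtains a b where "a < NA" "b < NB" "\<And>r. r < q \<Longrightarrow> \<exists>j<ncols. entA a r j = 1 \<and> entB b r j = - 1"
proof -
  obtain z where z: "\<And>v. z v \<in> {0, 1 :: int}" "\<And>c. c < m \<Longrightarrow> \<not> falsified z c"
    using satisfiable_not_falsified[OF assms] by blast
  have zn: "nat (z v) < 2" "int (nat (z v)) = z v" for v using z(1)[of v] by auto
  define x where "x = (\<Sum>v<hn. nat (z v) * 2 ^ v)"
  define b where "b = (\<Sum>v<hn. nat (z (v + hn)) * 2 ^ v)"
  have x: "x < 2 ^ hn" "\<And>v. v < hn \<Longrightarrow> dig 2 x v = nat (z v)"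
    using digits_sum[of hn "\<lambda>v. nat (z v)" 2] zn by (auto simp: x_def)
  have b: "b < 2 ^ hn" "\<And>v. v < hn \<Longrightarrow> dig 2 b v = nat (z (v + hn))"
    using digits_sum[of hn "\<lambda>v. nat (z (v + hn))" 2] zn by (auto simp: b_def)
  have mz: "merge a b v = z v" if "a mod 2 ^ hn = x" "v < n" for a v
    using that x(2)[of v] b(2)[of "v - hn"] hn zn(2)[of v] by (auto simp: merge_def xbit_def)
  have nf: "\<not> falsified (merge a b) c" if "a mod 2 ^ hn = x" "c < m" for a c
    using falsified_cong[of "merge a b" z c] mz[OF that(1)] z(2) that(2) by auto
  obtain g where g: "viol (zeta (merge x b)) = zp E * g" "degree g < d"
    by (rule completeness[of "merge x b", OF merge_in nf]) (use x in auto)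
  \<comment> \<open>The honest guess: the coefficients of the quotient modulo \<open>q\<close>, as
    base \<open>q\<close> digits.\<close>
  define H where "H = (\<Sum>i<d. nat (coeff g i mod int q) * q ^ i)"
  have cq: "nat (coeff g i mod int q) < q" for i
    using q_pos pos_mod_bound[of "int q" "coeff g i"] by (simp add: nat_less_iff)
  have H: "H < q ^ d" "\<And>i. i < d \<Longrightarrow> dig q H i = nat (coeff g i mod int q)"
    using digits_sum[of d "\<lambda>i. nat (coeff g i mod int q)" q] cq by (auto simp: H_def)
  define a where "a = x + 2 ^ hn * H"
  have am: "a mod 2 ^ hn = x" "a div 2 ^ hn = H" using x by (simp_all add: a_def)
  have "a < 2 ^ hn + 2 ^ hn * H" using x by (simp add: a_def)
  also have "\<dots> = 2 ^ hn * Suc H" by simp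
  also have "\<dots> \<le> NA" unfolding NA_def using H(1) by (intro mult_left_mono) auto
  finally have aNA: "a < NA" .
  have hg: "[poly (hpoly H) t = poly g t] (mod int q)" for t
  proof -
    have "poly g t = (\<Sum>i\<le>degree g. coeff g i * t ^ i)" by (rule poly_altdef)
    also have "\<dots> = (\<Sum>i<d. coeff g i * t ^ i)"
      using g(2) by (intro sum.mono_neutral_left) (auto simp: coeff_eq_0)
    finally have "poly g t = (\<Sum>i<d. coeff g i * t ^ i)" .
    moreover have "[(\<Sum>i<d. int (dig q H i) * t ^ i) = (\<Sum>i<d. coeff g i * t ^ i)] (mod int q)"
      using H(2) q_pos by (intro cong_sum cong_mult cong_refl) (auto simp: cong_def)
    ultimately show ?thesis by (simp add: poly_hpoly)
  qed
  show ?thesis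
  proof (rule that[of a b])
    show "a < NA" by (rule aNA)
    show "b < NB" using b by (simp add: NB_def)
    fix r assume "r < q"
    define j where "j = (\<Sum>\<sigma><Suc w. nat (msg a r \<sigma>) * q ^ \<sigma>)"
    have mq: "0 \<le> msg a r \<sigma>" "nat (msg a r \<sigma>) < q" for \<sigma>
      using q_pos by (auto simp: msg_def nat_less_iff)
    have j: "j < ncols" "\<And>\<sigma>. \<sigma> < Suc w \<Longrightarrow> int (dig q j \<sigma>) = msg a r \<sigma>"
      using digits_sum[of "Suc w" "\<lambda>\<sigma>. nat (msg a r \<sigma>)" q] mq unfolding ncols_def j_def by auto
    have "merge x b = merge a b" using x am by (auto simp: merge_def)
    then have "violv (int r) (\<lambda>\<sigma>. poly (zeta (merge a b) \<sigma>) (int r)) = poly (zp E) (int r) * poly g (int r)"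
      using g(1) poly_viol[of "zeta (merge a b)" "int r"] by simp
    moreover have "[poly (zp E) (int r) * poly g (int r) = poly (zp E) (int r) * poly (hpoly H) (int r)] (mod int q)"
      by (intro cong_mult cong_refl cong_sym[OF hg])
    ultimately have "int q dvd violv (int r) (\<lambda>\<sigma>. poly (zeta (merge a b) \<sigma>) (int r)) - poly (zp E) (int r) * poly (hpoly H) (int r)"
      by (simp add: cong_iff_dvd_diff)
    then have "entB b r j = - 1" using accept_cong[of j a r b, OF j(2)] am by (simp add: entB_def)
    moreover have "entA a r j = 1" using j(2) by (simp add: entA_def)
    ultimately show "\<exists>j<ncols. entA a r j = 1 \<and> entB b r j = - 1" using j(1) by blast
  qed
qed

section \<open>The vectors and the distances between them\<close>

definition pts :: "rat mat list" where
  "pts = map (\<lambda>i. mat (q + 1) ncols (\<lambda>(r, j). of_int (ent i r j))) [0..<N]"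

definition rpt :: "nat \<Rightarrow> real mat" where
  "rpt i = map_mat real_of_rat (mat (q + 1) ncols (\<lambda>(r, j). of_int (ent i r j)))"

lemma points_pts: "points pts = rpt ` {..<N}"
  by (auto simp: points_def pts_def rpt_def)

lemma ncols_pos: "ncols > 0" using q_pos by (simp add: ncols_def)

lemma rpt_index: "r < q + 1 \<Longrightarrow> j < ncols \<Longrightarrow> rpt i $$ (r, j) = of_int (ent i r j)"
  by (simp add: rpt_def)

lemma dist_rpt: "product_dist (q + 1) ncols (rpt i) (rpt i') =
  sqrt (\<Sum>r<q + 1. (Max ((\<lambda>j. real_of_int \<bar>ent i r j - ent i' r j\<bar>) ` {..<ncols}))\<^sup>2)"
  unfolding product_dist_def
  by (intro arg_cong[where f = sqrt] sum.cong refl arg_cong[where f = "\<lambda>x. x\<^sup>2"] arg_cong[where f = Max] image_cong)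
    (simp add: rpt_index)

text \<open>Each of the \<open>q + 1\<close> rows contributes at most 1 to the square, and a row in
  \<open>S\<close> at most 3 more.\<close>

lemma dist_rpt_le:
  assumes "S \<subseteq> {..<q}" "card S \<le> s"
    "\<And>r j. r < q + 1 \<Longrightarrow> j < ncols \<Longrightarrow> \<bar>ent i r j - ent i' r j\<bar> \<le> (if r \<in> S then 2 else 1)"
  shows "product_dist (q + 1) ncols (rpt i) (rpt i') \<le> sqrt (real (q + 1 + 3 * s))"
  unfolding dist_rpt
proof (rule real_sqrt_le_mono)
  have "(\<Sum>r<q + 1. (Max ((\<lambda>j. real_of_int \<bar>ent i r j - ent i' r j\<bar>) ` {..<ncols}))\<^sup>2) \<le> (\<Sum>r<q + 1. if r \<in> S then 4 else 1)"
  proof (rule sum_mono)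
    fix r assume r: "r \<in> {..<q + 1}"
    let ?M = "Max ((\<lambda>j. real_of_int \<bar>ent i r j - ent i' r j\<bar>) ` {..<ncols})"
    have "?M \<le> (if r \<in> S then 2 else 1)"
    proof (rule Max.boundedI)
      fix y assume "y \<in> (\<lambda>j. real_of_int \<bar>ent i r j - ent i' r j\<bar>) ` {..<ncols}"
      then obtain j where j: "j < ncols" "y = real_of_int \<bar>ent i r j - ent i' r j\<bar>" by auto
      have "real_of_int \<bar>ent i r j - ent i' r j\<bar> \<le> real_of_int (if r \<in> S then 2 else 1)"
        using assms(3)[of r j] r j by (simp only: of_int_le_iff lessThan_iff)
      then show "y \<le> (if r \<in> S then 2 else 1)" using j by (auto split: if_splits)
    qed (use ncols_pos in auto)
    moreover have "0 \<le> ?M"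
      using ncols_pos by (intro order_trans[OF _ Max_ge[of _ "real_of_int \<bar>ent i r 0 - ent i' r 0\<bar>"]]) auto
    ultimately have "?M\<^sup>2 \<le> (if r \<in> S then 2 else 1)\<^sup>2" by (intro power_mono)
    also have "\<dots> = (if r \<in> S then 4 else 1)" by simp
    finally show "?M\<^sup>2 \<le> (if r \<in> S then 4 else 1)" .
  qed
  also have "\<dots> = (\<Sum>r<q + 1. 1 + 3 * of_bool (r \<in> S))" by (intro sum.cong) auto
  also have "\<dots> = real (q + 1) + 3 * (\<Sum>r<q + 1. of_bool (r \<in> S))"
    by (simp add: sum.distrib sum_distrib_left)
  also have "(\<Sum>r<q + 1. of_bool (r \<in> S) :: real) = real (card ({..<q + 1} \<inter> S))"
    using sum.If_cases[of "{..<q + 1}" "\<lambda>r. r \<in> S" "\<lambda>_. 1" "\<lambda>_. 0 :: real"]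
    unfolding of_bool_def by (simp del: sum.lessThan_Suc)
  also have "{..<q + 1} \<inter> S = S" using assms(1) by auto
  finally show "(\<Sum>r<q + 1. (Max ((\<lambda>j. real_of_int \<bar>ent i r j - ent i' r j\<bar>) ` {..<ncols}))\<^sup>2) \<le> real (q + 1 + 3 * s)"
    using assms(2) by simp
qed

lemma entA_in: "entA a r j \<in> {0, 1}" and entB_in: "entB b r j \<in> {- 1, 0}"
  by (simp_all only: entA_def entB_def of_bool_def) auto

text \<open>A difference of 2 needs entries 1 and -1. Alice's vectors avoid -1, Bob's avoid 1
  outside the index row, and the index row contains only 0 and 1. So it occurs only between Alice
  and Bob, in an accepting row, and vectors of the same player are never far apart.\<close>

lemma unsat_dist:
  assumes unsat: "\<not> satisfiable F"
  shows "product_dist (q + 1) ncols (rpt i) (rpt i') \<le> sqrt (real (q + 1 + 3 * ((k + 2) * E)))"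
proof -
  define S where "S = {r. r < q \<and> (\<exists>j. ent i r j = 1 \<and> ent i' r j = - 1 \<or> ent i r j = - 1 \<and> ent i' r j = 1)}"
  have "card S \<le> (k + 2) * E"
  proof -
    have m1: "ent i r j \<noteq> - 1" if "i < NA" for i r j
      using that entA_in[of i r j] dig_2_in[of i j] by (auto simp: ent_def)
    have p1: "ent i r j \<noteq> 1" if "\<not> i < NA" "r < q" for i r j
      using that entB_in[of "i - NA" r j] by (auto simp: ent_def)
    show ?thesis
    proof (cases "i < NA"; cases "i' < NA")
      assume "i < NA" "i' < NA"
      then have "S = {}" using m1 by (auto simp: S_def)
      then show ?thesis by simp
    next
      assume "\<not> i < NA" "\<not> i' < NA"
      then have "S = {}" using p1 by (auto simp: S_def)
      then show ?thesis by simp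
    next
      assume i: "i < NA" "\<not> i' < NA"
      then have "S = {r. r < q \<and> (\<exists>j. entA i r j = 1 \<and> entB (i' - NA) r j = - 1)}"
        using m1[OF i(1)] by (auto simp: S_def ent_def)
      then show ?thesis using unsat_few_rows[OF unsat] by simp
    next
      assume i: "\<not> i < NA" "i' < NA"
      then have "S = {r. r < q \<and> (\<exists>j. entA i' r j = 1 \<and> entB (i - NA) r j = - 1)}"
        using m1[OF i(2)] by (auto simp: S_def ent_def)
      then show ?thesis using unsat_few_rows[OF unsat] by simp
    qed
  qed
  then show ?thesis
  proof (rule dist_rpt_le[rotated])
    show "S \<subseteq> {..<q}" by (auto simp: S_def)
    fix r j
    have "ent i r j \<in> {- 1, 0, 1}" for i
      using entA_in[of i r j] entB_in[of "i - NA" r j] dig_2_in[of i j] by (auto simp: ent_def)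
    from this[of i] this[of i'] consider "\<bar>ent i r j - ent i' r j\<bar> \<le> 1" |
      "\<bar>ent i r j - ent i' r j\<bar> = 2" "ent i r j = 1 \<and> ent i' r j = - 1 \<or> ent i r j = - 1 \<and> ent i' r j = 1" by fastforce
    then show "\<bar>ent i r j - ent i' r j\<bar> \<le> (if r \<in> S then 2 else 1)"
    proof cases
      case 2
      have "r < q"
      proof (rule ccontr)
        assume "\<not> r < q"
        then show False using 2 dig_2_in[of i j] dig_2_in[of i' j] by (auto simp: ent_def)
      qed
      then have "r \<in> S" using 2 by (auto simp: S_def)
      then show ?thesis using 2 by simp
    qed auto
  qed
qed

lemma sat_dist:
  assumes "satisfiable F"
  obtains i i' where "i < N" "i' < N" "sqrt (4 * real q) \<le> product_dist (q + 1) ncols (rpt i) (rpt i')"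
proof -
  obtain a b where ab: "a < NA" "b < NB" "\<And>r. r < q \<Longrightarrow> \<exists>j<ncols. entA a r j = 1 \<and> entB b r j = - 1"
    using sat_pair[OF assms] by blast
  have "sqrt (4 * real q) \<le> product_dist (q + 1) ncols (rpt a) (rpt (NA + b))"
    unfolding dist_rpt
  proof (rule real_sqrt_le_mono)
    let ?M = "\<lambda>r. Max ((\<lambda>j. real_of_int \<bar>ent a r j - ent (NA + b) r j\<bar>) ` {..<ncols})"
    have "4 * real q = (\<Sum>r<q. 2\<^sup>2)" by simp
    also have "\<dots> \<le> (\<Sum>r<q. (?M r)\<^sup>2)"
    proof (intro sum_mono power_mono)
      fix r assume "r \<in> {..<q}"
      then obtain j where "j < ncols" "entA a r j = 1" "entB b r j = - 1" "r < q" using ab(3) by auto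
      then have "2 = real_of_int \<bar>ent a r j - ent (NA + b) r j\<bar>" "j < ncols" using ab(1) by (simp_all add: ent_def)
      then show "2 \<le> ?M r" by (intro Max_ge) auto
    qed simp
    also have "\<dots> \<le> (\<Sum>r<q + 1. (?M r)\<^sup>2)" by (intro sum_mono2) auto
    finally show "4 * real q \<le> (\<Sum>r<q + 1. (?M r)\<^sup>2)" .
  qed
  then show ?thesis using that[of a "NA + b"] ab by (simp add: N_def)
qed

lemma N_pos: "N > 0" by (simp add: N_def NB_def)

lemma diameter_eq: "product_diameter (q + 1) ncols (points pts) =
  Max ((\<lambda>(i, i'). product_dist (q + 1) ncols (rpt i) (rpt i')) ` ({..<N} \<times> {..<N}))"
  unfolding product_diameter_def points_pts by (intro arg_cong[where f = Max]) auto

lemma unsat_diameter: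
  assumes "\<not> satisfiable F"
  shows "product_diameter (q + 1) ncols (points pts) \<le> sqrt (real (q + 1 + 3 * ((k + 2) * E)))"
  unfolding diameter_eq by (rule Max.boundedI) (use N_pos unsat_dist[OF assms] in auto)

lemma sat_diameter:
  assumes "satisfiable F"
  shows "sqrt (4 * real q) \<le> product_diameter (q + 1) ncols (points pts)"
proof -
  obtain i i' where i: "i < N" "i' < N" "sqrt (4 * real q) \<le> product_dist (q + 1) ncols (rpt i) (rpt i')"
    using sat_dist[OF assms] by blast
  note i(3)
  also have "product_dist (q + 1) ncols (rpt i) (rpt i') \<le> product_diameter (q + 1) ncols (points pts)"
    unfolding diameter_eq using i(1,2) by (intro Max_ge) auto
  finally show ?thesis .
qed

end

section \<open>The encoding of the instance\<close>

lemma dig_2_inject: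
  assumes "a < 2 ^ l" "b < 2 ^ l" "\<And>j. j < l \<Longrightarrow> dig 2 a j = dig 2 b j"
  shows "a = b"
  using assms
proof (induction l arbitrary: a b)
  case (Suc l)
  have d: "dig 2 (x div 2) j = dig 2 x (Suc j)" for x j by (simp only: dig_def power_Suc div_mult2_eq)
  have "a div 2 = b div 2"
  proof (rule Suc.IH)
    show "dig 2 (a div 2) j = dig 2 (b div 2) j" if "j < l" for j
      unfolding d using Suc.prems(3)[of "Suc j"] that by simp
  qed (use Suc.prems in simp_all)
  moreover have "a mod 2 = b mod 2" using Suc.prems(3)[of 0] by (simp add: dig_def)
  ultimately have "a div 2 * 2 + a mod 2 = b div 2 * 2 + b mod 2" by simp
  then show ?case by (simp only: div_mult_mod_eq)
qed simp

text \<open>Blocks of equal length turn a nested list into a function of the position alone. The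
  machine writes the instance cell by cell in this form.\<close>

lemma concat_map_upt:
  assumes "\<And>i. i < a \<Longrightarrow> length (f i) = b"
  shows "concat (map f [0..<a]) = map (\<lambda>p. f (p div b) ! (p mod b)) [0..<a * b]"
  using assms
proof (induction a)
  case (Suc a)
  show ?case
  proof (cases "b = 0")
    case False
    have "map (\<lambda>p. f (p div b) ! (p mod b)) [a * b..<a * b + b] = f a"
    proof (rule nth_equalityI)
      fix i assume "i < length (map (\<lambda>p. f (p div b) ! (p mod b)) [a * b..<a * b + b])"
      then have "i < b" by simp
      then show "map (\<lambda>p. f (p div b) ! (p mod b)) [a * b..<a * b + b] ! i = f a ! i" by simp
    qed (use Suc.prems in simp)
    moreover have "[0..<Suc a * b] = [0..<a * b] @ [a * b..<a * b + b]"
      using upt_add_eq_append[of 0 "a * b" b] by (simp add: add.commute)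
    ultimately show ?thesis using Suc by simp
  qed (use Suc in auto)
qed simp

lemma map_upt_cong: "(\<And>i. i < n \<Longrightarrow> f i = g i) \<Longrightarrow> map f [0..<n] = map g [0..<n]"
  by simp

context protocol begin

text \<open>After the header of three numbers, each entry takes two cells, its numerator and the
  denominator 1.\<close>

definition outv :: "nat \<Rightarrow> int" where
  "outv p = (if p = 0 then int N else if p = 1 then int (q + 1) else if p = 2 then int ncols
     else if odd (p - 3) then 1
     else ent ((p - 3) div 2 div ((q + 1) * ncols)) ((p - 3) div 2 div ncols mod (q + 1)) ((p - 3) div 2 mod ncols))"

definition outlen :: nat where
  "outlen = 3 + 2 * (N * (q + 1) * ncols)"

lemma encode_vector_pt:
  "encode_vector (mat (q + 1) ncols (\<lambda>(r, j). of_int (ent i r j))) =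
   map (\<lambda>p. [ent i (p div 2 div ncols) (p div 2 mod ncols), 1] ! (p mod 2)) [0..<(q + 1) * ncols * 2]"
proof -
  let ?f = "\<lambda>p. [ent i (p div ncols) (p mod ncols), 1]"
  have "encode_vector (mat (q + 1) ncols (\<lambda>(r, j). of_int (ent i r j))) =
     concat (concat (map (\<lambda>r. map (\<lambda>j. [ent i r j, 1]) [0..<ncols]) [0..<q + 1]))"
    unfolding encode_vector_def
    by (intro arg_cong[where f = concat] map_cong refl) (auto simp: encode_rat_def)
  also have "concat (map (\<lambda>r. map (\<lambda>j. [ent i r j, 1]) [0..<ncols]) [0..<q + 1]) =
     map (\<lambda>p. map (\<lambda>j. [ent i (p div ncols) j, 1]) [0..<ncols] ! (p mod ncols)) [0..<(q + 1) * ncols]"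
    by (rule concat_map_upt) simp
  also have "\<dots> = map ?f [0..<(q + 1) * ncols]" using ncols_pos by simp
  also have "concat \<dots> = map (\<lambda>p. ?f (p div 2) ! (p mod 2)) [0..<(q + 1) * ncols * 2]"
    by (rule concat_map_upt) simp
  finally show ?thesis .
qed

lemma encode_pts: "encode_instance (q + 1) ncols pts = map outv [0..<outlen]"
proof -
  let ?b = "(q + 1) * ncols * 2"
  let ?g = "\<lambda>i p. [ent i (p div 2 div ncols) (p div 2 mod ncols), 1] ! (p mod 2)"
  have "concat (map encode_vector pts) = concat (map (\<lambda>i. map (?g i) [0..<?b]) [0..<N])"
    unfolding pts_def map_map by (intro arg_cong[where f = concat] map_cong refl) (simp only: o_def encode_vector_pt)
  also have "\<dots> = map (\<lambda>p. map (?g (p div ?b)) [0..<?b] ! (p mod ?b)) [0..<N * ?b]"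
    by (rule concat_map_upt) simp
  also have "\<dots> = map (\<lambda>p. outv (p + 3)) [0..<N * ?b]"
  proof (rule map_upt_cong)
    fix p assume p: "p < N * ?b"
    have b: "?b > 0" using ncols_pos by simp
    have "p mod ?b < ?b" using b by simp
    then have "map (?g (p div ?b)) [0..<?b] ! (p mod ?b) = ?g (p div ?b) (p mod ?b)" by simp
    also have "\<dots> = outv (p + 3)"
    proof -
      have b2: "?b = 2 * ((q + 1) * ncols)" by (rule mult.commute)
      have e: "p div ?b = p div 2 div ((q + 1) * ncols)" unfolding b2 by (rule div_mult2_eq)
      have pm: "p mod ?b = 2 * (p div 2 mod ((q + 1) * ncols)) + p mod 2"
        unfolding b2 by (rule mod_mult2_eq)
      have 1: "p mod ?b div 2 = p div 2 mod ((q + 1) * ncols)" "p mod ?b mod 2 = p mod 2"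
        unfolding pm by simp_all
      have 2: "p div 2 mod ((q + 1) * ncols) = ncols * (p div 2 div ncols mod (q + 1)) + p div 2 mod ncols"
        unfolding mult.commute[of "q + 1" ncols] by (rule mod_mult2_eq)
      have 3: "p div 2 mod ((q + 1) * ncols) div ncols = p div 2 div ncols mod (q + 1)"
        "p div 2 mod ((q + 1) * ncols) mod ncols = p div 2 mod ncols"
        unfolding 2 using ncols_pos by simp_all
      show ?thesis unfolding 1 3 e
      proof (cases "even p")
        case True
        then have "p mod 2 = 0" by presburger
        then show "[ent (p div 2 div ((q + 1) * ncols)) (p div 2 div ncols mod (q + 1)) (p div 2 mod ncols), 1] ! (p mod 2) = outv (p + 3)"
          using True by (simp add: outv_def)
      next
        case False
        then have "p mod 2 = 1" by presburger
        then show "[ent (p div 2 div ((q + 1) * ncols)) (p div 2 div ncols mod (q + 1)) (p div 2 mod ncols), 1] ! (p mod 2) = outv (p + 3)"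
          using False by (simp add: outv_def)
      qed
    qed
    finally show "map (?g (p div ?b)) [0..<?b] ! (p mod ?b) = outv (p + 3)" .
  qed
  finally have c: "concat (map encode_vector pts) = map (\<lambda>p. outv (p + 3)) [0..<N * ?b]" .
  have "2 * (N * (q + 1) * ncols) = N * ?b" by (simp only: mult_ac)
  then have o: "outlen = Suc (Suc (Suc (N * ?b)))" unfolding outlen_def by simp
  have "map outv [0..<outlen] = outv 0 # outv 1 # outv 2 # map (\<lambda>p. outv (p + 3)) [0..<N * ?b]"
    unfolding o by (simp only: map_upt_Suc) (simp add: numeral_2_eq_2 numeral_3_eq_3)
  also have "\<dots> = encode_instance (q + 1) ncols pts"
    unfolding encode_instance_def c by (simp add: outv_def pts_def)
  finally show ?thesis by simp
qed

lemma length_pts: "length pts = N" by (simp add: pts_def)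

text \<open>The bound on \<open>N\<close> gives the index row room for all binary digits of an
  index.\<close>

lemma is_instance_pts:
  assumes "N \<le> 2 ^ ncols"
  shows "is_instance (q + 1) ncols pts"
proof -
  have "distinct pts" unfolding pts_def distinct_map
  proof
    show "inj_on (\<lambda>i. mat (q + 1) ncols (\<lambda>(r, j). rat_of_int (ent i r j))) (set [0..<N])"
    proof (rule inj_onI)
      fix a b assume ab: "a \<in> set [0..<N]" "b \<in> set [0..<N]"
        and e: "mat (q + 1) ncols (\<lambda>(r, j). rat_of_int (ent a r j)) = mat (q + 1) ncols (\<lambda>(r, j). rat_of_int (ent b r j))"
      have "dig 2 a j = dig 2 b j" if "j < ncols" for j
        using arg_cong[OF e, of "\<lambda>A. A $$ (q, j)"] that by (simp add: ent_def)
      then show "a = b" by (rule dig_2_inject[rotated 2]) (use ab assms in auto)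
    qed
  qed simp
  moreover have "set pts \<subseteq> carrier_mat (q + 1) ncols" by (auto simp: pts_def)
  moreover have "pts \<noteq> []" using N_pos by (auto simp: pts_def)
  ultimately show ?thesis using ncols_pos by (simp add: is_instance_def)
qed

lemma ent_abs_le: "\<bar>ent i r j\<bar> \<le> 1"
  using entA_in[of i r j] entB_in[of "i - NA" r j] dig_2_in[of i j] by (auto simp: ent_def)

lemma bits_abs_le_1: "\<bar>x\<bar> \<le> 1 \<Longrightarrow> bits x \<le> 2"
proof -
  assume "\<bar>x\<bar> \<le> 1"
  then consider "x = 0" | "x = 1" | "x = - 1" by linarith
  then show "bits x \<le> 2" by cases (simp_all add: bits_def bitlen_alt_def)
qed

lemma vector_bits_pts: "x \<in> set pts \<Longrightarrow> vector_bits x \<le> 4 * ((q + 1) * ncols)"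
proof -
  assume "x \<in> set pts"
  then obtain i where x: "x = mat (q + 1) ncols (\<lambda>(r, j). of_int (ent i r j))" by (auto simp: pts_def)
  have "vector_bits x \<le> sum_list (map (\<lambda>p. 2) [0..<(q + 1) * ncols * 2])"
    unfolding vector_bits_def x encode_vector_pt map_map
  proof (rule sum_list_mono)
    fix p
    show "(bits \<circ> (\<lambda>p. [ent i (p div 2 div ncols) (p div 2 mod ncols), 1] ! (p mod 2))) p \<le> 2"
      using bits_abs_le_1[OF ent_abs_le] bits_abs_le_1[of 1] mod_less_divisor[of 2 p] by (auto simp: less_2_cases_iff)
  qed
  then show ?thesis by (simp add: sum_list_triv)
qed

end

section \<open>Timed execution\<close>

definition runsto :: "prog \<Rightarrow> state \<Rightarrow> nat \<Rightarrow> (state \<Rightarrow> bool) \<Rightarrow> bool" where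
  "runsto p s T Q \<longleftrightarrow> (\<exists>t s'. exec p s t s' \<and> t \<le> T \<and> Q s')"

lemma runsto_mono: "runsto p s T Q \<Longrightarrow> T \<le> T' \<Longrightarrow> (\<And>s'. Q s' \<Longrightarrow> Q' s') \<Longrightarrow> runsto p s T' Q'"
  unfolding runsto_def by (meson le_trans)

lemma runsto_Skip: "Q s \<Longrightarrow> 1 \<le> T \<Longrightarrow> runsto Skip s T Q"
  unfolding runsto_def by (meson exec.skip)

lemma runsto_Const: "Q (R(r := c), M) \<Longrightarrow> bits c \<le> T \<Longrightarrow> runsto (Const r c) (R, M) T Q"
  unfolding runsto_def by (meson exec.const)

lemma runsto_Arith:
  "Q (R(r := arith_val f (R a) (R b)), M) \<Longrightarrow> bits (R a) + bits (R b) + bits (arith_val f (R a) (R b)) \<le> T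
    \<Longrightarrow> runsto (Arith f r a b) (R, M) T Q"
  unfolding runsto_def by (meson exec.arith[OF refl])

lemma runsto_Load:
  "Q (R(r := M A (R a)), M) \<Longrightarrow> bits (R a) + bits (M A (R a)) \<le> T \<Longrightarrow> runsto (Load r A a) (R, M) T Q"
  unfolding runsto_def by (meson exec.load[OF refl])

lemma runsto_Store:
  "Q (R, M(A := (M A)(R a := R r))) \<Longrightarrow> bits (R a) + bits (R r) \<le> T \<Longrightarrow> runsto (Store A a r) (R, M) T Q"
  unfolding runsto_def by (meson exec.store)

lemma runsto_Seq:
  assumes "runsto p s T1 Q1" "\<And>R M. Q1 (R, M) \<Longrightarrow> runsto q (R, M) T2 Q" "T1 + T2 \<le> T"
  shows "runsto (Seq p q) s T Q"
proof -
  obtain t1 s1 where 1: "exec p s t1 s1" "t1 \<le> T1" "Q1 s1" using assms(1) by (auto simp: runsto_def)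
  obtain t2 s2 where 2: "exec q s1 t2 s2" "t2 \<le> T2" "Q s2"
    using assms(2)[of "fst s1" "snd s1"] 1(3) by (auto simp: runsto_def)
  show ?thesis
    unfolding runsto_def
    by (rule exI[of _ "t1 + t2"], rule exI[of _ s2]) (use exec.seq[OF 1(1) 2(1)] 1 2 assms(3) in simp)
qed

lemma runsto_Cond:
  assumes "0 < R r \<Longrightarrow> runsto p (R, M) T1 Q" "R r \<le> 0 \<Longrightarrow> runsto q (R, M) T1 Q" "bits (R r) + T1 \<le> T"
  shows "runsto (Cond r p q) (R, M) T Q"
proof (cases "0 < R r")
  case True
  then obtain t s' where "exec p (R, M) t s'" "t \<le> T1" "Q s'" using assms(1) by (auto simp: runsto_def)
  with True assms(3) show ?thesis
    unfolding runsto_def by (intro exI[of _ "bits (R r) + t"] exI[of _ s']) (auto intro: exec.cond_pos)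
next
  case False
  then obtain t s' where "exec q (R, M) t s'" "t \<le> T1" "Q s'" using assms(2) by (auto simp: runsto_def)
  with False assms(3) show ?thesis
    unfolding runsto_def by (intro exI[of _ "bits (R r) + t"] exI[of _ s']) (auto intro: exec.cond_nonpos)
qed

section \<open>Bit lengths and arithmetic\<close>

lemma bits_le_Suc_iff: "bits x \<le> Suc b \<longleftrightarrow> \<bar>x\<bar> < 2 ^ b"
  unfolding bits_def using bitlen_le_iff_power[of "\<bar>x\<bar>" "int b"] bitlen_nonneg[of "\<bar>x\<bar>"] by auto

lemma bits_pos: "bits x \<ge> 1"
  by (simp add: bits_def)

lemma bits_0 [simp]: "bits 0 = 1"
  by (simp add: bits_def)

lemma bits_1 [simp]: "bits 1 = 2"
  by (simp add: bits_def bitlen_alt_def)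

lemma bits_less: "\<bar>x\<bar> < 2 ^ (bits x - 1)"
  using bits_le_Suc_iff[of x "bits x - 1"] bits_pos[of x] by simp

lemma bits_mono: "\<bar>x\<bar> \<le> \<bar>y\<bar> \<Longrightarrow> bits x \<le> bits y"
  using bits_less[of y] bits_pos[of y] bits_le_Suc_iff[of x "bits y - 1"] by simp

lemma bits_nat_le: "j \<le> Y \<Longrightarrow> Y \<ge> 4 \<Longrightarrow> bits (int j) \<le> Y"
proof -
  assume jY: "j \<le> Y" "Y \<ge> 4"
  obtain y where y: "Y = Suc y" using jY by (cases Y) auto
  have "y + 1 < 2 ^ y" if "y \<ge> 3" for y :: nat using that by (induction y rule: dec_induct) auto
  from this[of y] have "j < 2 ^ y" using jY y by simp
  then have "int j < int (2 ^ y)" by (simp only: of_nat_less_iff)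
  then have "\<bar>int j\<bar> < 2 ^ y" by simp
  then show ?thesis unfolding y bits_le_Suc_iff .
qed

lemma bits_add: "bits (x + y) \<le> bits x + bits y"
proof -
  obtain a b where ab: "bits x = Suc a" "bits y = Suc b"
    using bits_pos[of x] bits_pos[of y] by (metis Suc_le_D One_nat_def)
  have "\<bar>x\<bar> < 2 ^ a" "\<bar>y\<bar> < 2 ^ b" using ab bits_le_Suc_iff by (metis order_refl)+
  moreover have "(2::int) ^ a \<le> 2 ^ (a + b)" "(2::int) ^ b \<le> 2 ^ (a + b)" by (simp_all add: power_increasing)
  ultimately have "\<bar>x + y\<bar> < 2 ^ Suc (a + b)" unfolding power_Suc by linarith
  then have "bits (x + y) \<le> Suc (Suc (a + b))" unfolding bits_le_Suc_iff .
  then show ?thesis using ab by simp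
qed

lemma bits_mult: "bits (x * y) \<le> bits x + bits y"
proof -
  obtain a b where ab: "bits x = Suc a" "bits y = Suc b"
    using bits_pos[of x] bits_pos[of y] by (metis Suc_le_D One_nat_def)
  have "\<bar>x\<bar> < 2 ^ a" "\<bar>y\<bar> < 2 ^ b" using ab bits_le_Suc_iff by (metis order_refl)+
  then have "\<bar>x * y\<bar> < 2 ^ (a + b)" unfolding abs_mult power_add by (intro mult_strict_mono') auto
  then have "bits (x * y) \<le> Suc (a + b)" unfolding bits_le_Suc_iff .
  then show ?thesis using ab by simp
qed

lemma bits_uminus [simp]: "bits (- x) = bits x"
  by (simp add: bits_def)

lemma abs_div_le: "\<bar>x div y\<bar> \<le> \<bar>x :: int\<bar>"
proof (cases "y = 0 \<or> x = 0")
  case False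
  then have r: "\<bar>real_of_int x / real_of_int y\<bar> \<le> \<bar>real_of_int x\<bar>"
    by (auto simp: divide_simps mult_le_cancel_left1)
  then have "- \<bar>real_of_int x\<bar> \<le> real_of_int x / real_of_int y"
    "real_of_int x / real_of_int y \<le> \<bar>real_of_int x\<bar>" by linarith+
  then have "- \<bar>x\<bar> \<le> x div y \<and> x div y \<le> \<bar>x\<bar>"
    unfolding floor_divide_of_int_eq[symmetric, where 'a = real] le_floor_iff floor_le_iff by simp
  then show ?thesis by auto
qed auto

text \<open>One estimate for all five operations, including division by 0. It is crude for sums, but
  only polynomial growth matters.\<close>

lemma bits_arith: "bits (arith_val f x y) \<le> bits x + bits y"
proof (cases f)
  case Quo
  then show ?thesis using bits_mono[OF abs_div_le[of x y]] by simp
next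
  case Rem
  have "bits (x mod y) \<le> bits x + bits y"
  proof (cases "y = 0")
    case False
    then have "\<bar>x mod y\<bar> \<le> \<bar>y\<bar>" using abs_mod_less[of y x] by simp
    then show ?thesis using bits_mono[of "x mod y" y] by simp
  qed simp
  then show ?thesis using Rem by simp
qed (use bits_add[of x y] bits_add[of x "- y"] bits_mult[of x y] in simp_all)

text \<open>The machine tests only for positivity, so the limit is counted down in \<open>c\<close>
  while \<open>i\<close> counts up. Register \<open>i + 1\<close> holds the constant 1 needed for
  both.\<close>

definition forloop :: "nat \<Rightarrow> nat \<Rightarrow> prog \<Rightarrow> prog" where
  "forloop c i body = Seq (Const i 0) (Loop c
     (Seq body (Seq (Const (i + 1) 1) (Seq (Arith Add i i (i + 1)) (Arith Sub c c (i + 1))))))"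

text \<open>A negative limit means no rounds, hence \<open>nat z\<close>. Per round,
  \<open>b\<close> pays for the test and \<open>9 * b\<close> for the three bookkeeping
  instructions; these overwrite registers, so the invariant is required of the state after
  them.\<close>

lemma runsto_forloop:
  assumes ci: "c < i"
    and body: "\<And>j R M. j < N \<Longrightarrow> I j (R, M) \<Longrightarrow> R i = int j \<Longrightarrow> R c = z - int j \<Longrightarrow>
      runsto body (R, M) T (\<lambda>(R', M'). R' i = R i \<and> R' c = R c \<and>
        I (Suc j) (R'(i + 1 := 1, i := int (Suc j), c := z - int (Suc j)), M'))"
    and start: "I 0 (R(i := 0), M)" "R c = z" "N = nat z"
    and b: "bits z \<le> b" "b \<ge> 4"
    and total: "1 + b + N * (T + 10 * b) \<le> T'"
  shows "runsto (forloop c i body) (R, M) T' (I N)"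
proof -
  let ?B = "Seq body (Seq (Const (i + 1) 1) (Seq (Arith Add i i (i + 1)) (Arith Sub c c (i + 1))))"
  have bj: "bits (int j) \<le> b" "bits (z - int j) \<le> b" if "j \<le> N" "z \<ge> 0" for j
    using that bits_mono[of "int j" z] bits_mono[of "z - int j" z] start b by force+
  have step: "runsto (Seq (Const (i + 1) 1) (Seq (Arith Add i i (i + 1)) (Arith Sub c c (i + 1)))) (R', M') (9 * b) Q"
    if "R' i + 1 = u" "R' c - 1 = v" "bits (R' i) \<le> b" "bits (R' c) \<le> b" "bits u \<le> b" "bits v \<le> b"
      "Q (R'(i + 1 := 1, i := u, c := v), M')" for R' M' u v Q
  proof (rule runsto_Seq)
    show "runsto (Const (i + 1) 1) (R', M') b (\<lambda>s. s = (R'(i + 1 := 1), M'))"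
      by (rule runsto_Const) (use b in simp_all)
    fix R'' M'' assume "(R'', M'') = (R'(i + 1 := 1), M')"
    then have 1: "R'' = R'(i + 1 := 1)" "M'' = M'" by auto
    show "runsto (Seq (Arith Add i i (i + 1)) (Arith Sub c c (i + 1))) (R'', M'') (8 * b) Q"
      unfolding 1
    proof (rule runsto_Seq)
      show "runsto (Arith Add i i (i + 1)) (R'(i + 1 := 1), M') (4 * b) (\<lambda>s. s = (R'(i + 1 := 1, i := u), M'))"
        by (rule runsto_Arith) (use b that in simp_all)
      fix R'' M'' assume "(R'', M'') = (R'(i + 1 := 1, i := u), M')"
      then have 2: "R'' = R'(i + 1 := 1, i := u)" "M'' = M'" by auto
      show "runsto (Arith Sub c c (i + 1)) (R'', M'') (4 * b) Q"
        unfolding 2 by (rule runsto_Arith) (use b that ci in simp_all)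
    qed simp
  qed simp
  have loop: "runsto (Loop c ?B) (R, M) (b + m * (T + 10 * b)) (I N)"
    if "I j (R, M)" "R i = int j" "R c = z - int j" "j + m = N" for m j R M
    using that
  proof (induction m arbitrary: j R M)
    case 0
    then have le: "R c \<le> 0" "bits (R c) \<le> b" using start b bj[of j] by (cases "z \<ge> 0"; force)+
    show ?case unfolding runsto_def
      using exec.loop_nonpos[of R c ?B M, OF le(1)] le(2) 0 by auto
  next
    case (Suc m)
    then have j: "j < N" and z: "z \<ge> 0" using start by auto
    have pos: "0 < R c" using Suc.prems j start by auto
    have "runsto ?B (R, M) (T + 9 * b) (\<lambda>(R', M'). I (Suc j) (R', M') \<and> R' i = int (Suc j) \<and> R' c = z - int (Suc j))"
    proof (rule runsto_Seq[OF body[OF j Suc.prems(1-3)]], clarify)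
      fix R' M'
      assume *: "R' i = R i" "R' c = R c" "I (Suc j) (R'(i + 1 := 1, i := int (Suc j), c := z - int (Suc j)), M')"
      have bb: "bits (R i) \<le> b" "bits (R c) \<le> b" "bits (int (Suc j)) \<le> b" "bits (z - int (Suc j)) \<le> b"
        using bj[of j] bj[of "Suc j"] j z Suc.prems by auto
      show "runsto (Seq (Const (i + 1) 1) (Seq (Arith Add i i (i + 1)) (Arith Sub c c (i + 1)))) (R', M') (9 * b)
         (\<lambda>(R', M'). I (Suc j) (R', M') \<and> R' i = int (Suc j) \<and> R' c = z - int (Suc j))"
        by (rule step[where u = "int (Suc j)" and v = "z - int (Suc j)"])
          (use * bb Suc.prems ci in auto)
    qed simp
    then obtain t s' where B: "exec ?B (R, M) t s'" "t \<le> T + 9 * b" "I (Suc j) s'"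
      "fst s' i = int (Suc j)" "fst s' c = z - int (Suc j)" by (auto simp: runsto_def)
    obtain t' s'' where L: "exec (Loop c ?B) s' t' s''" "t' \<le> b + m * (T + 10 * b)" "I N s''"
      using Suc.IH[of "Suc j" "fst s'" "snd s'"] B Suc.prems by (auto simp: runsto_def)
    have "bits (R c) \<le> b" using Suc.prems j z bj[of j] by simp
    then show ?case unfolding runsto_def
      using exec.loop_pos[OF pos B(1) L(1)] B(2) L(2,3) by (intro exI conjI) auto
  qed
  show ?thesis unfolding forloop_def
    by (rule runsto_Seq[where ?Q1.0 = "\<lambda>s. s = (R(i := 0), M)", OF runsto_Const[where T = 1]])
      (use loop[of 0 "R(i := 0)" M N] start ci total in auto)
qed

text \<open>
  Variables are de Bruijn indices into a list of values.  \<open>Red m c b\<close> is the product or sum of \<open>b\<close> over \<open>i < c\<close>,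
  and \<open>Iter a c b\<close> applies \<open>b\<close> to the pair of the counter and the accumulator; \<open>App f es\<close> evaluates
  \<open>f\<close> in the environment of the values of \<open>es\<close> alone.
\<close>

datatype ex =
    Lit int
  | Var nat
  | Bin arith ex ex
  | Inp ex
  | Ite ex ex ex
  | Red bool ex ex
  | Iter ex ex ex
  | App ex "ex list"

primrec iter :: "(nat \<Rightarrow> 'a \<Rightarrow> 'a) \<Rightarrow> nat \<Rightarrow> 'a \<Rightarrow> 'a" where
  "iter g 0 x = x"
| "iter g (Suc i) x = g i (iter g i x)"

fun eval :: "ex \<Rightarrow> int list \<Rightarrow> (int \<Rightarrow> int) \<Rightarrow> int" where
  "eval (Lit c) env w = c"
| "eval (Var i) env w = (if i < length env then env ! i else 0)"
| "eval (Bin f a b) env w = arith_val f (eval a env w) (eval b env w)"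
| "eval (Inp e) env w = w (eval e env w)"
| "eval (Ite c a b) env w = (if 0 < eval c env w then eval a env w else eval b env w)"
| "eval (Red m c b) env w =
     (if m then \<Prod>i<nat (eval c env w). eval b (int i # env) w
      else \<Sum>i<nat (eval c env w). eval b (int i # env) w)"
| "eval (Iter a c b) env w =
     iter (\<lambda>i x. eval b (int i # x # env) w) (nat (eval c env w)) (eval a env w)"
| "eval (App f es) env w = eval f (map (\<lambda>e. eval e env w) es) w"

text \<open>
  All loops have at most \<open>Y\<close> rounds.  Sums and products over so few indices increase the bit length only by a
  factor \<open>Y\<close>, but the values of an \<open>Iter\<close> need a bound of their own.
\<close>

fun fine :: "nat \<Rightarrow> ex \<Rightarrow> int list \<Rightarrow> (int \<Rightarrow> int) \<Rightarrow> bool" where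
  "fine Y (Lit c) env w = True"
| "fine Y (Var i) env w = True"
| "fine Y (Bin f a b) env w = (fine Y a env w \<and> fine Y b env w)"
| "fine Y (Inp e) env w = fine Y e env w"
| "fine Y (Ite c a b) env w =
     (fine Y c env w \<and> (if 0 < eval c env w then fine Y a env w else fine Y b env w))"
| "fine Y (Red m c b) env w = (fine Y c env w \<and> nat (eval c env w) \<le> Y \<and>
     (\<forall>i<nat (eval c env w). fine Y b (int i # env) w))"
| "fine Y (Iter a c b) env w = (fine Y a env w \<and> fine Y c env w \<and> nat (eval c env w) \<le> Y \<and>
     (\<forall>i\<le>nat (eval c env w). let x = iter (\<lambda>i x. eval b (int i # x # env) w) i (eval a env w)
        in bits x \<le> Y \<and> (i < nat (eval c env w) \<longrightarrow> fine Y b (int i # x # env) w)))"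
| "fine Y (App f es) env w =
     ((\<forall>e\<in>set es. fine Y e env w) \<and> fine Y f (map (\<lambda>e. eval e env w) es) w)"

lemma fine_mono: "fine Y e env w \<Longrightarrow> Y \<le> Y' \<Longrightarrow> fine Y' e env w"
  by (induction e arbitrary: env) (auto simp: Let_def split: if_splits dest: le_trans)

primrec seqs :: "(nat \<Rightarrow> prog) list \<Rightarrow> nat \<Rightarrow> prog" where
  "seqs [] t = Skip"
| "seqs (p # ps) t = Seq (p t) (seqs ps (Suc t))"

definition move :: "nat \<Rightarrow> nat \<Rightarrow> prog" where
  "move t s = Seq (Const t 0) (Arith Add t s t)"

text \<open>
  The environment is in the registers \<open>\<rho>\<close>, all below \<open>t\<close>; the value is put into \<open>t\<close>, and registers
  below \<open>t\<close> are preserved.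
\<close>

fun compile :: "nat \<Rightarrow> ex \<Rightarrow> nat list \<Rightarrow> nat \<Rightarrow> prog" where
  "compile A (Lit c) \<rho> t = Const t c"
| "compile A (Var i) \<rho> t = (if i < length \<rho> then move t (\<rho> ! i) else Const t 0)"
| "compile A (Bin f a b) \<rho> t = Seq (compile A a \<rho> t) (Seq (compile A b \<rho> (t + 1)) (Arith f t t (t + 1)))"
| "compile A (Inp e) \<rho> t = Seq (compile A e \<rho> t) (Load t A t)"
| "compile A (Ite c a b) \<rho> t = Seq (compile A c \<rho> t) (Cond t (compile A a \<rho> t) (compile A b \<rho> t))"
| "compile A (Red m c b) \<rho> t = Seq (Const t (if m then 1 else 0)) (Seq (compile A c \<rho> (t + 1))
     (forloop (t + 1) (t + 2)
       (Seq (compile A b ((t + 2) # \<rho>) (t + 3)) (Arith (if m then Mul else Add) t t (t + 3)))))"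
| "compile A (Iter a c b) \<rho> t = Seq (compile A a \<rho> t) (Seq (compile A c \<rho> (t + 1))
     (forloop (t + 1) (t + 2) (Seq (compile A b ((t + 2) # t # \<rho>) (t + 3)) (move t (t + 3)))))"
| "compile A (App f es) \<rho> t = Seq (seqs (map (\<lambda>e. compile A e \<rho>) es) (Suc t))
     (Seq (compile A f [Suc t..<Suc t + length es] (Suc t + length es)) (move t (Suc t + length es)))"

section \<open>Compiling expressions\<close>

abbreviation computes :: "int \<Rightarrow> nat \<Rightarrow> (nat \<Rightarrow> int) \<Rightarrow> (nat \<Rightarrow> int \<Rightarrow> int) \<Rightarrow> state \<Rightarrow> bool" where
  "computes v t R M \<equiv> \<lambda>(R', M'). M' = M \<and> R' t = v \<and> (\<forall>x<t. R' x = R x)"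

text \<open>
  For a fixed expression, time and bit length are polynomial in the bound \<open>Y\<close>.  This makes explicit running
  times of the individual expressions unnecessary.
\<close>

definition comp_spec :: "ex \<Rightarrow> nat \<Rightarrow> bool" where
  "comp_spec e c \<longleftrightarrow> (\<forall>Y\<ge>4. \<forall>env w.
     (\<forall>x\<in>set env. bits x \<le> Y) \<and> (\<forall>a. bits (w a) \<le> Y) \<and> fine Y e env w \<longrightarrow>
     bits (eval e env w) \<le> Y ^ c \<and>
     (\<forall>A \<rho> t R M. (\<forall>x\<in>set \<rho>. x < t) \<and> map R \<rho> = env \<and> M A = w \<longrightarrow>
       runsto (compile A e \<rho> t) (R, M) (Y ^ c)
         (computes (eval e env w) t R M)))"

lemma comp_spec_bits:
  assumes "comp_spec e c" "Y \<ge> 4" "\<And>x. x \<in> set env \<Longrightarrow> bits x \<le> Y"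
    "\<And>a. bits (w a) \<le> Y" "fine Y e env w"
  shows "bits (eval e env w) \<le> Y ^ c"
  using assms unfolding comp_spec_def by blast

lemma comp_spec_runsto:
  assumes "comp_spec e c" "Y \<ge> 4" "\<And>x. x \<in> set env \<Longrightarrow> bits x \<le> Y"
    "\<And>a. bits (w a) \<le> Y" "fine Y e env w"
    "\<And>x. x \<in> set \<rho> \<Longrightarrow> x < t" "map R \<rho> = env" "M A = w"
    "\<And>R'. R' t = eval e env w \<Longrightarrow> (\<And>x. x < t \<Longrightarrow> R' x = R x) \<Longrightarrow> Q (R', M)"
    "Y ^ c \<le> T"
  shows "runsto (compile A e \<rho> t) (R, M) T Q"
proof -
  have "runsto (compile A e \<rho> t) (R, M) (Y ^ c)
       (computes (eval e env w) t R M)"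
    using assms(1-8) unfolding comp_spec_def by blast
  then show ?thesis by (rule runsto_mono) (use assms(9,10) in auto)
qed

lemma comp_specI:
  assumes "\<And>Y env w. Y \<ge> 4 \<Longrightarrow> (\<And>x. x \<in> set env \<Longrightarrow> bits x \<le> Y) \<Longrightarrow> (\<And>a. bits (w a) \<le> Y) \<Longrightarrow>
      fine Y e env w \<Longrightarrow> bits (eval e env w) \<le> Y ^ c"
    "\<And>Y env A \<rho> t R M. Y \<ge> 4 \<Longrightarrow> (\<And>x. x \<in> set env \<Longrightarrow> bits x \<le> Y) \<Longrightarrow> (\<And>a. bits (M A a) \<le> Y) \<Longrightarrow>
      fine Y e env (M A) \<Longrightarrow> (\<And>x. x \<in> set \<rho> \<Longrightarrow> x < t) \<Longrightarrow> map R \<rho> = env \<Longrightarrow>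
      runsto (compile A e \<rho> t) (R, M) (Y ^ c)
         (computes (eval e env (M A)) t R M)"
  shows "comp_spec e c"
  unfolding comp_spec_def using assms by blast

lemma comp_spec_mono:
  assumes "comp_spec e c" "c \<le> c'"
  shows "comp_spec e c'"
proof (rule comp_specI)
  fix Y :: nat and env :: "int list" and w :: "int \<Rightarrow> int"
  assume *: "Y \<ge> 4" "\<And>x. x \<in> set env \<Longrightarrow> bits x \<le> Y" "\<And>a. bits (w a) \<le> Y" "fine Y e env w"
  have "Y ^ c \<le> Y ^ c'" using * assms(2) by (intro power_increasing) auto
  then show "bits (eval e env w) \<le> Y ^ c'"
    using comp_spec_bits[OF assms(1) *] by simp
next
  fix Y :: nat and env :: "int list" and A :: nat and \<rho> :: "nat list" and t :: nat and R :: "nat \<Rightarrow> int" and M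
  assume *: "Y \<ge> 4" "\<And>x. x \<in> set env \<Longrightarrow> bits x \<le> Y" "\<And>a. bits (M A a) \<le> Y" "fine Y e env (M A)"
     "(\<And>x. x \<in> set \<rho> \<Longrightarrow> x < t)" "map R \<rho> = env"
  show "runsto (compile A e \<rho> t) (R, M) (Y ^ c')
         (computes (eval e env (M A)) t R M)"
    by (rule comp_spec_runsto[OF assms(1) *]) (use * assms(2) in \<open>auto intro: power_increasing\<close>)
qed

text \<open>Because of \<open>Y \<ge> 4\<close>, constant factors disappear into a few extra
  exponents.\<close>

lemma mult_le_power:
  fixes Y :: nat
  assumes "Y \<ge> 4" "x \<le> Y ^ a" "k \<le> 4 ^ b" "a + b \<le> c"
  shows "k * x \<le> Y ^ c"
proof -
  have "(4::nat) ^ b \<le> Y ^ b" using assms by (intro power_mono) auto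
  then have "k * x \<le> Y ^ b * Y ^ a" using assms by (intro mult_mono) auto
  also have "\<dots> = Y ^ (a + b)" by (simp add: power_add mult.commute)
  also have "\<dots> \<le> Y ^ c" using assms by (intro power_increasing) auto
  finally show ?thesis .
qed

lemma runsto_move:
  assumes "t \<noteq> s" "Q (R(t := R s), M)" "2 * bits (R s) + 2 \<le> T"
  shows "runsto (move t s) (R, M) T Q"
  unfolding move_def
proof (rule runsto_Seq)
  show "runsto (Const t 0) (R, M) 1 (\<lambda>s. s = (R(t := 0), M))" by (rule runsto_Const) auto
  fix R' M' assume "(R', M') = (R(t := 0), M)"
  then have 1: "R' = R(t := 0)" "M' = M" by auto
  show "runsto (Arith Add t s t) (R', M') (2 * bits (R s) + 1) Q"
    unfolding 1 by (rule runsto_Arith) (use assms in auto)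
qed (use assms in simp)

text \<open>Bit length is subadditive under sums and products alike, so a fold grows linearly in the
  number of terms. The 2 is the length of the empty product.\<close>

lemma bits_fold:
  assumes "\<And>i. i < N \<Longrightarrow> bits (g i) \<le> (b :: nat)"
  shows "bits (if m then \<Prod>i<N. g i else \<Sum>i<N. g i) \<le> 2 + N * b"
  using assms
proof (induction N)
  case (Suc N)
  then have "bits (if m then \<Prod>i<N. g i else \<Sum>i<N. g i) \<le> 2 + N * b" "bits (g N) \<le> b" by auto
  then show ?case
    using bits_add[of "\<Sum>i<N. g i" "g N"] bits_mult[of "\<Prod>i<N. g i" "g N"]
    by (cases m) (simp_all)
qed simp

text \<open>\<open>Z\<close> bounds the lengths and costs inside a round; its spare exponents pay
  for a fold of up to \<open>Y\<close> values. The exponents beyond \<open>Z\<close> pay for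
  \<open>Y\<close> rounds and the setup.\<close>

lemma comp_spec_loop_bound:
  fixes Y :: nat
  assumes "Y \<ge> 4" and Z_def: "Z = Y ^ (a + b + 2)"
  shows "4 * Y ^ a \<le> Z" "4 * Y ^ b \<le> Z" "j \<le> Y \<Longrightarrow> 2 + j * Y ^ b \<le> Z" "4 * Y \<le> Z"
    "j \<le> Y \<Longrightarrow> 2 + (Z + (1 + Z + j * (5 * Z + 10 * Z))) \<le> Y ^ (a + b + 10)" "Z \<le> Y ^ (a + b + 10)"
proof -
  have p: "1 \<le> Y ^ a" "1 \<le> Y ^ b" using assms by auto
  show 1: "4 * Y ^ a \<le> Z" unfolding Z_def by (rule mult_le_power[of _ _ a _ 1]) (use assms in auto)
  show 2: "4 * Y ^ b \<le> Z" unfolding Z_def by (rule mult_le_power[of _ _ b _ 1]) (use assms in auto)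
  show 3: "4 * Y \<le> Z" unfolding Z_def by (rule mult_le_power[of _ _ 1 _ 1]) (use assms in auto)
  show "2 + j * Y ^ b \<le> Z" if "j \<le> Y"
  proof -
    have "j * Y ^ b \<le> Y * Y ^ b" using that by simp
    moreover have "4 * (Y * Y ^ b) \<le> Z" unfolding Z_def by (rule mult_le_power[of _ _ "Suc b" _ 1]) (use assms in auto)
    ultimately show ?thesis using 3 assms(1) by linarith
  qed
  show "2 + (Z + (1 + Z + j * (5 * Z + 10 * Z))) \<le> Y ^ (a + b + 10)" if "j \<le> Y"
  proof -
    have "j * Z \<le> Y * Z" "1 * Z \<le> Y * Z" using that assms(1) by (intro mult_right_mono; simp)+
    moreover have "3 \<le> Z" using 3 assms(1) by simp
    moreover have "2 + (Z + (1 + Z + j * (5 * Z + 10 * Z))) = 3 + 2 * Z + 15 * (j * Z)" by (simp add: algebra_simps)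
    ultimately have "2 + (Z + (1 + Z + j * (5 * Z + 10 * Z))) \<le> 18 * (Y * Z)" by linarith
    also have "\<dots> \<le> Y ^ (a + b + 10)"
      by (rule mult_le_power[where a = "a + b + 3" and b = 3]) (use assms in \<open>auto simp: Z_def power_add power2_eq_square power3_eq_cube mult_ac\<close>)
    finally show ?thesis .
  qed
  show "Z \<le> Y ^ (a + b + 10)" unfolding Z_def using assms by (intro power_increasing) auto
qed

text \<open>Shared by \<open>Red\<close> and \<open>Iter\<close>. Register \<open>t\<close> is the
  accumulator, \<open>t + 1\<close> the countdown and \<open>t + 2\<close> the counter. Register
  \<open>t + 3\<close> receives the value of the body and is then overwritten by the constant 1 of
  \<open>forloop\<close>, so the invariant speaks only of registers up to \<open>t\<close>.\<close>

lemma runsto_loop: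
  assumes c: "comp_spec c a" and Y: "Y \<ge> 4" and env: "\<And>x. x \<in> set env \<Longrightarrow> bits x \<le> Y"
    and w: "\<And>a. bits (M A a) \<le> Y" and fine: "fine Y c env (M A)"
    and \<rho>: "\<And>x. x \<in> set \<rho> \<Longrightarrow> x < t" and m: "map R \<rho> = env"
    and N: "N = nat (eval c env (M A))" "N \<le> Y" and Z: "Z = Y ^ (a + b + 2)"
    and init: "runsto p (R, M) T (computes (S 0) t R M)" "T + Y ^ a \<le> 2 + Z"
    and body: "\<And>j R'. j < N \<Longrightarrow> R' (t + 2) = int j \<Longrightarrow> R' t = S j \<Longrightarrow> (\<And>x. x < t \<Longrightarrow> R' x = R x) \<Longrightarrow>
      runsto pb (R', M) (5 * Z) (\<lambda>(R'', M'). M' = M \<and> R'' t = S (Suc j) \<and>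
        (\<forall>x. x < t + 3 \<and> x \<noteq> t \<longrightarrow> R'' x = R' x))"
  shows "runsto (Seq p (Seq (compile A c \<rho> (t + 1)) (forloop (t + 1) (t + 2) pb))) (R, M)
    (Y ^ (a + b + 10)) (computes (S N) t R M)"
proof -
  note Z' = comp_spec_loop_bound[OF Y Z]
  define z where "z = eval c env (M A)"
  have bz: "bits z \<le> Z" unfolding z_def
    using comp_spec_bits[of c a Y env "M A"] c Y env w fine Z'(1) by fastforce
  let ?I = "\<lambda>j. computes (S j) t R M"
  have "runsto (Seq p (Seq (compile A c \<rho> (t + 1)) (forloop (t + 1) (t + 2) pb))) (R, M)
    (T + (Y ^ a + (1 + Z + N * (5 * Z + 10 * Z)))) (?I N)"
  proof (rule runsto_Seq[OF init(1)])
    fix R1 :: "nat \<Rightarrow> int" and M1 :: "nat \<Rightarrow> int \<Rightarrow> int" assume "computes (S 0) t R M (R1, M1)"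
    then have 1: "M1 = M" "R1 t = S 0" "\<forall>x<t. R1 x = R x" by auto
    have e: "map R1 \<rho> = env" using \<rho> 1 m by auto
    show "runsto (Seq (compile A c \<rho> (t + 1)) (forloop (t + 1) (t + 2) pb)) (R1, M1)
      (Y ^ a + (1 + Z + N * (5 * Z + 10 * Z))) (?I N)"
      unfolding 1(1)
    proof (rule runsto_Seq)
      show "runsto (compile A c \<rho> (t + 1)) (R1, M) (Y ^ a) (\<lambda>(R2, M2). R2 (t + 1) = z \<and> ?I 0 (R2, M2))"
      proof (rule comp_spec_runsto[OF c Y env w _ _ e])
        show "x < t + 1" if "x \<in> set \<rho>" for x using \<rho>[OF that] by simp
      qed (use fine 1 in \<open>auto simp: z_def\<close>)
      fix R2 :: "nat \<Rightarrow> int" and M2 :: "nat \<Rightarrow> int \<Rightarrow> int"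
      assume "case (R2, M2) of (R2, M2) \<Rightarrow> R2 (t + 1) = z \<and> ?I 0 (R2, M2)"
      then have 2: "R2 (t + 1) = z" "?I 0 (R2, M2)" by auto
      show "runsto (forloop (t + 1) (t + 2) pb) (R2, M2) (1 + Z + N * (5 * Z + 10 * Z)) (?I N)"
      proof (rule runsto_forloop[where z = z and I = ?I and T = "5 * Z" and b = Z])
        fix j R' M'
        assume j: "j < N" and I: "?I j (R', M')" and i: "R' (t + 2) = int j" and "R' (t + 1) = z - int j"
        show "runsto pb (R', M') (5 * Z) (\<lambda>(R'', M'). R'' (t + 2) = R' (t + 2) \<and> R'' (t + 1) = R' (t + 1) \<and>
          ?I (Suc j) (R''(t + 2 + 1 := 1, t + 2 := int (Suc j), t + 1 := z - int (Suc j)), M'))"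
          using I by (auto intro!: runsto_mono[OF body[where j = j and R' = R', OF j i]])
      qed (use 2 bz Z'(4) Y N in \<open>auto simp: z_def\<close>)
    qed simp
  qed simp
  then show ?thesis
    by (rule runsto_mono) (use Z'(5)[OF N(2)] init(2) in auto)
qed

lemma comp_spec_Red:
  assumes c: "comp_spec c a" and b: "comp_spec b a'"
  shows "comp_spec (Red m c b) (a + a' + 10)"
proof -
  define S where "S env w j = (if m then \<Prod>i<j. eval b (int i # env) w else \<Sum>i<j. eval b (int i # env) w)" for env w and j :: nat
  have bg: "bits (eval b (int i # env) w) \<le> Y ^ a'"
    if "Y \<ge> 4" "\<And>x. x \<in> set env \<Longrightarrow> bits x \<le> Y" "\<And>a. bits (w a) \<le> Y"
      "fine Y (Red m c b) env w" "i < nat (eval c env w)" for Y env w i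
    by (rule comp_spec_bits[OF b]) (use that bits_nat_le[of i Y] in auto)
  have bS: "bits (S env w j) \<le> Y ^ (a + a' + 2)"
    if "Y \<ge> 4" "\<And>x. x \<in> set env \<Longrightarrow> bits x \<le> Y" "\<And>a. bits (w a) \<le> Y"
      "fine Y (Red m c b) env w" "j \<le> nat (eval c env w)" for Y env w j
  proof -
    have "bits (S env w j) \<le> 2 + j * Y ^ a'" unfolding S_def
      by (rule bits_fold) (use bg[OF that(1-4)] that(5) in auto)
    then show ?thesis using comp_spec_loop_bound(3)[OF that(1) refl, of j a' a] that(4,5) by simp
  qed
  show ?thesis
  proof (rule comp_specI)
    fix Y :: nat and env :: "int list" and w :: "int \<Rightarrow> int"
    assume *: "Y \<ge> 4" "\<And>x. x \<in> set env \<Longrightarrow> bits x \<le> Y" "\<And>a. bits (w a) \<le> Y" "fine Y (Red m c b) env w"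
    show "bits (eval (Red m c b) env w) \<le> Y ^ (a + a' + 10)"
      using bS[OF *, of "nat (eval c env w)"] comp_spec_loop_bound(6)[OF *(1) refl, of a a'] by (simp add: S_def)
  next
    fix Y :: nat and env :: "int list" and A :: nat and \<rho> :: "nat list" and t :: nat and R :: "nat \<Rightarrow> int" and M
    assume Y: "Y \<ge> 4" and env: "\<And>x. x \<in> set env \<Longrightarrow> bits x \<le> Y" and w: "\<And>a. bits (M A a) \<le> Y"
      and fine: "fine Y (Red m c b) env (M A)"
      and \<rho>: "\<And>x. x \<in> set \<rho> \<Longrightarrow> x < t" and m: "map R \<rho> = env"
    let ?w = "M A"
    define N where "N = nat (eval c env ?w)"
    define Z where "Z = Y ^ (a + a' + 2)"
    have N: "N \<le> Y" using fine by (simp add: N_def)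
    note Z = comp_spec_loop_bound[OF Y Z_def]
    have g: "bits (eval b (int i # env) ?w) \<le> Y ^ a'" if "i < N" for i
      by (rule bg) (use that Y env w fine in \<open>auto simp: N_def\<close>)
    have SZ: "bits (S env ?w j) \<le> Z" if "j \<le> N" for j
      unfolding Z_def by (rule bS) (use that Y env w fine in \<open>auto simp: N_def\<close>)
    have "runsto (compile A (Red m c b) \<rho> t) (R, M) (Y ^ (a + a' + 10)) (computes (S env ?w N) t R M)"
      unfolding compile.simps
    proof (rule runsto_loop[where M = M and A = A and S = "S env ?w", OF c Y env w _ \<rho> m N_def N Z_def])
      show "runsto (Const t (if m then 1 else 0)) (R, M) 2 (computes (S env ?w 0) t R M)"
        by (rule runsto_Const) (auto simp: S_def)
      fix j R'
      assume j: "j < N" and R': "R' (t + 2) = int j" "R' t = S env ?w j" "\<And>x. x < t \<Longrightarrow> R' x = R x"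
      have e: "map R' ((t + 2) # \<rho>) = int j # env" using R' \<rho> m by auto
      have s: "arith_val (if m then Mul else Add) (S env ?w j) (eval b (int j # env) ?w) = S env ?w (Suc j)" by (simp add: S_def)
      show "runsto (Seq (compile A b ((t + 2) # \<rho>) (t + 3)) (Arith (if m then Mul else Add) t t (t + 3))) (R', M) (5 * Z)
          (\<lambda>(R'', M'). M' = M \<and> R'' t = S env ?w (Suc j) \<and> (\<forall>x. x < t + 3 \<and> x \<noteq> t \<longrightarrow> R'' x = R' x))"
      proof (rule runsto_Seq)
        show "runsto (compile A b ((t + 2) # \<rho>) (t + 3)) (R', M) Z (computes (eval b (int j # env) ?w) (t + 3) R' M)"
        proof (rule comp_spec_runsto[OF b Y, where env = "int j # env" and w = ?w])
          show "bits x \<le> Y" if "x \<in> set (int j # env)" for x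
            using that env bits_nat_le[of j Y] j N Y by auto
          show "fine Y b (int j # env) ?w" using fine j by (simp add: N_def)
          show "Y ^ a' \<le> Z" using Z(2) by simp
          show "x < t + 3" if "x \<in> set ((t + 2) # \<rho>)" for x using that \<rho> by force
        qed (use w e in auto)
        fix R2 :: "nat \<Rightarrow> int" and M2 :: "nat \<Rightarrow> int \<Rightarrow> int"
        assume "computes (eval b (int j # env) ?w) (t + 3) R' M (R2, M2)"
        then have R2: "M2 = M" "R2 (t + 3) = eval b (int j # env) ?w" "\<And>x. x < t+3 \<Longrightarrow> R2 x = R' x" by auto
        show "runsto (Arith (if m then Mul else Add) t t (t + 3)) (R2, M2) (4 * Z)
          (\<lambda>(R'', M'). M' = M \<and> R'' t = S env ?w (Suc j) \<and> (\<forall>x. x < t + 3 \<and> x \<noteq> t \<longrightarrow> R'' x = R' x))"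
          by (rule runsto_Arith)
             (use R2 s R' SZ[of j] SZ[of "Suc j"] g[OF j] Z(2) j in \<open>auto simp del: arith_val.simps\<close>)
      qed simp
    qed (use fine Z(1) in auto)
    then show "runsto (compile A (Red m c b) \<rho> t) (R, M) (Y ^ (a + a' + 10)) (computes (eval (Red m c b) env (M A)) t R M)"
      by (simp add: S_def N_def)
  qed
qed

lemma comp_spec_Iter:
  assumes a: "comp_spec a n" and c: "comp_spec c n" and b: "comp_spec b n"
  shows "comp_spec (Iter a c b) (n + n + 10)"
proof -
  define S where "S env w j = iter (\<lambda>i x. eval b (int i # x # env) w) j (eval a env w)" for env w j
  have S_Suc: "S env w (Suc j) = eval b (int j # S env w j # env) w" for env w j by (simp add: S_def)
  have bS: "bits (S env w j) \<le> Y" if "fine Y (Iter a c b) env w" "j \<le> nat (eval c env w)" for Y env w j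
    using that by (auto simp: S_def Let_def)
  show ?thesis
  proof (rule comp_specI)
    fix Y :: nat and env :: "int list" and w :: "int \<Rightarrow> int"
    assume *: "Y \<ge> 4" "\<And>x. x \<in> set env \<Longrightarrow> bits x \<le> Y" "\<And>a. bits (w a) \<le> Y" "fine Y (Iter a c b) env w"
    have "bits (eval (Iter a c b) env w) \<le> Y"
      using bS[OF *(4), of "nat (eval c env w)"] by (simp add: S_def)
    also have "Y \<le> Y ^ (n + n + 10)" using * by (intro self_le_power) auto
    finally show "bits (eval (Iter a c b) env w) \<le> Y ^ (n + n + 10)" .
  next
    fix Y :: nat and env :: "int list" and A :: nat and \<rho> :: "nat list" and t :: nat and R :: "nat \<Rightarrow> int" and M
    assume Y: "Y \<ge> 4" and env: "\<And>x. x \<in> set env \<Longrightarrow> bits x \<le> Y" and w: "\<And>a. bits (M A a) \<le> Y"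
      and fine: "fine Y (Iter a c b) env (M A)"
      and \<rho>: "\<And>x. x \<in> set \<rho> \<Longrightarrow> x < t" and m: "map R \<rho> = env"
    let ?w = "M A"
    define N where "N = nat (eval c env ?w)"
    define Z where "Z = Y ^ (n + n + 2)"
    have N: "N \<le> Y" using fine by (simp add: N_def)
    note Z = comp_spec_loop_bound[OF Y Z_def]
    have SY: "bits (S env ?w j) \<le> Y" if "j \<le> N" for j
      using bS[OF fine] that by (simp add: N_def)
    have "runsto (compile A (Iter a c b) \<rho> t) (R, M) (Y ^ (n + n + 10)) (computes (S env ?w N) t R M)"
      unfolding compile.simps
    proof (rule runsto_loop[where M = M and A = A and S = "S env ?w", OF c Y env w _ \<rho> m N_def N Z_def])
      show "runsto (compile A a \<rho> t) (R, M) (Y ^ n) (computes (S env ?w 0) t R M)"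
        by (rule comp_spec_runsto[OF a Y env w _ \<rho> m]) (use fine in \<open>auto simp: S_def\<close>)
      fix j R'
      assume j: "j < N" and R': "R' (t + 2) = int j" "R' t = S env ?w j" "\<And>x. x < t \<Longrightarrow> R' x = R x"
      have e: "map R' ((t + 2) # t # \<rho>) = int j # S env ?w j # env" using R' \<rho> m by auto
      show "runsto (Seq (compile A b ((t + 2) # t # \<rho>) (t + 3)) (move t (t + 3))) (R', M) (5 * Z)
          (\<lambda>(R'', M'). M' = M \<and> R'' t = S env ?w (Suc j) \<and> (\<forall>x. x < t + 3 \<and> x \<noteq> t \<longrightarrow> R'' x = R' x))"
      proof (rule runsto_Seq)
        show "runsto (compile A b ((t + 2) # t # \<rho>) (t + 3)) (R', M) Z (computes (S env ?w (Suc j)) (t + 3) R' M)"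
        proof (rule comp_spec_runsto[OF b Y, where env = "int j # S env ?w j # env" and w = ?w])
          show "bits x \<le> Y" if "x \<in> set (int j # S env ?w j # env)" for x
            using that env bits_nat_le[of j Y] j N Y SY[of j] by auto
          show "fine Y b (int j # S env ?w j # env) ?w" using fine j by (simp add: N_def S_def Let_def)
          show "Y ^ n \<le> Z" using Z(2) by simp
          show "x < t + 3" if "x \<in> set ((t + 2) # t # \<rho>)" for x using that \<rho> by force
        qed (use w e S_Suc in auto)
        fix R2 :: "nat \<Rightarrow> int" and M2 :: "nat \<Rightarrow> int \<Rightarrow> int"
        assume "computes (S env ?w (Suc j)) (t + 3) R' M (R2, M2)"
        then have R2: "M2 = M" "R2 (t + 3) = S env ?w (Suc j)" "\<And>x. x < t+3 \<Longrightarrow> R2 x = R' x" by auto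
        show "runsto (move t (t + 3)) (R2, M2) (4 * Z)
          (\<lambda>(R'', M'). M' = M \<and> R'' t = S env ?w (Suc j) \<and> (\<forall>x. x < t + 3 \<and> x \<noteq> t \<longrightarrow> R'' x = R' x))"
          by (rule runsto_move) (use R2 SY[of "Suc j"] Z(4) Y j in auto)
      qed simp
    qed (use fine Z(1) in auto)
    then show "runsto (compile A (Iter a c b) \<rho> t) (R, M) (Y ^ (n + n + 10)) (computes (eval (Iter a c b) env (M A)) t R M)"
      by (simp add: S_def N_def)
  qed
qed

lemma runsto_seqs:
  assumes "\<And>e. e \<in> set es \<Longrightarrow> comp_spec e c" "Y \<ge> 4" "\<And>x. x \<in> set env \<Longrightarrow> bits x \<le> Y" "\<And>a. bits (M A a) \<le> Y"
    "\<And>e. e \<in> set es \<Longrightarrow> fine Y e env (M A)" "\<And>x. x \<in> set \<rho> \<Longrightarrow> x < t" "map R \<rho> = env"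
  shows "runsto (seqs (map (\<lambda>e. compile A e \<rho>) es) t) (R, M) (1 + length es * Y ^ c)
       (\<lambda>(R', M'). M' = M \<and> map R' [t..<t + length es] = map (\<lambda>e. eval e env (M A)) es \<and> (\<forall>x<t. R' x = R x))"
  using assms
proof (induction es arbitrary: t R)
  case Nil
  then show ?case by (auto intro: runsto_Skip)
next
  case (Cons e es)
  show ?case unfolding seqs.simps list.map
  proof (rule runsto_Seq)
    show "runsto (compile A e \<rho> t) (R, M) (Y ^ c) (computes (eval e env (M A)) t R M)"
      by (rule comp_spec_runsto[of e c Y env "M A"]) (use Cons.prems in auto)
    fix R1 M1 assume "computes (eval e env (M A)) t R M (R1, M1)"
    then have 1: "M1 = M" "R1 t = eval e env (M A)" "\<forall>x<t. R1 x = R x" by auto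
    have e: "map R1 \<rho> = env" using 1 Cons.prems by auto
    have "runsto (seqs (map (\<lambda>e. compile A e \<rho>) es) (Suc t)) (R1, M) (1 + length es * Y ^ c)
       (\<lambda>(R', M'). M' = M \<and> map R' [Suc t..<Suc t + length es] = map (\<lambda>e. eval e env (M A)) es \<and> (\<forall>x<Suc t. R' x = R1 x))"
    proof (rule Cons.IH)
      show "x < Suc t" if "x \<in> set \<rho>" for x using Cons.prems(6)[OF that] by simp
    qed (use Cons.prems e in auto)
    then show "runsto (seqs (map (\<lambda>e. compile A e \<rho>) es) (Suc t)) (R1, M1) (1 + length es * Y ^ c)
      (\<lambda>(R', M'). M' = M \<and> map R' [t..<t + length (e # es)] = eval e env (M A) # map (\<lambda>e. eval e env (M A)) es \<and> (\<forall>x<t. R' x = R x))"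
      unfolding 1(1)
      by (rule runsto_mono) (use 1 in \<open>auto simp del: upt_Suc simp: upt_conv_Cons\<close>)
  qed simp
qed

text \<open>The arguments may have \<open>Y ^ n\<close> bits, so \<open>f\<close> is run with
  \<open>Y ^ n\<close> as its bound, by monotonicity of \<open>fine\<close>. Thus the exponents
  multiply.\<close>

lemma comp_spec_App:
  assumes es: "\<And>e. e \<in> set es \<Longrightarrow> comp_spec e n" and f: "comp_spec f n'" and n: "n \<ge> 1"
  shows "comp_spec (App f es) (n + length es + n * n' + 10)"
proof (rule comp_specI)
  fix Y :: nat and env :: "int list" and w :: "int \<Rightarrow> int"
  assume *: "Y \<ge> 4" "\<And>x. x \<in> set env \<Longrightarrow> bits x \<le> Y" "\<And>a. bits (w a) \<le> Y" "fine Y (App f es) env w"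
  have Yn: "Y \<le> Y ^ n" using * n by (intro self_le_power) auto
  have "bits (eval f (map (\<lambda>e. eval e env w) es) w) \<le> (Y ^ n) ^ n'"
  proof (rule comp_spec_bits[OF f])
    show "bits x \<le> Y ^ n" if x: "x \<in> set (map (\<lambda>e. eval e env w) es)" for x
    proof -
      obtain e where "e \<in> set es" "x = eval e env w" using x by auto
      then show ?thesis using comp_spec_bits[OF es *(1-3)] *(4) by auto
    qed
    show "bits (w a) \<le> Y ^ n" for a using *(3)[of a] Yn by simp
    show "fine (Y ^ n) f (map (\<lambda>e. eval e env w) es) w" using *(4) Yn by (auto intro: fine_mono)
    show "4 \<le> Y ^ n" using Yn * by simp
  qed
  also have "\<dots> \<le> Y ^ (n + length es + n * n' + 10)"
    unfolding power_mult[symmetric] using * by (intro power_increasing) auto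
  finally show "bits (eval (App f es) env w) \<le> Y ^ (n + length es + n * n' + 10)" by simp
next
  fix Y :: nat and env :: "int list" and A :: nat and \<rho> :: "nat list" and t :: nat and R :: "nat \<Rightarrow> int" and M
  assume Y: "Y \<ge> 4" and env: "\<And>x. x \<in> set env \<Longrightarrow> bits x \<le> Y" and w: "\<And>a. bits (M A a) \<le> Y"
    and fine: "fine Y (App f es) env (M A)"
    and \<rho>: "\<And>x. x \<in> set \<rho> \<Longrightarrow> x < t" and m: "map R \<rho> = env"
  let ?w = "M A" and ?l = "length es"
  let ?env = "map (\<lambda>e. eval e env ?w) es"
  have Yn: "Y \<le> Y ^ n" using Y n by (intro self_le_power) auto
  have benv: "bits x \<le> Y ^ n" if x: "x \<in> set ?env" for x
  proof -
    obtain e where "e \<in> set es" "x = eval e env ?w" using x by auto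
    then show ?thesis using comp_spec_bits[OF es Y env w] fine by auto
  qed
  have w': "bits (?w a) \<le> Y ^ n" for a using w[of a] Yn by simp
  have fine': "fine (Y ^ n) f ?env ?w" using fine Yn by (auto intro: fine_mono)
  have Y': "4 \<le> Y ^ n" using Yn Y by simp
  let ?r = "eval f ?env ?w"
  have bits: "bits ?r \<le> (Y ^ n) ^ n'" by (rule comp_spec_bits[OF f Y' benv w' fine'])
  have "runsto (compile A (App f es) \<rho> t) (R, M) (1 + ?l * Y ^ n + ((Y ^ n) ^ n' + (2 * (Y ^ n) ^ n' + 2)))
      (computes ?r t R M)"
    unfolding compile.simps
  proof (rule runsto_Seq[OF runsto_seqs[of es n Y env M A \<rho> "Suc t" R]])
    fix R1 M1
    assume "case (R1, M1) of (R', M') \<Rightarrow> M' = M \<and> map R' [Suc t..<Suc t + ?l] = map (\<lambda>e. eval e env (M A)) es \<and> (\<forall>x<Suc t. R' x = R x)"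
    then have 1: "M1 = M" "map R1 [Suc t..<Suc t + ?l] = ?env" "\<forall>x<Suc t. R1 x = R x" by auto
    show "runsto (Seq (compile A f [Suc t..<Suc t + ?l] (Suc t + ?l)) (move t (Suc t + ?l))) (R1, M1) ((Y ^ n) ^ n' + (2 * (Y ^ n) ^ n' + 2))
      (computes ?r t R M)"
      unfolding 1(1)
    proof (rule runsto_Seq)
      show "runsto (compile A f [Suc t..<Suc t + ?l] (Suc t + ?l)) (R1, M) ((Y ^ n) ^ n') (\<lambda>(R2, M2). M2 = M \<and> R2 (Suc t + ?l) = ?r \<and> (\<forall>x<t. R2 x = R x))"
        by (rule comp_spec_runsto[OF f Y' benv w' fine' _ 1(2)]) (use 1 in auto)
      fix R2 M2 assume "case (R2, M2) of (R2, M2) \<Rightarrow> M2 = M \<and> R2 (Suc t + ?l) = ?r \<and> (\<forall>x<t. R2 x = R x)"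
      then have 2: "M2 = M" "R2 (Suc t + ?l) = ?r" "\<forall>x<t. R2 x = R x" by auto
      show "runsto (move t (Suc t + ?l)) (R2, M2) (2 * (Y ^ n) ^ n' + 2) (computes ?r t R M)"
        by (rule runsto_move) (use 2 bits in auto)
    qed simp
  next
    show "x < Suc t" if "x \<in> set \<rho>" for x using \<rho>[OF that] by simp
  qed (use es Y env w fine m in auto)
  moreover have "1 + ?l * Y ^ n + ((Y ^ n) ^ n' + (2 * (Y ^ n) ^ n' + 2)) \<le> Y ^ (n + ?l + n * n' + 10)"
  proof -
    have "?l * Y ^ n \<le> Y ^ (n + ?l + n * n' + 9)"
      by (rule mult_le_power[of _ _ n _ ?l]) (use Y in \<open>auto intro: order_trans[OF less_imp_le[OF less_exp] power_mono]\<close>)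
    moreover have "3 * (Y ^ n) ^ n' \<le> Y ^ (n + ?l + n * n' + 9)"
      by (rule mult_le_power[of _ _ "n * n'" _ 1]) (use Y in \<open>auto simp: power_mult\<close>)
    moreover have "3 * 1 \<le> Y ^ (n + ?l + n * n' + 9)"
      by (rule mult_le_power[of _ _ 0 _ 1]) (use Y in auto)
    ultimately have "1 + ?l * Y ^ n + ((Y ^ n) ^ n' + (2 * (Y ^ n) ^ n' + 2)) \<le> 4 * Y ^ (n + ?l + n * n' + 9)" by linarith
    also have "\<dots> \<le> Y ^ (n + ?l + n * n' + 10)"
      by (rule mult_le_power[of _ _ "n + ?l + n * n' + 9" _ 1]) (use Y in auto)
    finally show ?thesis .
  qed
  ultimately show "runsto (compile A (App f es) \<rho> t) (R, M) (Y ^ (n + length es + n * n' + 10))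
         (computes (eval (App f es) env (M A)) t R M)"
    by (auto elim: runsto_mono)
qed

text \<open>An unspecified exponent suffices, since the expressions of the reduction depend on
  \<open>k\<close> and \<open>c\<close> but not on the formula.\<close>

lemma comp_spec_exists: "\<exists>c. comp_spec e c"
proof (induction e)
  case (Lit c)
  show ?case
  proof (rule exI, rule comp_specI)
    fix Y :: nat and env :: "int list" and w :: "int \<Rightarrow> int"
    assume "Y \<ge> 4"
    then have b: "1 * bits c \<le> Y ^ (bits c)"
      using mult_le_power[of Y 1 0 "bits c" "bits c" "bits c"] less_imp_le[OF less_exp[of "bits c"]]
        power_mono[of 2 "4::nat" "bits c"] by simp
    then show "bits (eval (Lit c) env w) \<le> Y ^ bits c" by simp
  next
    fix Y :: nat and env :: "int list" and A :: nat and \<rho> :: "nat list" and t :: nat and R :: "nat \<Rightarrow> int" and M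
    assume "Y \<ge> 4"
    then have b: "1 * bits c \<le> Y ^ (bits c)"
      using mult_le_power[of Y 1 0 "bits c" "bits c" "bits c"] less_imp_le[OF less_exp[of "bits c"]]
        power_mono[of 2 "4::nat" "bits c"] by simp
    then show "runsto (compile A (Lit c) \<rho> t) (R, M) (Y ^ bits c)
         (computes (eval (Lit c) env (M A)) t R M)"
      by (auto intro!: runsto_Const)
  qed
next
  case (Var i)
  have Y2: "4 * Y \<le> Y ^ 2" "Y \<le> Y ^ 2" if "Y \<ge> 4" for Y :: nat
    using that by (auto simp: power2_eq_square)
  show ?case
  proof (rule exI, rule comp_specI)
    fix Y :: nat and env :: "int list" and w :: "int \<Rightarrow> int"
    assume *: "Y \<ge> 4" "\<And>x. x \<in> set env \<Longrightarrow> bits x \<le> Y"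
    show "bits (eval (Var i) env w) \<le> Y ^ 2"
      using Y2[OF *(1)] *(1) *(2)[of "env ! i"] by (cases "i < length env") (auto intro: order_trans)
  next
    fix Y :: nat and env :: "int list" and A :: nat and \<rho> :: "nat list" and t :: nat and R :: "nat \<Rightarrow> int" and M
    assume Y: "Y \<ge> 4" and env: "\<And>x. x \<in> set env \<Longrightarrow> bits x \<le> Y"
      and \<rho>: "\<And>x. x \<in> set \<rho> \<Longrightarrow> x < t" and m: "map R \<rho> = env"
    show "runsto (compile A (Var i) \<rho> t) (R, M) (Y ^ 2)
         (computes (eval (Var i) env (M A)) t R M)"
    proof (cases "i < length \<rho>")
      case True
      then have "\<rho> ! i < t" "bits (R (\<rho> ! i)) \<le> Y" using \<rho>[of "\<rho> ! i"] env[of "R (\<rho> ! i)"] m by auto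
      then show ?thesis using True Y2[OF Y] Y m by (auto intro!: runsto_move)
    next
      case False
      then show ?thesis using Y2[OF Y] Y m by (auto intro!: runsto_Const)
    qed
  qed
next
  case (Bin f a b)
  then obtain n1 n2 where "comp_spec a n1" "comp_spec b n2" by blast
  then obtain n where a: "comp_spec a n" and b: "comp_spec b n"
    using comp_spec_mono[of a n1 "n1 + n2"] comp_spec_mono[of b n2 "n1 + n2"] by auto
  have Yn: "6 * Y ^ n \<le> Y ^ (n + 2)" if "Y \<ge> 4" for Y :: nat
    by (rule mult_le_power[of _ _ n _ 2]) (use that in auto)
  show ?case
  proof (rule exI, rule comp_specI)
    fix Y :: nat and env :: "int list" and w :: "int \<Rightarrow> int"
    assume *: "Y \<ge> 4" "\<And>x. x \<in> set env \<Longrightarrow> bits x \<le> Y" "\<And>a. bits (w a) \<le> Y" "fine Y (Bin f a b) env w"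
    have f: "fine Y a env w" "fine Y b env w" using *(4) by auto
    show "bits (eval (Bin f a b) env w) \<le> Y ^ (n + 2)"
      using comp_spec_bits[OF a *(1-3) f(1)] comp_spec_bits[OF b *(1-3) f(2)] Yn[OF *(1)]
        bits_arith[of f "eval a env w" "eval b env w"] unfolding eval.simps by linarith
  next
    fix Y :: nat and env :: "int list" and A :: nat and \<rho> :: "nat list" and t :: nat and R :: "nat \<Rightarrow> int" and M
    assume *: "Y \<ge> 4" "\<And>x. x \<in> set env \<Longrightarrow> bits x \<le> Y" "\<And>a. bits (M A a) \<le> Y" and fine: "fine Y (Bin f a b) env (M A)"
      and \<rho>: "\<And>x. x \<in> set \<rho> \<Longrightarrow> x < t" and m: "map R \<rho> = env"
    have f: "fine Y a env (M A)" "fine Y b env (M A)" using fine by auto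
    note bb = comp_spec_bits[OF a * f(1)] comp_spec_bits[OF b * f(2)] bits_arith[of f "eval a env (M A)" "eval b env (M A)"]
    let ?Q = "computes (eval (Bin f a b) env (M A)) t R M"
    have "runsto (compile A (Bin f a b) \<rho> t) (R, M) (Y ^ n + (Y ^ n + 4 * Y ^ n)) ?Q"
      unfolding compile.simps
    proof (rule runsto_Seq)
      show "runsto (compile A a \<rho> t) (R, M) (Y ^ n) (computes (eval a env (M A)) t R M)"
        by (rule comp_spec_runsto[OF a * f(1) \<rho> m]) auto
      fix R1 M1 assume "computes (eval a env (M A)) t R M (R1, M1)"
      then have 1: "M1 = M" "R1 t = eval a env (M A)" "\<And>x. x < t \<Longrightarrow> R1 x = R x" by auto
      have e: "map R1 \<rho> = env" using \<rho> 1 m by auto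
      have \<rho>1: "x < t + 1" if "x \<in> set \<rho>" for x using \<rho>[OF that] by simp
      show "runsto (Seq (compile A b \<rho> (t + 1)) (Arith f t t (t + 1))) (R1, M1) (Y ^ n + 4 * Y ^ n) ?Q"
        unfolding 1(1)
      proof (rule runsto_Seq)
        show "runsto (compile A b \<rho> (t + 1)) (R1, M) (Y ^ n)
           (\<lambda>(R2, M2). M2 = M \<and> R2 (t + 1) = eval b env (M A) \<and> R2 t = eval a env (M A) \<and> (\<forall>x<t. R2 x = R x))"
          by (rule comp_spec_runsto[OF b * f(2) \<rho>1 e]) (use 1 in auto)
        fix R2 M2 assume "case (R2, M2) of (R2, M2) \<Rightarrow> M2 = M \<and> R2 (t + 1) = eval b env (M A) \<and> R2 t = eval a env (M A) \<and> (\<forall>x<t. R2 x = R x)"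
        then show "runsto (Arith f t t (t + 1)) (R2, M2) (4 * Y ^ n) ?Q"
          by (intro runsto_Arith) (use bb in auto)
      qed simp
    qed simp
    then show "runsto (compile A (Bin f a b) \<rho> t) (R, M) (Y ^ (n + 2)) ?Q"
      by (rule runsto_mono) (use Yn[OF *(1)] in auto)
  qed
next
  case (Inp e)
  then obtain n where e: "comp_spec e n" by blast
  have Yn: "Y \<le> Y ^ (n + 2)" "2 * Y ^ n + Y \<le> Y ^ (n + 2)" if "Y \<ge> 4" for Y :: nat
  proof -
    have "3 * Y ^ n \<le> Y ^ (n + 1)" by (rule mult_le_power[of _ _ n _ 1]) (use that in auto)
    moreover have "1 * Y \<le> Y ^ (n + 1)" by (rule mult_le_power[of _ _ 1 _ 0]) (use that in auto)
    moreover have "4 * Y ^ (n + 1) \<le> Y ^ (n + 2)" by (rule mult_le_power[of _ _ "n + 1" _ 1]) (use that in auto)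
    ultimately show "Y \<le> Y ^ (n + 2)" "2 * Y ^ n + Y \<le> Y ^ (n + 2)" by linarith+
  qed
  show ?case
  proof (rule exI, rule comp_specI)
    fix Y :: nat and env :: "int list" and w :: "int \<Rightarrow> int"
    assume *: "Y \<ge> 4" "\<And>a. bits (w a) \<le> Y"
    show "bits (eval (Inp e) env w) \<le> Y ^ (n + 2)"
      using *(2)[of "eval e env w"] Yn(1)[OF *(1)] unfolding eval.simps by linarith
  next
    fix Y :: nat and env :: "int list" and A :: nat and \<rho> :: "nat list" and t :: nat and R :: "nat \<Rightarrow> int" and M
    assume *: "Y \<ge> 4" "\<And>x. x \<in> set env \<Longrightarrow> bits x \<le> Y" "\<And>a. bits (M A a) \<le> Y" and fine: "fine Y (Inp e) env (M A)"
      and \<rho>: "\<And>x. x \<in> set \<rho> \<Longrightarrow> x < t" and m: "map R \<rho> = env"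
    have f: "fine Y e env (M A)" using fine by auto
    have b: "bits (eval e env (M A)) + bits (M A (eval e env (M A))) \<le> Y ^ n + Y"
      using comp_spec_bits[OF e * f] *(3) by (intro add_mono) auto
    show "runsto (compile A (Inp e) \<rho> t) (R, M) (Y ^ (n + 2))
         (computes (eval (Inp e) env (M A)) t R M)"
      unfolding compile.simps
    proof (rule runsto_Seq)
      show "runsto (compile A e \<rho> t) (R, M) (Y ^ n) (computes (eval e env (M A)) t R M)"
        by (rule comp_spec_runsto[OF e * f \<rho> m]) auto
      fix R2 M2 assume "computes (eval e env (M A)) t R M (R2, M2)"
      then show "runsto (Load t A t) (R2, M2) (Y ^ n + Y)
         (computes (eval (Inp e) env (M A)) t R M)"
        by (intro runsto_Load) (use b in auto)
    qed (use Yn(2)[OF *(1)] in simp)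
  qed
next
  case (Ite c a b)
  then obtain n1 n2 n3 where "comp_spec c n1" "comp_spec a n2" "comp_spec b n3" by blast
  then obtain n where c: "comp_spec c n" and a: "comp_spec a n" and b: "comp_spec b n"
    using comp_spec_mono[of c n1 "n1 + n2 + n3"] comp_spec_mono[of a n2 "n1 + n2 + n3"]
      comp_spec_mono[of b n3 "n1 + n2 + n3"] by auto
  have Yn: "4 * Y ^ n \<le> Y ^ (n + 2)" if "Y \<ge> 4" for Y :: nat
    by (rule mult_le_power[of _ _ n _ 2]) (use that in auto)
  show ?case
  proof (rule exI, rule comp_specI)
    fix Y :: nat and env :: "int list" and w :: "int \<Rightarrow> int"
    assume *: "Y \<ge> 4" "\<And>x. x \<in> set env \<Longrightarrow> bits x \<le> Y" "\<And>a. bits (w a) \<le> Y" "fine Y (Ite c a b) env w"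
    show "bits (eval (Ite c a b) env w) \<le> Y ^ (n + 2)"
    proof (cases "0 < eval c env w")
      case True
      then have "fine Y a env w" using *(4) by simp
      from comp_spec_bits[OF a *(1-3) this] have "bits (eval a env w) \<le> Y ^ (n + 2)" using Yn[OF *(1)] by linarith
      then show ?thesis using True by simp
    next
      case False
      then have "fine Y b env w" using *(4) by simp
      from comp_spec_bits[OF b *(1-3) this] have "bits (eval b env w) \<le> Y ^ (n + 2)" using Yn[OF *(1)] by linarith
      then show ?thesis using False by simp
    qed
  next
    fix Y :: nat and env :: "int list" and A :: nat and \<rho> :: "nat list" and t :: nat and R :: "nat \<Rightarrow> int" and M
    assume *: "Y \<ge> 4" "\<And>x. x \<in> set env \<Longrightarrow> bits x \<le> Y" "\<And>a. bits (M A a) \<le> Y" and fine: "fine Y (Ite c a b) env (M A)"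
      and \<rho>: "\<And>x. x \<in> set \<rho> \<Longrightarrow> x < t" and m: "map R \<rho> = env"
    have f: "fine Y c env (M A)" using fine by auto
    note bb = comp_spec_bits[OF c * f]
    let ?Q = "computes (eval (Ite c a b) env (M A)) t R M"
    have "runsto (compile A (Ite c a b) \<rho> t) (R, M) (Y ^ n + (Y ^ n + Y ^ n)) ?Q"
      unfolding compile.simps
    proof (rule runsto_Seq)
      show "runsto (compile A c \<rho> t) (R, M) (Y ^ n) (computes (eval c env (M A)) t R M)"
        by (rule comp_spec_runsto[OF c * f \<rho> m]) auto
      fix R1 M1 assume "computes (eval c env (M A)) t R M (R1, M1)"
      then have 1: "M1 = M" "R1 t = eval c env (M A)" "\<And>x. x < t \<Longrightarrow> R1 x = R x" by auto
      have e: "map R1 \<rho> = env" using \<rho> 1 m by auto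
      show "runsto (Cond t (compile A a \<rho> t) (compile A b \<rho> t)) (R1, M1) (Y ^ n + Y ^ n) ?Q"
        unfolding 1(1)
      proof (rule runsto_Cond[where ?T1.0 = "Y ^ n"])
        assume p: "0 < R1 t"
        show "runsto (compile A a \<rho> t) (R1, M) (Y ^ n) ?Q"
          by (rule comp_spec_runsto[OF a * _ \<rho> e]) (use fine p 1 in auto)
      next
        assume p: "R1 t \<le> 0"
        show "runsto (compile A b \<rho> t) (R1, M) (Y ^ n) ?Q"
          by (rule comp_spec_runsto[OF b * _ \<rho> e]) (use fine p 1 in auto)
      qed (use 1 bb in auto)
    qed simp
    then show "runsto (compile A (Ite c a b) \<rho> t) (R, M) (Y ^ (n + 2)) ?Q"
      by (rule runsto_mono, use Yn[OF *(1)] in linarith)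
  qed
next
  case (Red m c b)
  then show ?case using comp_spec_Red by blast
next
  case (Iter a c b)
  then obtain n1 n2 n3 where "comp_spec c n1" "comp_spec a n2" "comp_spec b n3" by blast
  then obtain n where "comp_spec c n" and "comp_spec a n" and "comp_spec b n"
    using comp_spec_mono[of c n1 "n1 + n2 + n3"] comp_spec_mono[of a n2 "n1 + n2 + n3"]
      comp_spec_mono[of b n3 "n1 + n2 + n3"] by auto
  then show ?case using comp_spec_Iter by blast
next
  case (App f es)
  then obtain n1 where f: "comp_spec f n1" by blast
  have "\<exists>n. \<forall>e\<in>set es. comp_spec e n" using App(2)
  proof (induction es)
    case (Cons e es)
    then have "\<exists>n. comp_spec e n" "\<exists>n. \<forall>e\<in>set es. comp_spec e n" by simp_all
    then obtain n1 n2 where "comp_spec e n1" "\<forall>e\<in>set es. comp_spec e n2" by auto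
    then show ?case
      by (intro exI[of _ "n1 + n2"]) (auto intro: comp_spec_mono)
  qed auto
  then obtain n where "\<forall>e\<in>set es. comp_spec e n" ..
  then show ?case using comp_spec_App[of es "Suc n" f n1, OF _ f] comp_spec_mono[of _ n "Suc n"] by auto
qed

section \<open>The reduction as a program\<close>

definition fill :: "nat \<Rightarrow> nat \<Rightarrow> ex \<Rightarrow> ex \<Rightarrow> nat \<Rightarrow> prog" where
  "fill A src n f t = Seq (compile src n [] t)
     (forloop t (t + 1) (Seq (compile src f [t + 1] (t + 2)) (Store A (t + 1) (t + 2))))"

lemma runsto_fill:
  assumes n: "comp_spec n c" and f: "comp_spec f c" and Y: "Y \<ge> 4" and A: "A \<noteq> src"
    and w: "\<And>a. bits (w a) \<le> Y" "M src = w"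
    and fine: "fine Y n [] w" "\<And>j. j < N \<Longrightarrow> fine Y f [int j] w"
    and N: "eval n [] w = int N" "bits (int N) \<le> Y"
  shows "runsto (fill A src n f t) (R, M) ((N + 1) * Y ^ (c + 3))
    (\<lambda>(R', M'). M' = M(A := \<lambda>a. if 0 \<le> a \<and> a < int N then eval f [a] w else M A a) \<and> (\<forall>x<t. R' x = R x))"
proof -
  define F where "F j = M(A := \<lambda>a. if 0 \<le> a \<and> a < int j then eval f [a] w else M A a)" for j
  have F0: "F 0 = M" by (auto simp: F_def fun_eq_iff)
  have FS: "(F j)(A := (F j A)(int j := eval f [int j] w)) = F (Suc j)" for j
    by (auto simp: F_def fun_eq_iff)
  have Fs: "F j src = w" for j using A w by (simp add: F_def)
  have bj: "bits (int j) \<le> Y" if "j < N" for j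
    using bits_mono[of "int j" "int N"] that N(2) by simp
  let ?I = "\<lambda>j (R', M'). M' = F j \<and> (\<forall>x<t. R' x = R x)"
  have "runsto (fill A src n f t) (R, M) (Y ^ c + (1 + Y + N * (Y ^ c + (Y + Y ^ c) + 10 * Y))) (?I N)"
    unfolding fill_def
  proof (rule runsto_Seq)
    show "runsto (compile src n [] t) (R, M) (Y ^ c) (\<lambda>(R1, M1). M1 = M \<and> R1 t = int N \<and> (\<forall>x<t. R1 x = R x))"
      by (rule comp_spec_runsto[OF n Y _ w(1) fine(1)]) (use N w in auto)
    fix R1 :: "nat \<Rightarrow> int" and M1 :: "nat \<Rightarrow> int \<Rightarrow> int" assume "case (R1, M1) of (R1, M1) \<Rightarrow> M1 = M \<and> R1 t = int N \<and> (\<forall>x<t. R1 x = R x)"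
    then have 1: "M1 = M" "R1 t = int N" "\<And>x. x < t \<Longrightarrow> R1 x = R x" by auto
    show "runsto (forloop t (t + 1) (Seq (compile src f [t + 1] (t + 2)) (Store A (t + 1) (t + 2)))) (R1, M1)
      (1 + Y + N * (Y ^ c + (Y + Y ^ c) + 10 * Y)) (?I N)"
    proof (rule runsto_forloop[where z = "int N" and I = ?I and b = Y])
      fix j R' M'
      assume j: "j < N" and I: "?I j (R', M')" and i: "R' (t + 1) = int j" and "R' t = int N - int j"
      show "runsto (Seq (compile src f [t + 1] (t + 2)) (Store A (t + 1) (t + 2))) (R', M') (Y ^ c + (Y + Y ^ c))
         (\<lambda>(R'', M'). R'' (t + 1) = R' (t + 1) \<and> R'' t = R' t \<and>
          ?I (Suc j) (R''(t + 1 + 1 := 1, t + 1 := int (Suc j), t := int N - int (Suc j)), M'))"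
      proof (rule runsto_Seq)
        show "runsto (compile src f [t + 1] (t + 2)) (R', M') (Y ^ c)
          (\<lambda>(R2, M2). M2 = F j \<and> R2 (t + 2) = eval f [int j] w \<and> (\<forall>x<t+2. R2 x = R' x))"
          by (rule comp_spec_runsto[OF f Y _ w(1) fine(2)[OF j]]) (use I i bj[OF j] Fs in auto)
        fix R2 :: "nat \<Rightarrow> int" and M2 :: "nat \<Rightarrow> int \<Rightarrow> int"
        assume "case (R2, M2) of (R2, M2) \<Rightarrow> M2 = F j \<and> R2 (t + 2) = eval f [int j] w \<and> (\<forall>x<t+2. R2 x = R' x)"
        then have 2: "M2 = F j" "R2 (t + 2) = eval f [int j] w" "\<And>x. x<t+2 \<Longrightarrow> R2 x = R' x" by auto
        have b: "bits (eval f [int j] w) \<le> Y ^ c"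
          by (rule comp_spec_bits[OF f Y _ w(1) fine(2)[OF j]]) (use bj[OF j] in auto)
        have i2: "R2 (Suc t) = int j" using 2(3)[of "t+1"] i by simp
        show "runsto (Store A (t + 1) (t + 2)) (R2, M2) (Y + Y ^ c)
         (\<lambda>(R'', M'). R'' (t + 1) = R' (t + 1) \<and> R'' t = R' t \<and>
          ?I (Suc j) (R''(t + 1 + 1 := 1, t + 1 := int (Suc j), t := int N - int (Suc j)), M'))"
          by (rule runsto_Store) (use 2 i2 i I b bj[OF j] FS[of j] in auto)
      qed simp
    qed (use 1 F0 N Y in auto)
  qed simp
  then show ?thesis
  proof (rule runsto_mono)
    have X: "Y ^ c \<le> Y ^ (c + 1)" "Y \<le> Y ^ (c + 1)" "1 \<le> Y ^ (c + 1)" using Y by auto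
    have "Y ^ c + (1 + Y + N * (Y ^ c + (Y + Y ^ c) + 10 * Y)) \<le>
      Y ^ (c + 1) + (Y ^ (c + 1) + Y ^ (c + 1) + N * (Y ^ (c + 1) + (Y ^ (c + 1) + Y ^ (c + 1)) + 10 * Y ^ (c + 1)))"
      by (intro add_mono mult_mono X) auto
    also have "\<dots> \<le> (N + 1) * (16 * Y ^ (c + 1))" by simp
    also have "\<dots> \<le> (N + 1) * Y ^ (c + 3)"
      by (intro mult_left_mono mult_le_power[of _ _ "c + 1" _ 2]) (use Y in auto)
    finally show "Y ^ c + (1 + Y + N * (Y ^ c + (Y + Y ^ c) + 10 * Y)) \<le> (N + 1) * Y ^ (c + 3)" .
  qed (auto simp: F_def)
qed

text \<open>Under logarithmic cost every write is charged the length of the value. So the answer of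
  \<open>P\<close> is no longer than its running time, and comparing it with the threshold is
  cheap.\<close>

lemma bits_register_le: "exec p s t s' \<Longrightarrow> bits (fst s' r) \<le> bits (fst s r) + t"
  by (induction rule: exec.induct) auto

section \<open>Registers and arrays that a program can touch\<close>

fun below :: "nat \<Rightarrow> prog \<Rightarrow> bool" where
  "below K Skip = True"
| "below K (Const r c) = (r < K)"
| "below K (Arith f r a b) = (r < K \<and> a < K \<and> b < K)"
| "below K (Load r A a) = (r < K \<and> A < K \<and> a < K)"
| "below K (Store A a r) = (r < K \<and> A < K \<and> a < K)"
| "below K (Seq p q) = (below K p \<and> below K q)"
| "below K (Cond r p q) = (r < K \<and> below K p \<and> below K q)"
| "below K (Loop r p) = (r < K \<and> below K p)"

lemma below_mono: "below K p \<Longrightarrow> K \<le> K' \<Longrightarrow> below K' p"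
  by (induction p) auto

lemma exists_below: "\<exists>K. below K p"
proof (induction p)
  case (Seq p q)
  then obtain a b where "below a p" "below b q" by auto
  then show ?case by (intro exI[of _ "a + b"]) (auto intro: below_mono)
next
  case (Cond r p q)
  then obtain a b where "below a p" "below b q" by auto
  then show ?case by (intro exI[of _ "a + b + Suc r"]) (auto intro: below_mono)
next
  case (Loop r p)
  then obtain a where "below a p" by auto
  then show ?case by (intro exI[of _ "a + Suc r"]) (auto intro: below_mono)
next
  case (Arith f r a b)
  show ?case by (intro exI[of _ "Suc (r + a + b)"]) auto
next
  case (Load r a b)
  show ?case by (intro exI[of _ "Suc (r + a + b)"]) auto
next
  case (Store r a b)
  show ?case by (intro exI[of _ "Suc (r + a + b)"]) auto
qed auto

definition agree :: "nat set \<Rightarrow> state \<Rightarrow> state \<Rightarrow> bool" where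
  "agree X s u \<longleftrightarrow> (\<forall>x\<in>X. fst s x = fst u x \<and> snd s x = snd u x)"

text \<open>Whatever lies at \<open>K\<close> and above is neither seen nor changed by the program.
  So the copy of the formula survives the run of \<open>P\<close>, and \<open>post\<close> can
  compute the threshold from it.\<close>

lemma exec_frame:
  "exec p s t s' \<Longrightarrow> below K p \<Longrightarrow> agree {..<K} s u \<Longrightarrow>
    \<exists>u'. exec p u t u' \<and> agree {..<K} s' u' \<and> agree {K..} u u'"
proof (induction arbitrary: u rule: exec.induct)
  case (skip s)
  have "agree {K..} u u" by (simp add: agree_def)
  then show ?case using skip exec.skip by blast
next
  case (const r c R M)
  obtain S L where u: "u = (S, L)" by (cases u)
  have "exec (Const r c) u (bits c) (S(r := c), L)" unfolding u by (rule exec.const)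
  moreover have "agree {..<K} (R(r := c), M) (S(r := c), L)" "agree {K..} u (S(r := c), L)"
    using const u by (auto simp: agree_def)
  ultimately show ?case by blast
next
  case (arith v f R s t r M)
  obtain S L where u: "u = (S, L)" by (cases u)
  have e: "S s = R s" "S t = R t" using arith u by (auto simp: agree_def)
  have "exec (Arith f r s t) u (bits (R s) + bits (R t) + bits v) (S(r := v), L)"
    unfolding u using exec.arith[of v f S s t r L] e arith by simp
  moreover have "agree {..<K} (R(r := v), M) (S(r := v), L)" "agree {K..} u (S(r := v), L)"
    using arith u by (auto simp: agree_def)
  ultimately show ?case by blast
next
  case (load v M A R s r)
  obtain S L where u: "u = (S, L)" by (cases u)
  have e: "S s = R s" "L A = M A" using load u by (auto simp: agree_def)
  have "exec (Load r A s) u (bits (R s) + bits v) (S(r := v), L)"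
    unfolding u using exec.load[of v L A S s r] e load by simp
  moreover have "agree {..<K} (R(r := v), M) (S(r := v), L)" "agree {K..} u (S(r := v), L)"
    using load u by (auto simp: agree_def)
  ultimately show ?case by blast
next
  case (store A s r R M)
  obtain S L where u: "u = (S, L)" by (cases u)
  have e: "S s = R s" "S r = R r" "L A = M A" using store u by (auto simp: agree_def)
  have "exec (Store A s r) u (bits (R s) + bits (R r)) (S, L(A := (L A)(R s := R r)))"
    unfolding u using exec.store[of A s r S L] e by simp
  moreover have "agree {..<K} (R, M(A := (M A)(R s := R r))) (S, L(A := (L A)(R s := R r)))"
    "agree {K..} u (S, L(A := (L A)(R s := R r)))"
    using store u e by (auto simp: agree_def)
  ultimately show ?case by blast
next
  case (seq p s t s' q t' s'')
  have b: "below K p" "below K q" using seq.prems by auto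
  obtain u1 where 1: "exec p u t u1" "agree {..<K} s' u1" "agree {K..} u u1"
    using seq.IH(1)[OF b(1) seq.prems(2)] by blast
  obtain u2 where 2: "exec q u1 t' u2" "agree {..<K} s'' u2" "agree {K..} u1 u2"
    using seq.IH(2)[OF b(2) 1(2)] by blast
  have "agree {K..} u u2" using 1(3) 2(3) by (auto simp: agree_def)
  then show ?case using exec.seq[OF 1(1) 2(1)] 2 by blast
next
  case (cond_pos R r p M t s' q)
  obtain S L where u: "u = (S, L)" by (cases u)
  have b: "below K p" using cond_pos.prems by auto
  obtain u1 where 1: "exec p u t u1" "agree {..<K} s' u1" "agree {K..} u u1"
    using cond_pos.IH[OF b cond_pos.prems(2)] by blast
  have e: "S r = R r" using cond_pos.prems u by (auto simp: agree_def)
  have "exec (Cond r p q) u (bits (R r) + t) u1"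
    using exec.cond_pos[of S r p L t u1 q] 1(1) u e cond_pos.hyps by simp
  then show ?case using 1 by blast
next
  case (cond_nonpos R r q M t s' p)
  obtain S L where u: "u = (S, L)" by (cases u)
  have b: "below K q" using cond_nonpos.prems by auto
  obtain u1 where 1: "exec q u t u1" "agree {..<K} s' u1" "agree {K..} u u1"
    using cond_nonpos.IH[OF b cond_nonpos.prems(2)] by blast
  have e: "S r = R r" using cond_nonpos.prems u by (auto simp: agree_def)
  have "exec (Cond r p q) u (bits (R r) + t) u1"
    using exec.cond_nonpos[of S r q L t u1 p] 1(1) u e cond_nonpos.hyps by simp
  then show ?case using 1 by blast
next
  case (loop_pos R r p M t s' t' s'')
  obtain S L where u: "u = (S, L)" by (cases u)
  have b: "below K p" using loop_pos.prems by auto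
  obtain u1 where 1: "exec p u t u1" "agree {..<K} s' u1" "agree {K..} u u1"
    using loop_pos.IH(1)[OF b loop_pos.prems(2)] by blast
  obtain u2 where 2: "exec (Loop r p) u1 t' u2" "agree {..<K} s'' u2" "agree {K..} u1 u2"
    using loop_pos.IH(2)[OF loop_pos.prems(1) 1(2)] by blast
  have e: "S r = R r" using loop_pos.prems u by (auto simp: agree_def)
  have "exec (Loop r p) u (bits (R r) + t + t') u2"
    using exec.loop_pos[of S r p L t u1 t' u2] 1(1) 2(1) u e loop_pos.hyps by simp
  moreover have "agree {K..} u u2" using 1(3) 2(3) by (auto simp: agree_def)
  ultimately show ?case using 2 by blast
next
  case (loop_nonpos R r p M)
  obtain S L where u: "u = (S, L)" by (cases u)
  have e: "S r = R r" using loop_nonpos u by (auto simp: agree_def)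
  have "exec (Loop r p) u (bits (R r)) u"
    using exec.loop_nonpos[of S r p L] u e loop_nonpos(1) by simp
  moreover have "agree {K..} u u" by (simp add: agree_def)
  ultimately show ?case using loop_nonpos by blast
qed

text \<open>Comparing \<open>R 0 * R 1\<close> with \<open>\<theta> * (R 1)\<^sup>2\<close> instead of \<open>R 0 / R 1\<close> with \<open>\<theta>\<close> is correct also if \<open>R 1 \<le> 0\<close>.\<close>

definition post :: "ex \<Rightarrow> nat \<Rightarrow> prog" where
  "post \<theta> K = Seq (compile K \<theta> [] K) (Seq (Arith Mul (K + 1) 0 1) (Seq (Arith Mul (K + 2) 1 1)
     (Seq (Arith Mul (K + 2) K (K + 2)) (Seq (Arith Sub (K + 1) (K + 1) (K + 2))
       (Cond (K + 1) (Const 0 1) (Const 0 0))))))"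

lemma runsto_post:
  assumes \<theta>: "comp_spec \<theta> c" and Y: "Y \<ge> 4" and w: "\<And>a. bits (w a) \<le> Y" "M K = w" and fine: "fine Y \<theta> [] w"
    and K: "K \<ge> 2" and b: "bits (R 0) \<le> b" "bits (R 1) \<le> b"
  shows "runsto (post \<theta> K) (R, M) (Y ^ c + (40 * b + 10 * Y ^ c))
    (\<lambda>(R', M'). R' 0 \<noteq> 0 \<longleftrightarrow> R 0 * R 1 > eval \<theta> [] w * (R 1)\<^sup>2)"
  unfolding post_def
proof (rule runsto_Seq)
  let ?e = "eval \<theta> [] w"
  define B where "B = bits (?e)"
  have B: "B \<le> Y ^ c" unfolding B_def by (rule comp_spec_bits[OF \<theta> Y _ w(1) fine]) auto
  show "runsto (compile K \<theta> [] K) (R, M) (Y ^ c) (\<lambda>(R1, M1). R1 K = ?e \<and> (\<forall>x<K. R1 x = R x))"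
    by (rule comp_spec_runsto[where env = "[]" and w = w, OF \<theta> Y]) (use w fine in auto)
  fix R1 :: "nat \<Rightarrow> int" and M1 :: "nat \<Rightarrow> int \<Rightarrow> int" assume "case (R1, M1) of (R1, M1) \<Rightarrow> R1 K = ?e \<and> (\<forall>x<K. R1 x = R x)"
  then have 1: "R1 K = ?e" "R1 0 = R 0" "R1 1 = R 1" using K by auto
  let ?x = "R 0 * R 1" and ?y = "R 1 * R 1"
  have bx: "bits ?x \<le> 2 * b" "bits ?y \<le> 2 * b" using bits_mult[of "R 0" "R 1"] bits_mult[of "R 1" "R 1"] b by auto
  have bz: "bits (?e * ?y) \<le> B + 2 * b" using bits_mult[of ?e ?y] bx B_def by auto
  have bd: "bits (?x - ?e * ?y) \<le> 2 * b + (B + 2 * b)" using bits_add[of ?x "- (?e * ?y)"] bx bz by auto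
  let ?Q = "\<lambda>(R', M'). R' 0 \<noteq> 0 \<longleftrightarrow> R 0 * R 1 > ?e * (R 1)\<^sup>2"
  have b2: "2 \<le> 2 * b" using bits_pos[of "R 0"] b by linarith
  have "runsto (Cond (K + 1) (Const 0 1) (Const 0 0)) (R', M1) (4 * b + B + 2 * b) ?Q"
    if "R' (K + 1) = ?x - ?e * ?y" for R'
    by (rule runsto_Cond[where ?T1.0 = "2 * b"])
      (use that bd b2 in \<open>auto intro!: runsto_Const simp: power2_eq_square\<close>)
  note cond = this
  have "runsto (Seq (Arith Sub (K + 1) (K + 1) (K + 2)) (Cond (K + 1) (Const 0 1) (Const 0 0))) (R', M1) (16 * b + 4 * B) ?Q"
    if "R' (K + 1) = ?x" "R' (K + 2) = ?e * ?y" for R'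
    by (rule runsto_Seq[OF runsto_Arith[where T = "8 * b + 2 * B" and Q = "\<lambda>s. s = (R'(K + 1 := ?x - ?e * ?y), M1)"],
        where ?T2.0 = "4 * b + B + 2 * b"]) (use that bx bz bd cond in auto)
  note sub = this
  have "runsto (Seq (Arith Mul (K + 2) K (K + 2)) (Seq (Arith Sub (K + 1) (K + 1) (K + 2)) (Cond (K + 1) (Const 0 1) (Const 0 0)))) (R', M1) (20 * b + 6 * B) ?Q"
    if "R' (K + 1) = ?x" "R' (K + 2) = ?y" "R' K = ?e" for R'
    by (rule runsto_Seq[OF runsto_Arith[where T = "4 * b + 2 * B" and Q = "\<lambda>s. s = (R'(K + 2 := ?e * ?y), M1)"],
        where ?T2.0 = "16 * b + 4 * B"]) (use that bx bz sub B_def in auto)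
  note mul = this
  have "runsto (Seq (Arith Mul (K + 2) 1 1) (Seq (Arith Mul (K + 2) K (K + 2)) (Seq (Arith Sub (K + 1) (K + 1) (K + 2)) (Cond (K + 1) (Const 0 1) (Const 0 0))))) (R', M1) (24 * b + 6 * B) ?Q"
    if "R' (K + 1) = ?x" "R' 1 = R 1" "R' K = ?e" for R'
    by (rule runsto_Seq[OF runsto_Arith[where T = "4 * b" and Q = "\<lambda>s. s = (R'(K + 2 := ?y), M1)"],
        where ?T2.0 = "20 * b + 6 * B"]) (use that bx b mul in auto)
  note mul2 = this
  have "runsto (Seq (Arith Mul (K + 1) 0 1) (Seq (Arith Mul (K + 2) 1 1) (Seq (Arith Mul (K + 2) K (K + 2)) (Seq (Arith Sub (K + 1) (K + 1) (K + 2)) (Cond (K + 1) (Const 0 1) (Const 0 0)))))) (R1, M1) (28 * b + 6 * B) ?Q"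
    by (rule runsto_Seq[OF runsto_Arith[where T = "4 * b" and Q = "\<lambda>s. s = (R1(K + 1 := ?x), M1)"],
        where ?T2.0 = "24 * b + 6 * B"]) (use 1 bx b K mul2 in auto)
  then show "runsto (Seq (Arith Mul (K + 1) 0 1) (Seq (Arith Mul (K + 2) 1 1) (Seq (Arith Mul (K + 2) K (K + 2)) (Seq (Arith Sub (K + 1) (K + 1) (K + 2)) (Cond (K + 1) (Const 0 1) (Const 0 0)))))) (R1, M1) (40 * b + 10 * Y ^ c) ?Q"
    by (rule runsto_mono) (use B in auto)
qed simp

text \<open>
  The input moves to array \<open>K\<close>, so that \<open>P\<close>, which only uses registers and arrays below \<open>K\<close>, starts in a proper
  initial state.
\<close>

definition reduction :: "prog \<Rightarrow> nat \<Rightarrow> ex \<Rightarrow> ex \<Rightarrow> ex \<Rightarrow> ex \<Rightarrow> prog" where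
  "reduction P K m n f \<theta> = Seq (fill K 0 m (Inp (Var 0)) K) (Seq (fill 0 K m (Lit 0) K)
     (Seq (fill 0 K n f K) (Seq P (post \<theta> K))))"

text \<open>Cells beyond the input hold 0, so copying and clearing up to an upper bound
  \<open>L\<close> of its length is harmless. Array 0 is cleared before the instance is written,
  because remains of a formula longer than the instance would spoil the initial state.\<close>

lemma runs_reduction:
  fixes inp :: "int list"
  defines "w \<equiv> snd (initial inp) 0"
  assumes K: "below K P" "K \<ge> 2"
    and c: "\<And>e. e \<in> {m, n, f, \<theta>, Inp (Var 0), Lit 0} \<Longrightarrow> comp_spec e c"
    and Y: "Y \<ge> 4" "\<And>a. bits (w a) \<le> Y"
    and fine: "fine Y m [] w" "fine Y n [] w" "fine Y \<theta> [] w" "\<And>j. j < N \<Longrightarrow> fine Y f [int j] w"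
    and L: "eval m [] w = int L" "length inp \<le> L" "bits (int L) \<le> Y"
    and N: "eval n [] w = int N" "bits (int N) \<le> Y"
    and P: "runs P (map (\<lambda>j. eval f [int j] w) [0..<N]) tP RP"
  shows "\<exists>t R. runs (reduction P K m n f \<theta>) inp t R \<and>
    t \<le> (2 * (L + 1) + (N + 1)) * Y ^ (c + 3) + 100 * (tP + Y ^ c) \<and>
    (R 0 \<noteq> 0 \<longleftrightarrow> RP 0 * RP 1 > eval \<theta> [] w * (RP 1)\<^sup>2)"
proof -
  define T where "T = (L + 1) * Y ^ (c + 3)"
  define TN where "TN = (N + 1) * Y ^ (c + 3)"
  let ?out = "map (\<lambda>j. eval f [int j] w) [0..<N]"
  obtain R0 M0 where init: "initial inp = (R0, M0)" by (cases "initial inp")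
  have M0: "M0 0 = w" "\<And>A. A \<noteq> 0 \<Longrightarrow> M0 A = (\<lambda>_. 0)" and R0: "\<And>x. R0 x = 0"
    using init unfolding w_def initial_def by auto
  have w0: "w a = 0" if "\<not> (0 \<le> a \<and> a < int L)" for a
    using that L(2) by (auto simp: w_def initial_def)
  obtain MP where "exec P (initial ?out) tP (RP, MP)" using P by (auto simp: runs_def)
  note P = this
  have bP: "bits (RP r) \<le> tP + 1" for r
    using bits_register_le[OF P, of r] by (simp add: initial_def)
  have "runsto (reduction P K m n f \<theta>) (R0, M0) (T + (T + (TN + (tP + (Y ^ c + (40 * (tP + 1) + 10 * Y ^ c))))))
    (\<lambda>(R, M). R 0 \<noteq> 0 \<longleftrightarrow> RP 0 * RP 1 > eval \<theta> [] w * (RP 1)\<^sup>2)"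
    unfolding reduction_def
  proof (rule runsto_Seq)
    show "runsto (fill K 0 m (Inp (Var 0)) K) (R0, M0) T
      (\<lambda>(R, M). M = M0(K := w) \<and> (\<forall>x<K. R x = 0))" unfolding T_def
      by (rule runsto_mono[OF runsto_fill[where c = c and w = w]])
        (use c Y fine K M0 R0 L w0 in \<open>auto simp: fun_eq_iff\<close>)
    fix R1 :: "nat \<Rightarrow> int" and M1 :: "nat \<Rightarrow> int \<Rightarrow> int" assume "case (R1, M1) of (R, M) \<Rightarrow> M = M0(K := w) \<and> (\<forall>x<K. R x = 0)"
    then have 1: "M1 = M0(K := w)" "\<And>x. x<K \<Longrightarrow> R1 x = 0" by auto
    show "runsto (Seq (fill 0 K m (Lit 0) K) (Seq (fill 0 K n f K) (Seq P (post \<theta> K)))) (R1, M1)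
      (T + (TN + (tP + (Y ^ c + (40 * (tP + 1) + 10 * Y ^ c)))))
      (\<lambda>(R, M). R 0 \<noteq> 0 \<longleftrightarrow> RP 0 * RP 1 > eval \<theta> [] w * (RP 1)\<^sup>2)"
    proof (rule runsto_Seq)
      show "runsto (fill 0 K m (Lit 0) K) (R1, M1) T
        (\<lambda>(R, M). M = (\<lambda>A a. 0)(K := w) \<and> (\<forall>x<K. R x = 0))" unfolding T_def
        by (rule runsto_mono[OF runsto_fill[where c = c and w = w]])
          (use c Y fine K M0 L w0 1 in \<open>auto simp: fun_eq_iff\<close>)
      fix R2 :: "nat \<Rightarrow> int" and M2 :: "nat \<Rightarrow> int \<Rightarrow> int" assume "case (R2, M2) of (R, M) \<Rightarrow> M = (\<lambda>A a. 0)(K := w) \<and> (\<forall>x<K. R x = 0)"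
      then have 2: "M2 = (\<lambda>A a. 0)(K := w)" "\<And>x. x<K \<Longrightarrow> R2 x = 0" by auto
      show "runsto (Seq (fill 0 K n f K) (Seq P (post \<theta> K))) (R2, M2)
        (TN + (tP + (Y ^ c + (40 * (tP + 1) + 10 * Y ^ c))))
        (\<lambda>(R, M). R 0 \<noteq> 0 \<longleftrightarrow> RP 0 * RP 1 > eval \<theta> [] w * (RP 1)\<^sup>2)"
      proof (rule runsto_Seq)
        show "runsto (fill 0 K n f K) (R2, M2) TN
          (\<lambda>(R, M). M K = w \<and> agree {..<K} (initial ?out) (R, M))" unfolding TN_def
          by (rule runsto_mono[OF runsto_fill[where c = c and w = w]])
            (use c Y fine K N 2 in \<open>auto simp: fun_eq_iff agree_def initial_def nat_less_iff\<close>)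
        fix R3 :: "nat \<Rightarrow> int" and M3 :: "nat \<Rightarrow> int \<Rightarrow> int" assume "case (R3, M3) of (R, M) \<Rightarrow> M K = w \<and> agree {..<K} (initial ?out) (R, M)"
        then have 3: "M3 K = w" "agree {..<K} (initial ?out) (R3, M3)" by auto
        obtain R4 M4 where 4: "exec P (R3, M3) tP (R4, M4)" "agree {..<K} (RP, MP) (R4, M4)" "agree {K..} (R3, M3) (R4, M4)"
          using exec_frame[OF P K(1) 3(2)] by auto
        have 5: "R4 0 = RP 0" "R4 1 = RP 1" "M4 K = w" using 4(2,3) 3(1) K by (auto simp: agree_def)
        have "runsto (post \<theta> K) (R4, M4) (Y ^ c + (40 * (tP + 1) + 10 * Y ^ c))
           (\<lambda>(R, M). R 0 \<noteq> 0 \<longleftrightarrow> R4 0 * R4 1 > eval \<theta> [] w * (R4 1)\<^sup>2)"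
          by (rule runsto_post[where w = w]) (use c Y fine K 5 bP[of 0] bP[of 1] in auto)
        then show "runsto (Seq P (post \<theta> K)) (R3, M3) (tP + (Y ^ c + (40 * (tP + 1) + 10 * Y ^ c)))
          (\<lambda>(R, M). R 0 \<noteq> 0 \<longleftrightarrow> RP 0 * RP 1 > eval \<theta> [] w * (RP 1)\<^sup>2)"
          unfolding 5 by (intro runsto_Seq[where ?Q1.0 = "\<lambda>s. s = (R4, M4)"]) (use 4 in \<open>auto simp: runsto_def\<close>)
      qed simp
    qed simp
  qed simp
  then obtain t R M where "exec (reduction P K m n f \<theta>) (initial inp) t (R, M)"
    "t \<le> T + (T + (TN + (tP + (Y ^ c + (40 * (tP + 1) + 10 * Y ^ c)))))"
    "R 0 \<noteq> 0 \<longleftrightarrow> RP 0 * RP 1 > eval \<theta> [] w * (RP 1)\<^sup>2"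
    unfolding init by (auto simp: runsto_def)
  moreover have "1 \<le> Y ^ c" using Y by simp
  moreover have "(2 * (L + 1) + (N + 1)) * Y ^ (c + 3) = T + T + TN" by (simp add: T_def TN_def algebra_simps)
  ultimately show ?thesis unfolding runs_def
    by (intro exI[of _ t] exI[of _ R]) auto
qed

section \<open>The instance as an expression\<close>

abbreviation add_ex (infixl "+." 65) where "a +. b \<equiv> Bin Add a b"
abbreviation sub_ex (infixl "-." 65) where "a -. b \<equiv> Bin Sub a b"
abbreviation mul_ex (infixl "*." 70) where "a *. b \<equiv> Bin Mul a b"
abbreviation quo_ex (infixl "quo" 70) where "a quo b \<equiv> Bin Quo a b"
abbreviation rem_ex (infixl "rem" 70) where "a rem b \<equiv> Bin Rem a b"

text \<open>Branches test positivity only, and 1 - (a - b)^2 is positive exactly for equal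
  integers.\<close>

definition eqE :: "ex \<Rightarrow> ex \<Rightarrow> ex" where
  "eqE a b = Ite (Lit 1 -. (a -. b) *. (a -. b)) (Lit 1) (Lit 0)"

lemma eval_eqE [simp]: "eval (eqE a b) env inp = of_bool (eval a env inp = eval b env inp)"
proof -
  have "0 < 1 - x * x \<longleftrightarrow> x = 0" for x :: int
  proof
    assume "0 < 1 - x * x"
    then have "x * x \<le> 0" by simp
    then show "x = 0" by (metis mult_le_0_iff order_antisym)
  qed simp
  from this[of "eval a env inp - eval b env inp"] show ?thesis by (simp add: eqE_def)
qed

lemma fine_eqE [simp]: "fine Y (eqE a b) env inp \<longleftrightarrow> fine Y a env inp \<and> fine Y b env inp"
  by (auto simp: eqE_def)

definition ltE :: "ex \<Rightarrow> ex \<Rightarrow> ex" where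
  "ltE a b = Ite (b -. a) (Lit 1) (Lit 0)"

lemma eval_ltE [simp]: "eval (ltE a b) env inp = of_bool (eval a env inp < eval b env inp)"
  by (simp add: ltE_def)

lemma fine_ltE [simp]: "fine Y (ltE a b) env inp \<longleftrightarrow> fine Y a env inp \<and> fine Y b env inp"
  by (auto simp: ltE_def)

text \<open>The two \<open>Var 1\<close> differ: the count is evaluated in the environment of base
  and exponent and takes the exponent; in the body the loop index is in front, so the base is
  meant.\<close>

definition pwE :: ex where "pwE = Red True (Var 1) (Var 1)"

lemma eval_pwE [simp]: "eval pwE [b, int v] inp = b ^ v"
  by (simp add: pwE_def)

lemma eval_pwE_numeral [simp]: "eval pwE [b, numeral v] inp = b ^ numeral v"
  using eval_pwE[of b "numeral v"] by simp

lemma fine_pwE [simp]: "fine Y pwE [b, int v] inp \<longleftrightarrow> v \<le> Y"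
  by (simp add: pwE_def)

definition digE :: ex where "digE = (Var 1 quo App pwE [Var 0, Var 2]) rem Var 0"

lemma eval_digE [simp]: "eval digE [int b, int a, int v] inp = int (dig b a v)"
  by (simp add: digE_def dig_def zdiv_int zmod_int)

lemma eval_digE_2 [simp]: "eval digE [2, int a, int v] inp = int (dig 2 a v)"
  using eval_digE[of 2 a v] by simp

lemma fine_digE [simp]: "fine Y digE [b, a, int v] inp \<longleftrightarrow> v \<le> Y"
  by (simp add: digE_def)

text \<open>The bit length of \<open>n\<close>, as a sum that a \<open>Red\<close> can
  evaluate.\<close>

definition ell :: "nat \<Rightarrow> nat" where
  "ell n = (\<Sum>i<n. of_bool (2 ^ i \<le> n))"

definition base :: "nat \<Rightarrow> nat" where
  "base n = (ell n + 1) ^ 2"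

text \<open>The power dominates the number of clauses, at most (2 n + 1)^k, and the number of
  batches h^k, as h \<le> (2 n + 2)^2. The factor \<open>c\<close> makes the batches a small
  fraction of the rows.\<close>

definition bound :: "nat \<Rightarrow> nat \<Rightarrow> nat \<Rightarrow> nat" where
  "bound k c n = c * (2 * n + 2) ^ (2 * k)"

definition modulus :: "nat \<Rightarrow> nat \<Rightarrow> nat \<Rightarrow> nat" where
  "modulus k c n = (LEAST p. prime p \<and> bound k c n < p)"

lemma modulus:
  assumes "c \<ge> 1"
  shows "prime (modulus k c n)" "bound k c n < modulus k c n" "modulus k c n \<le> 2 * (bound k c n)\<^sup>2 + 1"
    "p < modulus k c n \<Longrightarrow> \<not> (prime p \<and> bound k c n < p)"
proof -
  have "bound k c n \<ge> 1" using assms by (simp add: bound_def Suc_le_eq)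
  then obtain r where r: "prime r \<and> bound k c n < r" "r \<le> 2 * (bound k c n)\<^sup>2 + 1"
    using exists_prime_between by blast
  show "prime (modulus k c n)" "bound k c n < modulus k c n"
    using LeastI[of "\<lambda>p. prime p \<and> bound k c n < p", OF r(1)] by (auto simp: modulus_def)
  show "modulus k c n \<le> 2 * (bound k c n)\<^sup>2 + 1"
    using Least_le[of "\<lambda>p. prime p \<and> bound k c n < p", OF r(1)] r(2) by (simp add: modulus_def)
  show "p < modulus k c n \<Longrightarrow> \<not> (prime p \<and> bound k c n < p)"
    unfolding modulus_def by (rule not_less_Least)
qed

section \<open>Numerical parameters as expressions\<close>

definition nE :: ex where "nE = Inp (Lit 0)"
definition mE :: ex where "mE = Inp (Lit 1)"
definition ellE :: ex where "ellE = Red False nE (ltE (App pwE [Lit 2, Var 0]) (nE +. Lit 1))"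
definition hE :: ex where "hE = App pwE [ellE +. Lit 1, Lit 2]"
definition EE :: "nat \<Rightarrow> ex" where "EE k = App pwE [hE, Lit (int k)]"
definition WE :: ex where "WE = nE quo hE +. Lit 1"
definition wE :: "nat \<Rightarrow> ex" where "wE k = Lit (int k) *. WE"
definition dE :: "nat \<Rightarrow> ex" where "dE k = Lit (int (k + 1)) *. EE k +. Lit 1"
definition boundE :: "nat \<Rightarrow> nat \<Rightarrow> ex" where
  "boundE k c = Lit (int c) *. App pwE [Lit 2 *. nE +. Lit 2, Lit (int (2 * k))]"
definition primeE :: ex where
  "primeE = ltE (Lit 1) (Var 0) *.
     eqE (Red False (Var 0) (ltE (Lit 1) (Var 0) *. eqE (Var 1 rem Var 0) (Lit 0))) (Lit 0)"
definition candE :: "nat \<Rightarrow> nat \<Rightarrow> ex" where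
  "candE k c = ltE (boundE k c) (Var 0) *. App primeE [Var 0]"
text \<open>Search for the least candidate as a sum: the product annihilates every candidate but the
  first. The range is the one in which \<open>exists_prime_between\<close> guarantees a
  prime.\<close>

definition qE :: "nat \<Rightarrow> nat \<Rightarrow> ex" where
  "qE k c = Red False (Lit 2 *. (boundE k c *. boundE k c) +. Lit 2)
     (Var 0 *. App (candE k c) [Var 0] *. Red True (Var 0) (Lit 1 -. App (candE k c) [Var 0]))"

lemma prime_iff_sum:
  "of_bool (prime p) = of_bool (1 < int p) * (of_bool ((\<Sum>i<p. of_bool (1 < int i) * of_bool (int p mod int i = (0 :: int))) = (0 :: int)) :: int)"
proof -
  have "(\<Sum>i<p. of_bool (1 < int i) * of_bool (int p mod int i = (0 :: int))) = (0 :: int) \<longleftrightarrow> (\<forall>i<p. 1 < i \<longrightarrow> \<not> i dvd p)"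
    by (subst sum_nonneg_eq_0_iff) (auto simp: mod_eq_0_iff_dvd)
  also have "\<dots> \<longleftrightarrow> (\<forall>i. 1 < i \<and> i < p \<longrightarrow> \<not> i dvd p)" by blast
  moreover have "prime p \<longleftrightarrow> 1 < p \<and> (\<forall>i. 1 < i \<and> i < p \<longrightarrow> \<not> i dvd p)"
  proof (cases "1 < p")
    case True
    then show ?thesis unfolding prime_nat_iff
      using dvd_imp_le[of _ p] by (auto, metis One_nat_def Suc_lessI dvd_0_left_iff le_neq_implies_less not_gr_zero not_less_zero)
  next
    case False
    then show ?thesis using prime_gt_1_nat by blast
  qed
  ultimately show ?thesis by simp
qed

lemma eval_primeE [simp]: "eval primeE [int p] inp = of_bool (prime p)"
  by (simp add: primeE_def prime_iff_sum)

lemma fine_primeE [simp]: "fine Y primeE [int p] inp \<longleftrightarrow> p \<le> Y"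
  by (simp add: primeE_def)

lemma nth_concat:
  "c < length xs \<Longrightarrow> j < length (xs ! c) \<Longrightarrow>
    (\<Sum>i<c. length (xs ! i)) + j < length (concat xs) \<and>
    concat xs ! ((\<Sum>i<c. length (xs ! i)) + j) = xs ! c ! j"
proof (induction xs arbitrary: c)
  case (Cons x xs)
  show ?case
  proof (cases c)
    case 0
    then show ?thesis using Cons.prems by (simp add: nth_append)
  next
    case (Suc c')
    then have "(\<Sum>i<c. length ((x # xs) ! i)) = length x + (\<Sum>i<c'. length (xs ! i))"
      by (simp only: sum.lessThan_Suc_shift nth_Cons_0 nth_Cons_Suc)
    then show ?thesis using Cons Suc by (simp add: nth_append add.assoc)
  qed
qed simp

text \<open>The bounds on \<open>Y\<close> cover the rounds of all loops in the expressions and the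
  lengths of iterated values. \<open>ncols\<close> is among them because a column of the index row
  is a digit position, hence an exponent. It is still 2^o(n), so cells may cost a power of
  \<open>Y\<close>.\<close>

locale exprs = protocol +
  fixes c Y :: nat and inp :: "int \<Rightarrow> int"
  assumes c: "c \<ge> 1" and h_eq: "h = base n" and hn_eq: "hn = n div 2 + 1" and q_eq: "q = modulus k c n"
    and inp: "inp = snd (initial (encode_cnf n F)) 0"
    and Y: "Y \<ge> 4" "n + 2 * h \<le> Y" "2 + m * (k + 1) \<le> Y" "2 * k \<le> Y" "hn \<le> Y" "E \<le> Y" "d \<le> Y" "w + 1 \<le> Y"
      "2 * (bound k c n)\<^sup>2 + 2 \<le> Y" "ncols \<le> Y"
begin

lemma inp_nth: "i < length (encode_cnf n F) \<Longrightarrow> inp (int i) = encode_cnf n F ! i"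
  by (simp add: inp initial_def)

lemma inp_0 [simp]: "inp 0 = int n" and inp_1 [simp]: "inp 1 = int m"
  using inp_nth[of 0] inp_nth[of 1] by (simp_all add: encode_cnf_def m_def)

lemma eval_nE [simp]: "eval nE env inp = int n" and fine_nE [simp]: "fine Y nE env inp"
  by (simp_all add: nE_def)

lemma eval_mE [simp]: "eval mE env inp = int m" and fine_mE [simp]: "fine Y mE env inp"
  by (simp_all add: mE_def)

lemma eval_ellE [simp]: "eval ellE env inp = int (ell n)"
proof -
  have "(2 :: int) ^ i < 1 + int n \<longleftrightarrow> 2 ^ i \<le> n" for i
  proof -
    have "(2 :: int) ^ i < 1 + int n \<longleftrightarrow> (2 :: int) ^ i \<le> int n" by linarith
    also have "\<dots> \<longleftrightarrow> int (2 ^ i) \<le> int n" by simp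
    finally have "(2 :: int) ^ i < 1 + int n \<longleftrightarrow> int (2 ^ i) \<le> int n" .
    then show ?thesis by (simp only: of_nat_le_iff)
  qed
  then show ?thesis by (simp add: ellE_def ell_def add.commute)
qed

lemma fine_ellE [simp]: "fine Y ellE env inp"
  using Y(2) by (simp add: ellE_def)

lemma eval_hE [simp]: "eval hE env inp = int h" and fine_hE [simp]: "fine Y hE env inp"
  using Y(1) fine_pwE[of Y "int (ell n) + 1" 2 inp] by (simp_all add: hE_def h_eq base_def add.commute)

lemma eval_EE [simp]: "eval (EE k) env inp = int E" and fine_EE [simp]: "fine Y (EE k) env inp"
  using Y(4) by (simp_all add: EE_def E_def)

lemma eval_WE [simp]: "eval WE env inp = int W" and fine_WE [simp]: "fine Y WE env inp"
  by (simp_all add: WE_def W_def zdiv_int)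

lemma eval_wE [simp]: "eval (wE k) env inp = int w" and fine_wE [simp]: "fine Y (wE k) env inp"
  by (simp_all add: wE_def w_def)

lemma eval_dE [simp]: "eval (dE k) env inp = int d" and fine_dE [simp]: "fine Y (dE k) env inp"
  by (simp_all add: dE_def d_def algebra_simps)

lemma eval_boundE [simp]: "eval (boundE k c) env inp = int (bound k c n)"
  and fine_boundE [simp]: "fine Y (boundE k c) env inp"
  using Y(4) eval_pwE[of "2 * int n + 2" "2 * k" inp] fine_pwE[of Y "2 * int n + 2" "2 * k" inp]
  by (simp_all add: boundE_def bound_def add.commute)

lemma eval_candE [simp]: "eval (candE k c) [int p] inp = of_bool (prime p \<and> bound k c n < p)"
  by (auto simp: candE_def)

lemma fine_candE [simp]: "p \<le> Y \<Longrightarrow> fine Y (candE k c) [int p] inp"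
  by (simp add: candE_def)

lemma eval_qE [simp]: "eval (qE k c) env inp = int q"
proof -
  let ?B = "bound k c n"
  have n: "nat (2 * (int ?B * int ?B) + 2) = 2 * ?B\<^sup>2 + 2"
    by (simp add: nat_eq_iff power2_eq_square)
  have "eval (qE k c) env inp = (\<Sum>i<2 * ?B\<^sup>2 + 2. int i * of_bool (prime i \<and> ?B < i) * (\<Prod>j<i. 1 - of_bool (prime j \<and> ?B < j)))"
    using n by (simp add: qE_def)
  also have "\<dots> = (\<Sum>i<2 * ?B\<^sup>2 + 2. if i = q then int i else 0)"
  proof (rule sum.cong[OF refl])
    fix i
    show "int i * of_bool (prime i \<and> ?B < i) * (\<Prod>j<i. 1 - of_bool (prime j \<and> ?B < j)) = (if i = q then int i else 0)"
    proof (cases "i = q")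
      case True
      then have "(\<Prod>j<i. 1 - of_bool (prime j \<and> ?B < j)) = (\<Prod>j<i. 1 :: int)"
        using modulus(4)[OF c, of _ k n] q_eq by (intro prod.cong) auto
      then show ?thesis using True modulus(1,2)[OF c, of k n] q_eq by simp
    next
      case False
      show ?thesis
      proof (cases "prime i \<and> ?B < i")
        case True
        then have "\<not> i < q" using modulus(4)[OF c, of i k n] q_eq by blast
        then have "q < i" using False by simp
        then have "(\<Prod>j<i. 1 - of_bool (prime j \<and> ?B < j)) = (0 :: int)"
          using modulus(1,2)[OF c, of k n] q_eq by (intro prod_zero bexI[of _ q]) auto
        then show ?thesis using False by simp
      qed (use False in auto)
    qed
  qed
  also have "\<dots> = int q"
    using modulus(3)[OF c, of k n] q_eq by (simp del: sum.lessThan_Suc add: sum.delta)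
  finally show ?thesis .
qed

lemma fine_qE [simp]: "fine Y (qE k c) env inp"
proof -
  let ?B = "bound k c n"
  have n: "nat (2 * (int ?B * int ?B) + 2) = 2 * ?B\<^sup>2 + 2"
    by (simp add: nat_eq_iff power2_eq_square)
  then show ?thesis using Y(9) by (auto simp: qE_def)
qed

end

text \<open>Where an expression takes arguments, its \<open>eval\<close> lemma below shows their
  order. Inside the body of a \<open>Red\<close> all indices are shifted by one.\<close>

definition hnE :: ex where "hnE = nE quo Lit 2 +. Lit 1"
definition NBE :: ex where "NBE = App pwE [Lit 2, hnE]"
definition NAE :: "nat \<Rightarrow> nat \<Rightarrow> ex" where "NAE k c = NBE *. App pwE [qE k c, dE k]"
definition NE :: "nat \<Rightarrow> nat \<Rightarrow> ex" where "NE k c = NAE k c +. NBE"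
definition colsE :: "nat \<Rightarrow> nat \<Rightarrow> ex" where "colsE k c = App pwE [qE k c, wE k +. Lit 1]"
definition mpE :: "nat \<Rightarrow> ex" where
  "mpE k = Red True (EE k) (Ite (eqE (Var 0) (Var 1)) (Lit 1) (Var 2 -. Var 0))"
definition upE :: "nat \<Rightarrow> ex" where "upE k = Red False (EE k) (App (mpE k) [Var 0, Var 1])"
definition zpE :: "nat \<Rightarrow> ex" where "zpE k = Red True (EE k) (Var 1 -. Var 0)"
definition xbitE :: ex where
  "xbitE = Ite (Var 0)
     (Ite (ltE (Var 2) hnE) (Lit 0) (App digE [Lit 2, Var 1, Var 2 -. hnE]))
     (Ite (ltE (Var 2) hnE) (App digE [Lit 2, Var 1, Var 2]) (Lit 0))"
definition zetaE :: "nat \<Rightarrow> ex" where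
  "zetaE k = Red False (EE k)
     (App xbitE [Var 1, Var 2, App digE [hE, Var 0, Var 3 quo WE] +. hE *. (Var 3 rem WE)] *.
      App (mpE k) [Var 0, Var 4])"
definition hpolyE :: "nat \<Rightarrow> nat \<Rightarrow> ex" where
  "hpolyE k c = Red False (dE k) (App digE [qE k c, Var 1, Var 0] *. App pwE [Var 2, Var 0])"
definition msgE :: "nat \<Rightarrow> nat \<Rightarrow> ex" where
  "msgE k c = Ite (ltE (Var 2) (wE k)) (App (zetaE k) [Lit 0, Var 0 rem NBE, Var 2, Var 1])
     (App (zpE k) [Var 1] *. App (hpolyE k c) [Var 0 quo NBE, Var 1]) rem qE k c"
definition entAE :: "nat \<Rightarrow> nat \<Rightarrow> ex" where
  "entAE k c = Red True (wE k +. Lit 1)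
     (eqE (App digE [qE k c, Var 3, Var 0]) (App (msgE k c) [Var 1, Var 2, Var 0]))"
text \<open>Clauses differ in length, so a clause is located by hopping over its predecessors, from
  cell 2 behind the header. This is why the expression language has \<open>Iter\<close>.\<close>

definition posE :: ex where "posE = Iter (Lit 2) (Var 0) (Var 1 +. Lit 1 +. Inp (Var 1))"
definition litE :: ex where
  "litE = Ite (ltE (Var 1) (Inp (App posE [Var 0]))) (Inp (App posE [Var 0] +. Lit 1 +. Var 1)) (Lit 0)"
definition varE :: ex where
  "varE = Ite (Var 0) (Var 0 -. Lit 1) (Ite (Lit 0 -. Var 0) (Lit 0 -. Var 0 -. Lit 1) (Lit 0))"
definition batE :: "nat \<Rightarrow> ex" where
  "batE k = Red False (Lit (int k))
     ((App varE [App litE [Var 1, Var 0]] rem hE) *. App pwE [hE, Var 0])"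
definition zsumE :: "nat \<Rightarrow> nat \<Rightarrow> ex" where
  "zsumE k c = App digE [qE k c, Var 1, Var 3] +. App (zetaE k) [Lit 1, Var 0, Var 3, Var 2]"
definition litvE :: "nat \<Rightarrow> nat \<Rightarrow> ex" where
  "litvE k c = Ite (Var 0)
     (App (upE k) [Var 4] -. App (zsumE k c) [Var 2, Var 3, Var 4, Var 1 *. WE +. (App varE [Var 0] quo hE)])
     (Ite (Lit 0 -. Var 0)
       (App (zsumE k c) [Var 2, Var 3, Var 4, Var 1 *. WE +. (App varE [Var 0] quo hE)])
       (App (upE k) [Var 4]))"
definition violvE :: "nat \<Rightarrow> nat \<Rightarrow> ex" where
  "violvE k c = Red False mE (App (mpE k) [App (batE k) [Var 0], Var 3] *.
     Red True (Lit (int k)) (App (litvE k c) [App litE [Var 1, Var 0], Var 0, Var 2, Var 3, Var 4]))"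
definition entBE :: "nat \<Rightarrow> nat \<Rightarrow> ex" where
  "entBE k c = Lit 0 -. eqE ((App (violvE k c) [Var 0, Var 2, Var 1] -. App digE [qE k c, Var 2, wE k])
     rem qE k c) (Lit 0)"
definition entE :: "nat \<Rightarrow> nat \<Rightarrow> ex" where
  "entE k c = Ite (ltE (Var 1) (qE k c))
     (Ite (ltE (Var 0) (NAE k c)) (App (entAE k c) [Var 0, Var 1, Var 2])
       (App (entBE k c) [Var 0 -. NAE k c, Var 1, Var 2]))
     (App digE [Lit 2, Var 0, Var 2])"
definition outE :: "nat \<Rightarrow> nat \<Rightarrow> ex" where
  "outE k c = Ite (eqE (Var 0) (Lit 0)) (NE k c) (Ite (eqE (Var 0) (Lit 1)) (qE k c +. Lit 1)
     (Ite (eqE (Var 0) (Lit 2)) (colsE k c) (Ite ((Var 0 -. Lit 3) rem Lit 2) (Lit 1)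
       (App (entE k c) [(Var 0 -. Lit 3) quo Lit 2 quo ((qE k c +. Lit 1) *. colsE k c),
          ((Var 0 -. Lit 3) quo Lit 2 quo colsE k c) rem (qE k c +. Lit 1),
          ((Var 0 -. Lit 3) quo Lit 2) rem colsE k c]))))"
definition outlenE :: "nat \<Rightarrow> nat \<Rightarrow> ex" where
  "outlenE k c = Lit 3 +. Lit 2 *. (NE k c *. (qE k c +. Lit 1) *. colsE k c)"
text \<open>The square of the bound in \<open>unsat_diameter\<close>.\<close>

definition thresholdE :: "nat \<Rightarrow> nat \<Rightarrow> ex" where
  "thresholdE k c = qE k c +. Lit 1 +. Lit 3 *. (Lit (int (k + 2)) *. EE k)"
definition inlenE :: "nat \<Rightarrow> ex" where "inlenE k = Lit 2 +. mE *. Lit (int (k + 1))"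

context exprs begin

lemma eval_hnE [simp]: "eval hnE env inp = int hn" and fine_hnE [simp]: "fine Y hnE env inp"
  by (simp_all add: hnE_def hn_eq zdiv_int)

lemma eval_NBE [simp]: "eval NBE env inp = int NB" and fine_NBE [simp]: "fine Y NBE env inp"
  using Y(5) by (simp_all add: NBE_def NB_def)

lemma eval_NAE [simp]: "eval (NAE k c) env inp = int NA" and fine_NAE [simp]: "fine Y (NAE k c) env inp"
  using Y(7) by (simp_all add: NAE_def NA_def NB_def)

lemma eval_NE [simp]: "eval (NE k c) env inp = int N" and fine_NE [simp]: "fine Y (NE k c) env inp"
  by (simp_all add: NE_def N_def)

lemma eval_colsE [simp]: "eval (colsE k c) env inp = int ncols" and fine_colsE [simp]: "fine Y (colsE k c) env inp"
  using Y(8) eval_pwE[of "int q" "w + 1" inp] fine_pwE[of Y "int q" "w + 1" inp]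
  by (simp_all add: colsE_def ncols_def add.commute)

lemma eval_mpE [simp]: "eval (mpE k) [int e, x] inp = poly (mp E e) x"
  unfolding poly_mp by (simp add: mpE_def) (rule prod.cong[OF refl], simp)

lemma fine_mpE [simp]: "fine Y (mpE k) [int e, x] inp"
  using Y(6) by (simp add: mpE_def)

lemma eval_upE [simp]: "eval (upE k) [x] inp = poly (up E) x" and fine_upE [simp]: "fine Y (upE k) [x] inp"
  using Y(6) by (simp_all add: upE_def poly_up)

lemma eval_zpE [simp]: "eval (zpE k) [x] inp = poly (zp E) x" and fine_zpE [simp]: "fine Y (zpE k) [x] inp"
  using Y(6) by (simp_all add: zpE_def poly_zp)

lemma eval_xbitE [simp]: "eval xbitE [of_bool s, int a, int v] inp = xbit s a v"
  and fine_xbitE [simp]: "v \<le> Y \<Longrightarrow> fine Y xbitE [of_bool s, int a, int v] inp"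
proof -
  define u where "u = v - hn"
  have u: "v - hn = u" "\<not> v < hn \<Longrightarrow> int v - int hn = int u" "u \<le> v" by (auto simp: u_def)
  show "eval xbitE [of_bool s, int a, int v] inp = xbit s a v"
    by (cases "v < hn") (simp_all add: xbitE_def xbit_def u)
  show "fine Y xbitE [of_bool s, int a, int v] inp" if "v \<le> Y"
    using that le_trans[OF u(3) that] by (cases "v < hn") (simp_all add: xbitE_def u)
qed

text \<open>\<open>xbitE\<close> uses a variable index as an exponent, so slots must respect the
  loop bound. They can exceed \<open>n\<close>, as every block gets indices up to
  \<open>n div h\<close>.\<close>

lemma slot_le: "slot \<sigma> e \<le> Y"
proof -
  have "slot \<sigma> e \<le> h + h * (n div h)"
    using dig_less[OF h_pos, of e "\<sigma> div W"] mod_less_divisor[OF W_pos, of \<sigma>] unfolding slot_def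
    by (intro add_mono mult_left_mono) (auto simp: W_def less_Suc_eq_le)
  also have "h * (n div h) \<le> n" by simp
  finally show ?thesis using Y(2) by simp
qed

lemma eval_zetaE [simp]: "eval (zetaE k) [of_bool s, int a, int \<sigma>, x] inp = poly (zeta (xbit s a) \<sigma>) x"
  and fine_zetaE [simp]: "\<sigma> \<le> Y \<Longrightarrow> fine Y (zetaE k) [of_bool s, int a, int \<sigma>, x] inp"
proof -
  define u where "u = \<sigma> div W"
  define v where "v = \<sigma> mod W"
  have uv: "\<sigma> div W = u" "\<sigma> mod W = v" "int \<sigma> div int W = int u" "int \<sigma> mod int W = int v"
    by (simp_all only: u_def v_def zdiv_int zmod_int)
  have sl: "int (dig h e u) + int h * int v = int (slot \<sigma> e)" for e
    by (simp only: slot_def uv of_nat_add of_nat_mult)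
  show "eval (zetaE k) [of_bool s, int a, int \<sigma>, x] inp = poly (zeta (xbit s a) \<sigma>) x"
    unfolding zetaE_def poly_zeta by (simp add: uv sl)
  show "fine Y (zetaE k) [of_bool s, int a, int \<sigma>, x] inp" if "\<sigma> \<le> Y"
  proof -
    have "u \<le> Y" unfolding u_def using that div_le_dividend le_trans by blast
    then show ?thesis using Y(6) slot_le[of \<sigma>] unfolding zetaE_def by (simp add: uv sl)
  qed
qed

lemma eval_zetaE_0 [simp]: "eval (zetaE k) [0, int a, int \<sigma>, x] inp = poly (zeta (xbit False a) \<sigma>) x"
  and eval_zetaE_1 [simp]: "eval (zetaE k) [1, int a, int \<sigma>, x] inp = poly (zeta (xbit True a) \<sigma>) x"
  using eval_zetaE[of False a \<sigma> x] eval_zetaE[of True a \<sigma> x] by simp_all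

lemma fine_zetaE_0 [simp]: "\<sigma> \<le> Y \<Longrightarrow> fine Y (zetaE k) [0, int a, int \<sigma>, x] inp"
  and fine_zetaE_1 [simp]: "\<sigma> \<le> Y \<Longrightarrow> fine Y (zetaE k) [1, int a, int \<sigma>, x] inp"
  using fine_zetaE[of \<sigma> False a x] fine_zetaE[of \<sigma> True a x] by simp_all

lemma eval_hpolyE [simp]: "eval (hpolyE k c) [int H, x] inp = poly (hpoly H) x"
  and fine_hpolyE [simp]: "fine Y (hpolyE k c) [int H, x] inp"
  using Y(7) by (simp_all add: hpolyE_def poly_hpoly)

lemma NB_div_mod: "int a mod int NB = int (a mod NB)" "int a div int NB = int (a div NB)"
  by (simp_all only: zdiv_int zmod_int)

lemma eval_msgE [simp]: "eval (msgE k c) [int a, int r, int \<sigma>] inp = msg a r \<sigma>"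
  unfolding msg_def NB_def[symmetric] by (simp add: msgE_def NB_div_mod)

lemma fine_msgE [simp]: "\<sigma> \<le> Y \<Longrightarrow> fine Y (msgE k c) [int a, int r, int \<sigma>] inp"
  by (simp add: msgE_def NB_div_mod)

lemma prod_of_bool: "(\<Prod>i<(l :: nat). of_bool (P i)) = (of_bool (\<forall>i<l. P i) :: int)"
  by (induction l) (auto simp: less_Suc_eq)

lemma eval_entAE [simp]: "eval (entAE k c) [int a, int r, int j] inp = entA a r j"
proof -
  have "eval (entAE k c) [int a, int r, int j] inp = (\<Prod>\<sigma><nat (int w + 1). of_bool (int (dig q j \<sigma>) = msg a r \<sigma>))"
    by (simp add: entAE_def)
  also have "nat (int w + 1) = Suc w" by simp
  also have "(\<Prod>\<sigma><Suc w. of_bool (int (dig q j \<sigma>) = msg a r \<sigma>)) = (of_bool (\<forall>\<sigma><Suc w. int (dig q j \<sigma>) = msg a r \<sigma>) :: int)"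
    by (rule prod_of_bool)
  finally show ?thesis by (simp only: entA_def)
qed

lemma fine_entAE [simp]: "fine Y (entAE k c) [int a, int r, int j] inp"
proof -
  have "nat (int w + 1) = w + 1" by simp
  then show ?thesis using Y(8) unfolding entAE_def by simp
qed

section \<open>Locating clauses and literals in the input\<close>

definition pos :: "nat \<Rightarrow> nat" where "pos cl = 2 + (\<Sum>i<cl. 1 + length (F ! i))"

lemma clause_nth:
  assumes "cl < m" "j < 1 + length (F ! cl)"
  shows "inp (int (pos cl + j)) = (int (length (F ! cl)) # F ! cl) ! j"
proof -
  let ?xs = "map (\<lambda>c. int (length c) # c) F"
  have l: "(\<Sum>i<cl. length (?xs ! i)) = (\<Sum>i<cl. 1 + length (F ! i))"
    using assms(1) by (intro sum.cong) (auto simp: m_def)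
  have "(\<Sum>i<cl. length (?xs ! i)) + j < length (concat ?xs) \<and> concat ?xs ! ((\<Sum>i<cl. length (?xs ! i)) + j) = ?xs ! cl ! j"
    by (rule nth_concat) (use assms in \<open>auto simp: m_def\<close>)
  then have a: "(\<Sum>i<cl. 1 + length (F ! i)) + j < length (concat ?xs)"
    and b: "concat ?xs ! ((\<Sum>i<cl. 1 + length (F ! i)) + j) = (int (length (F ! cl)) # F ! cl) ! j"
    unfolding l using assms(1) by (auto simp: m_def)
  have p: "pos cl + j = Suc (Suc ((\<Sum>i<cl. 1 + length (F ! i)) + j))" by (simp add: pos_def)
  show ?thesis unfolding p using a b by (subst inp_nth) (simp_all add: encode_cnf_def)
qed

lemma inp_pos: "cl < m \<Longrightarrow> inp (int (pos cl)) = int (length (F ! cl))"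
  using clause_nth[of cl 0] by simp

lemma inp_pos_nth: "cl < m \<Longrightarrow> j < length (F ! cl) \<Longrightarrow> inp (int (pos cl) + 1 + int j) = F ! cl ! j"
  using clause_nth[of cl "Suc j"] by (simp add: add.assoc add.left_commute)

lemma pos_le: "cl \<le> m \<Longrightarrow> pos cl \<le> 2 + m * (k + 1)"
proof -
  assume cl: "cl \<le> m"
  have "(\<Sum>i<cl. 1 + length (F ! i)) \<le> (\<Sum>i<cl. k + 1)"
    using clause(1) cl by (intro sum_mono) auto
  also have "\<dots> = cl * (k + 1)" by simp
  also have "\<dots> \<le> m * (k + 1)" using cl by (intro mult_right_mono) auto
  finally show ?thesis by (simp add: pos_def)
qed

lemma iter_pos: "cl \<le> m \<Longrightarrow> iter (\<lambda>i x. x + 1 + inp x) cl 2 = int (pos cl)"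
proof (induction cl)
  case (Suc cl)
  then show ?case using inp_pos[of cl] by (simp add: pos_def)
qed (simp add: pos_def)

lemma eval_posE [simp]: "cl < m \<Longrightarrow> eval posE [int cl] inp = int (pos cl)"
  using iter_pos[of cl] by (simp add: posE_def)

lemma fine_posE [simp]: "cl < m \<Longrightarrow> fine Y posE [int cl] inp"
proof -
  assume cl: "cl < m"
  have "m \<le> 2 + m * (k + 1)" by simp
  then have "m \<le> Y" using Y(3) by linarith
  moreover have "bits (int (pos i)) \<le> Y" if "i \<le> cl" for i
    using pos_le[of i] that cl Y(1,3) by (intro bits_nat_le) auto
  ultimately show ?thesis using cl iter_pos by (simp add: posE_def Let_def)
qed

lemma eval_litE [simp]: "cl < m \<Longrightarrow> eval litE [int cl, int j] inp = lit F cl j"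
  unfolding lit_def using inp_pos[of cl] inp_pos_nth[of cl j] by (simp add: litE_def)

lemma fine_litE [simp]: "cl < m \<Longrightarrow> fine Y litE [int cl, int j] inp"
  by (simp add: litE_def)

lemma eval_varE [simp]: "eval varE [l] inp = int (var l)" and fine_varE [simp]: "fine Y varE [l] inp"
  by (auto simp: varE_def var_def)

lemma eval_batE [simp]: "cl < m \<Longrightarrow> eval (batE k) [int cl] inp = int (bat cl)"
  by (simp add: batE_def bat_def zmod_int)

lemma fine_batE [simp]: "cl < m \<Longrightarrow> fine Y (batE k) [int cl] inp"
  using Y(4) by (simp add: batE_def)

lemma eval_zsumE [simp]: "eval (zsumE k c) [int b, int j, x, int \<sigma>] inp = int (dig q j \<sigma>) + poly (zeta (xbit True b) \<sigma>) x"
  by (simp add: zsumE_def)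

lemma fine_zsumE [simp]: "\<sigma> \<le> Y \<Longrightarrow> fine Y (zsumE k c) [int b, int j, x, int \<sigma>] inp"
  by (simp add: zsumE_def)

lemma slot_index_int: "int i * int W + int (var l) div int h = int (i * W + var l div h)"
  by (simp add: zdiv_int)

lemma eval_litvE [simp]:
  "eval (litvE k c) [lit F cl i, int i, int b, int j, x] inp = litv x (\<lambda>\<sigma>. int (dig q j \<sigma>) + poly (zeta (xbit True b) \<sigma>) x) cl i"
proof -
  define t where "t = i * W + var (lit F cl i) div h"
  have s: "int i * int W + int (var (lit F cl i)) div int h = int t" unfolding slot_index_int t_def ..
  show ?thesis unfolding litv_def Let_def t_def[symmetric] by (simp add: litvE_def s)
qed

lemma fine_litvE [simp]:
  assumes "cl < m" "i < k"
  shows "fine Y (litvE k c) [lit F cl i, int i, int b, int j, x] inp"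
proof -
  define t where "t = i * W + var (lit F cl i) div h"
  have s: "int i * int W + int (var (lit F cl i)) div int h = int t" unfolding slot_index_int t_def ..
  have "t \<le> Y" using slot_index_less[OF assms(2,1)] Y(8) unfolding t_def by linarith
  then show ?thesis by (simp add: litvE_def s)
qed

lemma eval_violvE [simp]: "eval (violvE k c) [int b, int j, x] inp = violv x (\<lambda>\<sigma>. int (dig q j \<sigma>) + poly (zeta (xbit True b) \<sigma>) x)"
  by (simp add: violvE_def violv_def)

lemma m_le: "m \<le> Y"
proof -
  have "m \<le> 2 + m * (k + 1)" by simp
  then show "m \<le> Y" using Y(3) by linarith
qed

lemma fine_violvE [simp]: "fine Y (violvE k c) [int b, int j, x] inp"
  using Y(4) m_le by (simp add: violvE_def)

lemma eval_entBE [simp]: "eval (entBE k c) [int b, int r, int j] inp = entB b r j"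
  by (simp add: entBE_def entB_def mod_eq_0_iff_dvd)

lemma fine_entBE [simp]: "fine Y (entBE k c) [int b, int r, int j] inp"
  using Y(8) by (simp add: entBE_def)

lemma eval_entE [simp]: "eval (entE k c) [int i, int r, int j] inp = ent i r j"
  and fine_entE [simp]: "j \<le> Y \<Longrightarrow> fine Y (entE k c) [int i, int r, int j] inp"
proof -
  define u where "u = i - NA"
  have u: "i - NA = u" "\<not> i < NA \<Longrightarrow> int i - int NA = int u" by (auto simp: u_def)
  show "eval (entE k c) [int i, int r, int j] inp = ent i r j"
    by (cases "i < NA") (simp_all add: entE_def ent_def u)
  show "fine Y (entE k c) [int i, int r, int j] inp" if "j \<le> Y"
    using that by (cases "i < NA") (simp_all add: entE_def u)
qed

lemma out_args:
  assumes "p \<ge> 3"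
  shows "(int p - 3) div 2 div ((int q + 1) * int ncols) = int ((p - 3) div 2 div ((q + 1) * ncols))"
    "(int p - 3) div 2 div int ncols mod (int q + 1) = int ((p - 3) div 2 div ncols mod (q + 1))"
    "(int p - 3) div 2 mod int ncols = int ((p - 3) div 2 mod ncols)"
    "(int p - 3) mod 2 = of_bool (odd (p - 3))"
proof -
  obtain s where s: "p = s + 3" using assms by (metis le_add_diff_inverse2)
  have i: "int p - 3 = int s" "p - 3 = s" by (simp_all add: s)
  show "(int p - 3) div 2 div ((int q + 1) * int ncols) = int ((p - 3) div 2 div ((q + 1) * ncols))"
    "(int p - 3) div 2 div int ncols mod (int q + 1) = int ((p - 3) div 2 div ncols mod (q + 1))"
    "(int p - 3) div 2 mod int ncols = int ((p - 3) div 2 mod ncols)"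
    unfolding i by (simp_all only: zdiv_int zmod_int of_nat_mult of_nat_add of_nat_1 of_nat_numeral)
  show "(int p - 3) mod 2 = of_bool (odd (p - 3))"
    unfolding i by (simp add: mod2_eq_if)
qed

lemma eval_outE [simp]: "eval (outE k c) [int p] inp = outv p"
  and fine_outE [simp]: "fine Y (outE k c) [int p] inp"
proof -
  have "eval (outE k c) [int p] inp = outv p \<and> fine Y (outE k c) [int p] inp"
  proof (cases "p < 3")
    case True
    then consider "p = 0" | "p = 1" | "p = 2" by linarith
    then show ?thesis by cases (simp_all add: outE_def outv_def)
  next
    case False
    define i where "i = (p - 3) div 2 div ((q + 1) * ncols)"
    define r where "r = (p - 3) div 2 div ncols mod (q + 1)"
    define j where "j = (p - 3) div 2 mod ncols"
    define par where "par \<longleftrightarrow> odd (p - 3)"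
    have p: "int p \<noteq> 0" "int p \<noteq> 1" "int p \<noteq> 2" "p \<noteq> 0" "p \<noteq> 1" "p \<noteq> 2" using False by auto
    have "p \<ge> 3" using False by simp
    note a = out_args[OF this, folded i_def r_def j_def par_def]
    have j: "j \<le> Y"
      using mod_less_divisor[OF ncols_pos, of "(p - 3) div 2"] Y(10) unfolding j_def by linarith
    have "eval (outE k c) [int p] inp = (if par then 1 else ent i r j)"
      using p unfolding outE_def by (simp add: a)
    moreover have "outv p = (if par then 1 else ent i r j)"
      unfolding outv_def i_def r_def j_def par_def using p(4-6) by (simp only: if_False)
    moreover have "fine Y (outE k c) [int p] inp"
      using p j unfolding outE_def by (simp add: a)
    ultimately show ?thesis by simp
  qed
  then show "eval (outE k c) [int p] inp = outv p" "fine Y (outE k c) [int p] inp" by auto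
qed

lemma eval_outlenE [simp]: "eval (outlenE k c) env inp = int outlen" and fine_outlenE [simp]: "fine Y (outlenE k c) env inp"
  by (simp_all add: outlenE_def outlen_def algebra_simps)

lemma eval_thresholdE [simp]: "eval (thresholdE k c) env inp = int (q + 1 + 3 * ((k + 2) * E))"
  and fine_thresholdE [simp]: "fine Y (thresholdE k c) env inp"
  by (simp_all add: thresholdE_def algebra_simps)

lemma eval_inlenE [simp]: "eval (inlenE k) env inp = int (2 + m * (k + 1))" and fine_inlenE [simp]: "fine Y (inlenE k) env inp"
  by (simp_all add: inlenE_def algebra_simps)

end

definition algorithm :: "nat \<Rightarrow> nat \<Rightarrow> prog \<Rightarrow> nat \<Rightarrow> prog" where
  "algorithm k c P K = reduction P K (inlenE k) (outlenE k c) (outE k c) (thresholdE k c)"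

text \<open>In the unsatisfiable case \<open>returned_value R \<le> opt\<close> decides; in the
  satisfiable case the approximation factor does, as the gap puts \<theta> below 4 q / (2 -
  \<delta>)^2. Since \<open>sqrt\<close> is monotone on all reals, negative quotients are covered
  too.\<close>

lemma returned_value_iff:
  assumes \<delta>: "\<delta> > 0" "2 - \<delta> \<ge> 1" and gap: "real \<theta> * (2 - \<delta>)\<^sup>2 < 4 * real q"
    and yes: "S \<Longrightarrow> sqrt (4 * real q) \<le> opt" and no: "\<not> S \<Longrightarrow> opt \<le> sqrt (real \<theta>)"
    and L: "opt / (2 - \<delta>) \<le> returned_value R" "returned_value R \<le> opt"
  shows "R 0 * R 1 > int \<theta> * (R 1)\<^sup>2 \<longleftrightarrow> S"
proof -
  let ?x = "real_of_int (R 0) / real_of_int (R 1)"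
  have iff: "R 0 * R 1 > int \<theta> * (R 1)\<^sup>2 \<longleftrightarrow> ?x > real \<theta>"
  \<comment> \<open>For \<open>R 1 = 0\<close> the quotient is 0 and both sides are false.\<close>
  proof (cases "R 1 = 0")
    case False
    then have p: "0 < (real_of_int (R 1))\<^sup>2" by simp
    have "?x > real \<theta> \<longleftrightarrow> ?x * (real_of_int (R 1))\<^sup>2 > real \<theta> * (real_of_int (R 1))\<^sup>2"
      by (rule mult_less_cancel_right_pos[OF p, symmetric])
    also have "?x * (real_of_int (R 1))\<^sup>2 = real_of_int (R 0 * R 1)"
      using False by (simp add: power2_eq_square)
    also have "real \<theta> * (real_of_int (R 1))\<^sup>2 = real_of_int (int \<theta> * (R 1)\<^sup>2)" by simp
    finally show ?thesis by (simp only: of_int_less_iff)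
  qed simp
  show ?thesis unfolding iff
  proof
    assume x: "?x > real \<theta>"
    show S
    proof (rule ccontr)
      assume "\<not> S"
      then have "sqrt ?x \<le> sqrt (real \<theta>)" using no[of] L(2) unfolding returned_value_def by linarith
      then show False using x by simp
    qed
  next
    assume S
    then have "sqrt (4 * real q) / (2 - \<delta>) \<le> opt / (2 - \<delta>)" using yes \<delta> by (intro divide_right_mono) auto
    also have "\<dots> \<le> sqrt ?x" using L by (simp add: returned_value_def)
    finally have a: "sqrt (4 * real q) / (2 - \<delta>) \<le> sqrt ?x" .
    have "real \<theta> < 4 * real q / (2 - \<delta>)\<^sup>2" using gap \<delta> by (simp add: less_divide_eq)
    then have "sqrt (real \<theta>) < sqrt (4 * real q / (2 - \<delta>)\<^sup>2)" by simp
    also have "\<dots> = sqrt (4 * real q) / (2 - \<delta>)" using \<delta> by (simp add: real_sqrt_divide)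
    finally have "sqrt (real \<theta>) < sqrt ?x" using a by linarith
    then show "?x > real \<theta>" by simp
  qed
qed

context exprs begin

lemma runs_algorithm:
  assumes P: "diameter_approximation (2 - \<delta>) P" and \<delta>: "\<delta> > 0"
    and K: "below K P" "K \<ge> 2"
    and cc: "\<And>e. e \<in> {inlenE k, outlenE k c, outE k c, thresholdE k c, Inp (Var 0), Lit 0} \<Longrightarrow> comp_spec e cc"
    and bY: "\<And>a. bits (inp a) \<le> Y" "bits (int outlen) \<le> Y" and NC: "N \<le> 2 ^ ncols"
    and gap: "real (q + 1 + 3 * ((k + 2) * E)) * (2 - \<delta>)\<^sup>2 < 4 * real q"
  obtains t R tP RP where "runs (algorithm k c P K) (encode_cnf n F) t R" "R 0 \<noteq> 0 \<longleftrightarrow> satisfiable F"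
    "runs P (encode_instance (q + 1) ncols pts) tP RP"
    "t \<le> (2 * (3 + m * (k + 1)) + (outlen + 1)) * Y ^ (cc + 3) + 100 * (tP + Y ^ cc)"
proof -
  obtain tP RP where RP: "runs P (encode_instance (q + 1) ncols pts) tP RP"
    "product_diameter (q + 1) ncols (points pts) / (2 - \<delta>) \<le> returned_value RP"
    "returned_value RP \<le> product_diameter (q + 1) ncols (points pts)"
    using P is_instance_pts[OF NC] unfolding diameter_approximation_def by blast
  have ge1: "2 - \<delta> \<ge> 1" using P by (simp add: diameter_approximation_def)
  have o: "map (\<lambda>j. eval (outE k c) [int j] inp) [0..<outlen] = encode_instance (q + 1) ncols pts"
    unfolding encode_pts by simp
  have len: "length (encode_cnf n F) \<le> 2 + m * (k + 1)"
  proof -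
    have "length (concat (map (\<lambda>c. int (length c) # c) F)) = (\<Sum>c\<leftarrow>F. 1 + length c)"
      by (simp add: length_concat o_def)
    also have "\<dots> \<le> (\<Sum>c\<leftarrow>F. 1 + k)"
      using F by (intro sum_list_mono) (auto simp: is_kcnf_def)
    finally show ?thesis by (simp add: encode_cnf_def m_def sum_list_triv)
  qed
  have bL: "bits (int (2 + m * (k + 1))) \<le> Y" by (rule bits_nat_le) (use Y in auto)
  have "\<exists>t R. runs (algorithm k c P K) (encode_cnf n F) t R \<and>
    t \<le> (2 * ((2 + m * (k + 1)) + 1) + (outlen + 1)) * Y ^ (cc + 3) + 100 * (tP + Y ^ cc) \<and>
    (R 0 \<noteq> 0 \<longleftrightarrow> RP 0 * RP 1 > eval (thresholdE k c) [] (snd (initial (encode_cnf n F)) 0) * (RP 1)\<^sup>2)"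
    unfolding algorithm_def
    by (rule runs_reduction; (unfold inp[symmetric])?)
      (use K cc Y bY bL len RP(1) o in auto)
  then obtain t R where tR: "runs (algorithm k c P K) (encode_cnf n F) t R"
    "t \<le> (2 * ((2 + m * (k + 1)) + 1) + (outlen + 1)) * Y ^ (cc + 3) + 100 * (tP + Y ^ cc)"
    "R 0 \<noteq> 0 \<longleftrightarrow> RP 0 * RP 1 > int (q + 1 + 3 * ((k + 2) * E)) * (RP 1)\<^sup>2"
    unfolding inp[symmetric] eval_thresholdE by blast
  have "RP 0 * RP 1 > int (q + 1 + 3 * ((k + 2) * E)) * (RP 1)\<^sup>2 \<longleftrightarrow> satisfiable F"
    by (rule returned_value_iff[OF \<delta> ge1 gap sat_diameter unsat_diameter RP(2,3)])
  moreover have "2 * ((2 + m * (k + 1)) + 1) = 2 * (3 + m * (k + 1))" by simp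
  ultimately show ?thesis using that tR RP(1) by metis
qed

end

section \<open>Parameters as functions of \<open>n\<close> and the inequalities between them\<close>

lemma ell_le: "ell n \<le> n"
proof -
  have "ell n \<le> (\<Sum>i<n. 1)" unfolding ell_def by (intro sum_mono) auto
  then show ?thesis by simp
qed

text \<open>Padding by 0 maps the clauses to words of length \<open>k\<close> over 2 n + 1 letters.
  Literals are nonzero, so the word determines the set of literals, and no two clauses of
  \<open>F\<close> have the same set.\<close>

lemma card_clauses:
  assumes "is_kcnf k n F"
  shows "length F \<le> (2 * n + 1) ^ k"
proof -
  let ?A = "{- int n..int n}"
  let ?pad = "\<lambda>c. c @ replicate (k - length c) 0"
  have d: "distinct (map set F)" using assms by (simp add: is_kcnf_def)
  have "inj_on ?pad (set F)"
  proof (rule inj_onI)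
    fix a b assume ab: "a \<in> set F" "b \<in> set F" and e: "?pad a = ?pad b"
    have nz: "0 \<notin> set a" "0 \<notin> set b" using assms ab by (auto simp: is_kcnf_def)
    have s: "set x = set (?pad x) - {0}" if "0 \<notin> set x" for x :: "int list"
      using that by auto
    have "set a = set (?pad a) - {0}" by (rule s[OF nz(1)])
    also have "\<dots> = set b" unfolding e by (rule s[OF nz(2), symmetric])
    finally have "set a = set b" .
    then show "a = b" using d ab unfolding distinct_map inj_on_def by blast
  qed
  then have "card (set F) = card (?pad ` set F)" by (simp add: card_image)
  also have "\<dots> \<le> card {xs. set xs \<subseteq> ?A \<and> length xs = k}"
  proof (rule card_mono)
    show "finite {xs. set xs \<subseteq> ?A \<and> length xs = k}" by (rule finite_lists_length_eq) simp
    show "?pad ` set F \<subseteq> {xs. set xs \<subseteq> ?A \<and> length xs = k}"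
    proof
      fix y assume "y \<in> ?pad ` set F"
      then obtain c where c: "c \<in> set F" "y = ?pad c" by blast
      then have "length c \<le> k" "\<And>l. l \<in> set c \<Longrightarrow> \<bar>l\<bar> \<le> int n" using assms unfolding is_kcnf_def by blast+
      then show "y \<in> {xs. set xs \<subseteq> ?A \<and> length xs = k}" using c(2) by (force simp: abs_le_iff)
    qed
  qed
  also have "\<dots> = card ?A ^ k" by (rule card_lists_length_eq) simp
  also have "card ?A = 2 * n + 1" by simp
  finally have "card (set F) \<le> (2 * n + 1) ^ k" .
  moreover have "card (set F) = length F" using d by (simp add: distinct_card distinct_map)
  ultimately show ?thesis by simp
qed

text \<open>\<open>c\<close> will be chosen from \<delta>. The bound \<open>4 * k + 8\<close> leaves
  a margin between \<open>q\<close> and the smaller parameters for all the crude estimates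
  below.\<close>

locale params =
  fixes k c n :: nat
  assumes k3: "k \<ge> 3" and ck: "c \<ge> 4 * k + 8"
begin

definition "h = base n"
definition "q = modulus k c n"
definition "hn = n div 2 + 1"
definition "ee = h ^ k"
definition "ww = k * (n div h + 1)"
definition "dd = (k + 1) * ee + 1"
definition "big = q ^ (ww + 1)"
definition "YY = 16 * big"
definition "NN = 2 ^ hn * q ^ dd + 2 ^ hn"
text \<open>The number of guesses for \<open>H\<close> times the number of columns. Apart from
  \<open>2 ^ hn\<close> and the time of \<open>P\<close>, all costs are polynomial in this quantity,
  so one growth estimate suffices.\<close>

definition "GG = q ^ dd * big"

lemma c1: "c \<ge> 1" using ck by simp

lemma bound_ge: "(4 * k + 8) * (2 * n + 2) ^ (2 * k) \<le> bound k c n"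
  unfolding bound_def using ck by (intro mult_right_mono) auto

lemma q_prime: "prime q" and bound_less_q: "bound k c n < q" and q_le: "q \<le> 2 * (bound k c n)\<^sup>2 + 1"
  using modulus[OF c1] by (simp_all add: q_def)

lemma h_le: "h \<le> (2 * n + 2) ^ 2"
  unfolding h_def base_def using ell_le[of n] by (intro power_mono) auto

lemma power_le_bound: "x \<le> (2 * n + 2) ^ (2 * k) \<Longrightarrow> (4 * k + 8) * x < q"
proof -
  assume "x \<le> (2 * n + 2) ^ (2 * k)"
  then have "(4 * k + 8) * x \<le> (4 * k + 8) * (2 * n + 2) ^ (2 * k)" by (rule mult_le_mono2)
  then show ?thesis using bound_ge bound_less_q by linarith
qed

lemma ee_less: "(4 * k + 8) * ee < q"
proof (rule power_le_bound)
  have "ee \<le> ((2 * n + 2) ^ 2) ^ k" unfolding ee_def by (rule power_mono[OF h_le]) simp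
  then show "ee \<le> (2 * n + 2) ^ (2 * k)" by (simp add: power_mult)
qed

lemma le_pow: "2 * n + 2 \<le> (2 * n + 2) ^ (2 * k)" "(2 * n + 2) ^ 2 \<le> (2 * n + 2) ^ (2 * k)"
  by (rule self_le_power; use k3 in simp) (rule power_increasing; use k3 in simp)

lemma n_less: "(4 * k + 8) * (2 * n + 2) < q" and h_less: "(4 * k + 8) * h < q"
  using power_le_bound[OF le_pow(1)] power_le_bound[OF order_trans[OF h_le le_pow(2)]] by auto

lemma k_less: "4 * k + 8 < q"
  using n_less by (simp add: algebra_simps)

lemma h_pos: "h \<ge> 1" by (simp add: h_def base_def)

lemma ee_pos: "ee \<ge> 1" using h_pos by (simp add: ee_def)

lemma dd_le: "dd \<le> q"
proof -
  have "dd = (k + 1) * ee + 1" by (simp add: dd_def)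
  also have "(k + 1) * ee \<le> (4 * k + 8) * ee" by (rule mult_right_mono) auto
  finally show ?thesis using ee_less by linarith
qed

lemma ww_ge: "ww \<ge> 3" using k3 by (simp add: ww_def)

lemma ww_le: "ww + 1 \<le> q"
proof -
  have "ww \<le> k * (n + 1)" unfolding ww_def by (intro mult_left_mono) auto
  also have "\<dots> \<le> (4 * k + 8) * (2 * n + 2)" by (intro mult_mono) auto
  finally show ?thesis using n_less by linarith
qed

lemma hn_le: "hn \<le> q"
proof -
  have "hn \<le> 1 * (2 * n + 2)" by (simp add: hn_def)
  also have "\<dots> \<le> (4 * k + 8) * (2 * n + 2)" by (rule mult_right_mono) auto
  finally show ?thesis using n_less by linarith
qed

text \<open>Here \<open>k \<ge> 3\<close> pays off: a fourth power of \<open>q\<close> dominates any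
  product of two parameters up to \<open>q\<close>, with a constant to spare.\<close>

lemma big_ge: "q * q * q * q \<le> big"
proof -
  have "q ^ 4 \<le> q ^ (ww + 1)" using ww_ge k_less by (intro power_increasing) auto
  then show ?thesis by (simp add: big_def power4_eq_xxxx)
qed

lemma q20: "q \<ge> 20" using k_less k3 by linarith

lemma sq_le_big: "x \<le> q \<Longrightarrow> y \<le> q \<Longrightarrow> 20 * (x * y) \<le> big"
proof -
  assume xy: "x \<le> q" "y \<le> q"
  then have "x * y \<le> q * q" by (rule mult_mono) auto
  then have "20 * (x * y) \<le> q * (q * q)" by (rule mult_mono[OF q20]) auto
  also have "\<dots> = 1 * (q * q * q)" by simp
  also have "\<dots> \<le> q * (q * q * q)" using q20 by (intro mult_right_mono) auto
  also have "\<dots> = q * q * q * q" by simp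
  finally show ?thesis using big_ge by linarith
qed

lemma q_le_big: "20 * q \<le> big"
  using sq_le_big[of q 1] q20 by simp

lemma NN_le: "NN \<le> 2 ^ (hn + 1 + q * dd)"
proof -
  have "1 \<le> q ^ dd" using q20 by simp
  then have "2 ^ hn * 1 \<le> 2 ^ hn * q ^ dd" by (rule mult_left_mono) simp
  then have "NN \<le> 2 ^ (hn + 1) * q ^ dd" by (simp add: NN_def)
  also have "\<dots> \<le> 2 ^ (hn + 1) * (2 ^ q) ^ dd" by (intro mult_left_mono power_mono less_imp_le[OF less_exp]) auto
  also have "\<dots> = 2 ^ (hn + 1 + q * dd)" by (simp add: power_add power_mult)
  finally show ?thesis .
qed

lemma NN_le_pow: "NN \<le> 2 ^ big"
proof -
  have "hn + 1 + q * dd \<le> big" using sq_le_big[OF le_refl dd_le] hn_le q_le_big q20 by linarith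
  then have "(2::nat) ^ (hn + 1 + q * dd) \<le> 2 ^ big" by (intro power_increasing) auto
  then show ?thesis using NN_le by linarith
qed

lemma bits_out: "bits (int (3 + 2 * (NN * (q + 1) * big))) \<le> YY"
proof -
  have "NN * (q + 1) * big \<le> 2 ^ (hn + 1 + q * dd) * 2 ^ q * 2 ^ (q * (ww + 1))"
  proof (intro mult_mono NN_le)
    show "q + 1 \<le> 2 ^ q" using Suc_leI[OF less_exp[of q]] by simp
    show "big \<le> 2 ^ (q * (ww + 1))" unfolding big_def power_mult by (intro power_mono less_imp_le[OF less_exp]) auto
  qed auto
  also have "\<dots> = 2 ^ (hn + 1 + q * dd + q + q * (ww + 1))" by (simp add: power_add)
  also have "\<dots> \<le> 2 ^ (4 * big)"
  proof (rule power_increasing)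
    have "q * dd \<le> big" "q * (ww + 1) \<le> big" using sq_le_big[OF le_refl dd_le] sq_le_big[OF le_refl ww_le] by linarith+
    then show "hn + 1 + q * dd + q + q * (ww + 1) \<le> 4 * big" using hn_le q_le_big q20 by linarith
  qed simp
  finally have "NN * (q + 1) * big \<le> 2 ^ (4 * big)" .
  moreover have "3 + 2 * x < 2 ^ 3 * y" if "x \<le> y" "y \<ge> 1" for x y :: nat using that by simp
  moreover have "(1::nat) \<le> 2 ^ (4 * big)" by simp
  ultimately have "3 + 2 * (NN * (q + 1) * big) < 2 ^ 3 * 2 ^ (4 * big)" by blast
  also have "\<dots> = 2 ^ (3 + 4 * big)" by (simp add: power_add)
  finally have "int (3 + 2 * (NN * (q + 1) * big)) < int (2 ^ (3 + 4 * big))" by (simp only: of_nat_less_iff)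
  then have "bits (int (3 + 2 * (NN * (q + 1) * big))) \<le> Suc (3 + 4 * big)"
    unfolding bits_le_Suc_iff by simp
  also have "\<dots> \<le> YY" using q_le_big q20 by (simp add: YY_def)
  finally show ?thesis .
qed

lemma protocol_F: 
  assumes F: "is_kcnf k n F"
  shows "protocol n k F h q hn"
proof
  show "length F < q"
  proof -
    have "length F \<le> (2 * n + 1) ^ k" by (rule card_clauses[OF F])
    also have "\<dots> \<le> (2 * n + 2) ^ k" by (rule power_mono) auto
    also have "\<dots> \<le> (2 * n + 2) ^ (2 * k)" by (rule power_increasing) auto
    finally have "(4 * k + 8) * length F < q" by (rule power_le_bound)
    then show ?thesis using k3 by (simp add: algebra_simps)
  qed
  show "h ^ k < q" using ee_less unfolding ee_def by (simp add: algebra_simps)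
qed (use k3 h_pos q_prime F in \<open>auto simp: hn_def\<close>)

lemma exprs_F:
  assumes F: "is_kcnf k n F"
  shows "exprs n k F h q hn c YY (snd (initial (encode_cnf n F)) 0)"
proof -
  interpret protocol n k F h q hn by (rule protocol_F[OF F])
  have e: "E = ee" "w = ww" "d = dd" "ncols = big"
    by (simp_all add: E_def ee_def w_def W_def ww_def d_def dd_def big_def ncols_def)
  have mq: "m < q" using Fq by (simp add: m_def)
  show ?thesis
  proof unfold_locales
    show "2 + m * (k + 1) \<le> YY"
      using sq_le_big[of m "k + 1"] mq k_less q_le_big q20 unfolding YY_def by linarith
    show "n + 2 * h \<le> YY"
    proof -
      have "n \<le> (4 * k + 8) * (2 * n + 2)" "h \<le> (4 * k + 8) * h" by (auto simp: algebra_simps)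
      then show ?thesis using n_less h_less q_le_big unfolding YY_def by linarith
    qed
    show "2 * (bound k c n)\<^sup>2 + 2 \<le> YY"
      using sq_le_big[of "bound k c n" "bound k c n"] bound_less_q q_le_big q20 unfolding YY_def power2_eq_square by linarith
    show "E \<le> YY" using ee_less q_le_big unfolding YY_def e by (simp add: algebra_simps)
    show "d \<le> YY" "w + 1 \<le> YY" "ncols \<le> YY" "hn \<le> YY" "2 * k \<le> YY" "4 \<le> YY"
      unfolding e YY_def using q_le_big q20 k_less hn_le dd_le ww_le by linarith+
  qed (rule c1 h_def q_def hn_def refl)+
qed

end

section \<open>Growth of the parameters\<close>

text \<open>Otherwise all exponents 0, ..., \<open>ell n\<close> would be counted by
  \<open>ell n\<close>, which is one too many.\<close>

lemma less_power_ell: "n < 2 ^ ell n"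
proof (rule ccontr)
  assume "\<not> n < 2 ^ ell n"
  then have le: "2 ^ ell n \<le> n" by simp
  have s: "i < n \<and> 2 ^ i \<le> n" if "i \<le> ell n" for i
  proof -
    have "(2::nat) ^ i \<le> 2 ^ ell n" using that by (rule power_increasing) simp
    then have "2 ^ i \<le> n" using le by linarith
    then show ?thesis using less_exp[of i] by linarith
  qed
  have "Suc (ell n) = (\<Sum>i<Suc (ell n). 1)" by simp
  also have "\<dots> = (\<Sum>i<Suc (ell n). of_bool (2 ^ i \<le> n))"
    by (rule sum.cong[OF refl]) (use s in \<open>simp add: less_Suc_eq_le\<close>)
  also have "\<dots> \<le> (\<Sum>i<n. of_bool (2 ^ i \<le> n))" by (rule sum_mono2) (use s[of "ell n"] in \<open>auto simp: less_Suc_eq_le Suc_le_eq\<close>)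
  finally show False by (simp add: ell_def)
qed

lemma power_ell_le:
  assumes "n \<ge> 1"
  shows "2 ^ ell n \<le> 2 * n"
proof (cases "ell n")
  case (Suc l)
  have "2 ^ l \<le> n"
  proof (rule ccontr)
    assume "\<not> 2 ^ l \<le> n"
    then have "(2::nat) ^ i < 2 ^ l" if "2 ^ i \<le> n" for i using that by linarith
    then have "i < l" if "2 ^ i \<le> n" for i
      using that power_strict_increasing_iff[of "2::nat" i l] by auto
    then have "ell n \<le> (\<Sum>i<n. of_bool (i < l))" unfolding ell_def by (intro sum_mono) auto
    also have "\<dots> = card {i. i < n \<and> i < l}" by (simp add: of_bool_def sum.If_cases Int_def)
    also have "\<dots> \<le> card {..<l}" by (intro card_mono) auto
    finally show False using Suc by simp
  qed
  then show ?thesis using Suc by simp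
qed (use assms in simp)

text \<open>An upper o(n) bound. The additive constant absorbs small \<open>n\<close>, so the
  estimates hold everywhere and not just eventually.\<close>

definition sublinear :: "(nat \<Rightarrow> real) \<Rightarrow> bool" where
  "sublinear f \<longleftrightarrow> (\<forall>\<gamma>>0. \<exists>C. \<forall>n. f n \<le> \<gamma> * real n + C)"

lemma sublinear_add:
  assumes "sublinear f" "sublinear g"
  shows "sublinear (\<lambda>n. f n + g n)"
  unfolding sublinear_def
proof (intro allI impI)
  fix \<gamma> :: real assume "\<gamma> > 0"
  then obtain C D where "\<forall>n. f n \<le> \<gamma> / 2 * real n + C" "\<forall>n. g n \<le> \<gamma> / 2 * real n + D"
    using assms unfolding sublinear_def by (meson half_gt_zero)
  then have "f n + g n \<le> \<gamma> * real n + (C + D)" for n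
    using add_mono[of "f n" "\<gamma> / 2 * real n + C" "g n" "\<gamma> / 2 * real n + D"] by (simp add: field_simps)
  then show "\<exists>C. \<forall>n. f n + g n \<le> \<gamma> * real n + C" by blast
qed

lemma sublinear_cmult:
  assumes "sublinear f" "c > 0"
  shows "sublinear (\<lambda>n. c * f n)"
  unfolding sublinear_def
proof (intro allI impI)
  fix \<gamma> :: real assume "\<gamma> > 0"
  then have "\<gamma> / c > 0" using assms by simp
  then obtain C where C: "\<forall>n. f n \<le> \<gamma> / c * real n + C"
    using assms unfolding sublinear_def by blast
  have "c * f n \<le> \<gamma> * real n + c * C" for n
  proof -
    have "c * f n \<le> c * (\<gamma> / c * real n + C)" using C assms(2) by (intro mult_left_mono) auto
    also have "\<dots> = \<gamma> * real n + c * C" using assms(2) by (simp add: distrib_left)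
    finally show ?thesis .
  qed
  then show "\<exists>C. \<forall>n. c * f n \<le> \<gamma> * real n + C" by blast
qed

lemma eventually_le_imp_le_add:
  fixes f g :: "nat \<Rightarrow> real"
  assumes "eventually (\<lambda>n. f n \<le> g n) sequentially" "\<And>n. g n \<ge> 0"
  shows "\<exists>C. \<forall>n. f n \<le> g n + C"
proof -
  obtain N where N: "\<And>n. n \<ge> N \<Longrightarrow> f n \<le> g n" using assms(1) by (auto simp: eventually_sequentially)
  have "f n \<le> g n + (\<Sum>i<N. \<bar>f i\<bar>)" for n
  proof (cases "n < N")
    case True
    then have "\<bar>f n\<bar> \<le> (\<Sum>i<N. \<bar>f i\<bar>)" by (intro member_le_sum) auto
    then show ?thesis using assms(2)[of n] by linarith
  next
    case False
    have "0 \<le> (\<Sum>i<N. \<bar>f i\<bar>)" by (intro sum_nonneg) auto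
    then show ?thesis using N[of n] False by linarith
  qed
  then show ?thesis by blast
qed

lemma power_le_exp2:
  assumes "\<gamma> > 0"
  shows "\<exists>C. \<forall>x::nat. real x ^ p \<le> \<gamma> * 2 ^ x + C"
proof (rule eventually_le_imp_le_add)
  have "(\<lambda>x::nat. real x ^ p / 2 ^ x) \<longlonglongrightarrow> 0" by real_asymp
  then have "eventually (\<lambda>x. real x ^ p / 2 ^ x < \<gamma>) sequentially"
    using assms by (rule order_tendstoD)
  then show "eventually (\<lambda>x. real x ^ p \<le> \<gamma> * 2 ^ x) sequentially"
    by eventually_elim (simp add: divide_simps mult_ac)
qed (use assms in simp)

text \<open>With x = ell n + 1, a power of x is eventually below any multiple of 2^x, and 2^x is at
  most 4 n.\<close>

lemma sublinear_ell_power: "sublinear (\<lambda>n. real (ell n + 1) ^ p)"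
  unfolding sublinear_def
proof (intro allI impI)
  fix \<gamma> :: real assume \<gamma>: "\<gamma> > 0"
  then obtain C where C: "\<And>x::nat. real x ^ p \<le> \<gamma> / 4 * 2 ^ x + C" using power_le_exp2[of "\<gamma> / 4" p] by auto
  have "real (ell n + 1) ^ p \<le> \<gamma> * real n + (\<bar>C\<bar> + 1)" for n
  proof (cases "n = 0")
    case True
    then show ?thesis by (simp add: ell_def)
  next
    case False
    then have "(2::nat) ^ (ell n + 1) \<le> 4 * n" using power_ell_le[of n] by simp
    then have "real (2 ^ (ell n + 1)) \<le> real (4 * n)" by (simp only: of_nat_le_iff)
    then have "\<gamma> / 4 * 2 ^ (ell n + 1) \<le> \<gamma> / 4 * (4 * real n)" using \<gamma> by (intro mult_left_mono) auto
    then show ?thesis using C[of "ell n + 1"] by simp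
  qed
  then show "\<exists>C. \<forall>n. real (ell n + 1) ^ p \<le> \<gamma> * real n + C" by blast
qed

text \<open>Either the logarithm has reached 1 / \<gamma>, or \<open>n\<close> itself is
  bounded.\<close>

lemma sublinear_div_ell: "sublinear (\<lambda>n. real n / real (ell n + 1))"
  unfolding sublinear_def
proof (intro allI impI)
  fix \<gamma> :: real assume \<gamma>: "\<gamma> > 0"
  have "real n / real (ell n + 1) \<le> \<gamma> * real n + 2 ^ nat \<lceil>1 / \<gamma>\<rceil>" for n
  proof (cases "1 / \<gamma> \<le> real (ell n + 1)")
    case True
    then have "1 / real (ell n + 1) \<le> \<gamma>" using \<gamma> by (simp add: field_simps)
    then have "real n * (1 / real (ell n + 1)) \<le> real n * \<gamma>" by (intro mult_left_mono) auto
    then show ?thesis by (simp add: mult.commute add_increasing2)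
  next
    case False
    then have "ell n \<le> nat \<lceil>1 / \<gamma>\<rceil>" by linarith
    then have "(2::real) ^ ell n \<le> 2 ^ nat \<lceil>1 / \<gamma>\<rceil>" by (intro power_increasing) auto
    moreover have "real n < real (2 ^ ell n)" using less_power_ell by (simp only: of_nat_less_iff)
    moreover have "real n / real (ell n + 1) \<le> real n" by (simp add: divide_le_eq mult_le_cancel_left1)
    moreover have "0 \<le> \<gamma> * real n" using \<gamma> by simp
    ultimately show ?thesis unfolding of_nat_power of_nat_numeral by linarith
  qed
  then show "\<exists>C. \<forall>n. real n / real (ell n + 1) \<le> \<gamma> * real n + C" by blast
qed

definition subexponential :: "(nat \<Rightarrow> nat) \<Rightarrow> bool" where
  "subexponential f \<longleftrightarrow> (\<forall>\<gamma>>0. \<exists>C>0. \<forall>n. real (f n) \<le> C * 2 powr (\<gamma> * real n))"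

lemma subexponentialD:
  assumes "subexponential f" "\<gamma> > 0"
  obtains C where "C > 0" "\<And>n. real (f n) \<le> C * 2 powr (\<gamma> * real n)"
  using assms unfolding subexponential_def by blast

lemma subexponential_mult:
  assumes "subexponential f" "subexponential g"
  shows "subexponential (\<lambda>n. f n * g n)"
  unfolding subexponential_def
proof (intro allI impI)
  fix \<gamma> :: real assume "\<gamma> > 0"
  then have \<gamma>: "\<gamma> / 2 > 0" by simp
  obtain C where C: "C > 0" "\<And>n. real (f n) \<le> C * 2 powr (\<gamma> / 2 * real n)" by (rule subexponentialD[OF assms(1) \<gamma>]) blast
  obtain D where D: "D > 0" "\<And>n. real (g n) \<le> D * 2 powr (\<gamma> / 2 * real n)" by (rule subexponentialD[OF assms(2) \<gamma>]) blast
  have "real (f n * g n) \<le> (C * D) * 2 powr (\<gamma> * real n)" for n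
  proof -
    have "real (f n) * real (g n) \<le> (C * 2 powr (\<gamma> / 2 * real n)) * (D * 2 powr (\<gamma> / 2 * real n))"
      using C D by (intro mult_mono) auto
    also have "\<dots> = C * D * (2 powr (\<gamma> / 2 * real n) * 2 powr (\<gamma> / 2 * real n))" by simp
    also have "2 powr (\<gamma> / 2 * real n) * 2 powr (\<gamma> / 2 * real n) = 2 powr (\<gamma> * real n)"
      unfolding powr_add[symmetric] by simp
    finally show ?thesis by simp
  qed
  then show "\<exists>C>0. \<forall>n. real (f n * g n) \<le> C * 2 powr (\<gamma> * real n)" using C(1) D(1) by (intro exI[of _ "C * D"]) auto
qed

lemma subexponential_const: "subexponential (\<lambda>_. c)"
  unfolding subexponential_def
proof (intro allI impI)
  fix \<gamma> :: real assume "\<gamma> > 0"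
  have "real c \<le> (real c + 1) * 2 powr (\<gamma> * real n)" for n
  proof -
    have "1 \<le> 2 powr (\<gamma> * real n)" using \<open>\<gamma> > 0\<close> by (intro ge_one_powr_ge_zero) auto
    then have "(real c + 1) * 1 \<le> (real c + 1) * 2 powr (\<gamma> * real n)" by (intro mult_left_mono) auto
    then show ?thesis by (rule order_trans[rotated]) simp
  qed
  then show "\<exists>C>0. \<forall>n::nat. real c \<le> C * 2 powr (\<gamma> * real n)" by (intro exI[of _ "real c + 1"]) auto
qed

lemma subexponential_power: "subexponential f \<Longrightarrow> subexponential (\<lambda>n. f n ^ p)"
  by (induction p) (auto intro: subexponential_mult subexponential_const[of 1, simplified])

lemma subexponential_exp2:
  assumes "sublinear e" "\<And>n. real (f n) \<le> 2 powr e n"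
  shows "subexponential f"
  unfolding subexponential_def
proof (intro allI impI)
  fix \<gamma> :: real assume "\<gamma> > 0"
  then obtain C where C: "\<And>n. e n \<le> \<gamma> * real n + C" using assms(1) unfolding sublinear_def by blast
  have "real (f n) \<le> 2 powr C * 2 powr (\<gamma> * real n)" for n
  proof -
    have "2 powr e n \<le> 2 powr (C + \<gamma> * real n)" using C[of n] by (intro powr_mono) auto
    then show ?thesis using assms(2)[of n] by (simp add: powr_add)
  qed
  then show "\<exists>C>0. \<forall>n. real (f n) \<le> C * 2 powr (\<gamma> * real n)" by (intro exI[of _ "2 powr C"]) auto
qed

context params begin

lemma q_le_exp: "q \<le> 2 ^ ((3 * c\<^sup>2 + 4 * k) * (ell n + 1))"
proof -
  have b: "bound k c n \<ge> 1" using c1 by (simp add: bound_def Suc_le_eq)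
  have "n + 1 \<le> 2 ^ ell n" using less_power_ell[of n] by simp
  then have "2 * n + 2 \<le> 2 ^ (ell n + 1)" by simp
  then have "(2 * n + 2) ^ (4 * k) \<le> (2 ^ (ell n + 1)) ^ (4 * k)" by (rule power_mono) simp
  also have "\<dots> = 2 ^ (4 * k * (ell n + 1))" by (simp only: power_mult[symmetric] mult.commute)
  finally have 1: "(2 * n + 2) ^ (4 * k) \<le> 2 ^ (4 * k * (ell n + 1))" .
  have "2 * (bound k c n)\<^sup>2 + 1 \<le> 3 * (bound k c n)\<^sup>2" using b by (simp add: Suc_le_eq)
  then have "q \<le> 3 * (bound k c n)\<^sup>2" using q_le by linarith
  also have "\<dots> = 3 * c\<^sup>2 * (2 * n + 2) ^ (4 * k)" by (simp add: bound_def power_mult_distrib flip: power_mult)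
  also have "\<dots> \<le> 2 ^ (3 * c\<^sup>2) * 2 ^ (4 * k * (ell n + 1))"
    by (intro mult_mono 1 less_imp_le[OF less_exp]) auto
  also have "\<dots> = 2 ^ (3 * c\<^sup>2 + 4 * k * (ell n + 1))" by (simp add: power_add)
  also have "\<dots> \<le> 2 ^ ((3 * c\<^sup>2 + 4 * k) * (ell n + 1))" by (intro power_increasing) (auto simp: algebra_simps)
  finally show ?thesis .
qed

text \<open>With x = ell n + 1, log q is O(x) and the exponent of \<open>q\<close> is d + w + 1,
  where d is about (k + 1) x^(2 k) and w about k n / x^2. The product leaves n / x, thanks to the
  square in \<open>base\<close>.\<close>

lemma GG_le:
  "real GG \<le> 2 powr (real (3 * c\<^sup>2 + 4 * k) * (real (k + 1) * real (ell n + 1) ^ (2 * k + 1) +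
     (real (k + 2) * real (ell n + 1) ^ 1 + real k * (real n / real (ell n + 1)))))"
proof -
  let ?x = "ell n + 1" and ?A = "3 * c\<^sup>2 + 4 * k"
  have "GG = q ^ (dd + (ww + 1))" unfolding GG_def big_def by (simp add: power_add)
  also have "\<dots> \<le> (2 ^ (?A * ?x)) ^ (dd + (ww + 1))" by (rule power_mono[OF q_le_exp]) simp
  also have "\<dots> = 2 ^ (?A * ?x * (dd + (ww + 1)))" by (simp only: power_mult)
  finally have "real GG \<le> real (2 ^ (?A * ?x * (dd + (ww + 1))))" by (simp only: of_nat_le_iff)
  also have "\<dots> = 2 powr real (?A * ?x * (dd + (ww + 1)))" by (subst powr_realpow) auto
  also have "\<dots> \<le> 2 powr (real ?A * (real (k + 1) * real ?x ^ (2 * k + 1) +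
     (real (k + 2) * real ?x ^ 1 + real k * (real n / real ?x))))"
  proof (rule powr_mono)
    have d: "real dd = real (k + 1) * real ?x ^ (2 * k) + 1"
      by (simp add: dd_def ee_def h_def base_def algebra_simps flip: power_mult)
    have "real (n div h) \<le> real n / real h" 
      using of_int_floor_le[of "real n / real h"] by (simp add: floor_divide_of_nat_eq)
    also have "real h = real ?x * real ?x" by (simp add: h_def base_def power2_eq_square algebra_simps)
    finally have "real ?x * real (n div h) \<le> real ?x * (real n / (real ?x * real ?x))" by (intro mult_left_mono) auto
    also have "\<dots> = real n / real ?x" by simp
    finally have w: "real ?x * real (n div h) \<le> real n / real ?x" .
    have "real ?x * (real dd + (real ww + 1)) = real (k + 1) * (real ?x ^ (2 * k) * real ?x) + (real (k + 2) * real ?x + real k * (real ?x * real (n div h)))"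
      unfolding d by (simp add: ww_def algebra_simps)
    also have "\<dots> \<le> real (k + 1) * real ?x ^ (2 * k + 1) + (real (k + 2) * real ?x ^ 1 + real k * (real n / real ?x))"
      using w by (intro add_mono mult_left_mono) auto
    finally show "real (?A * ?x * (dd + (ww + 1))) \<le> real ?A * (real (k + 1) * real ?x ^ (2 * k + 1) +
     (real (k + 2) * real ?x ^ 1 + real k * (real n / real ?x)))"
      unfolding of_nat_mult mult.assoc of_nat_add[of dd] of_nat_add[of ww] of_nat_1 by (intro mult_left_mono) auto
  qed simp
  finally show ?thesis .
qed

end

lemma subexponential_GG:
  assumes "k \<ge> 3" "c \<ge> 4 * k + 8"
  shows "subexponential (params.GG k c)"
proof (rule subexponential_exp2)
  show "sublinear (\<lambda>n. real (3 * c\<^sup>2 + 4 * k) * (real (k + 1) * real (ell n + 1) ^ (2 * k + 1) +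
     (real (k + 2) * real (ell n + 1) ^ 1 + real k * (real n / real (ell n + 1)))))"
    by (intro sublinear_add sublinear_cmult sublinear_ell_power sublinear_div_ell)
      (use assms in \<open>auto intro: add_nonneg_pos\<close>)
  show "real (params.GG k c n) \<le> 2 powr (real (3 * c\<^sup>2 + 4 * k) * (real (k + 1) * real (ell n + 1) ^ (2 * k + 1) +
     (real (k + 2) * real (ell n + 1) ^ 1 + real k * (real n / real (ell n + 1)))))" for n
    by (rule params.GG_le) (use assms in \<open>simp add: params_def\<close>)
qed

section \<open>The reduction\<close>

context params begin

lemma GG_bounds: "q \<le> GG" "big \<le> GG" "q ^ dd \<le> GG" "1 \<le> GG"
proof -
  have p: "1 \<le> q ^ dd" "1 \<le> big" using q20 by (simp_all add: big_def)
  then show b: "big \<le> GG" "q ^ dd \<le> GG" by (simp_all add: GG_def)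
  have "q \<le> big" using q_le_big by linarith
  then show "q \<le> GG" using b by linarith
  then show "1 \<le> GG" using q20 by linarith
qed

lemma ee_le: "c * ee \<le> bound k c n"
proof -
  have "ee \<le> ((2 * n + 2) ^ 2) ^ k" unfolding ee_def by (rule power_mono[OF h_le]) simp
  then have "ee \<le> (2 * n + 2) ^ (2 * k)" by (simp add: power_mult)
  then show ?thesis unfolding bound_def by (rule mult_le_mono2)
qed

text \<open>The terms beside \<open>q\<close> add up to at most (3 k + 7) E, and \<open>q\<close>
  exceeds c E. So they stay below q (4 / (2 - \<delta>)^2 - 1) once \<open>c\<close> is
  large.\<close>

lemma gap:
  assumes "\<delta> > 0" "2 - \<delta> \<ge> 1" "real (3 * k + 7) < real c * (4 / (2 - \<delta>)\<^sup>2 - 1)"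
  shows "real (q + 1 + 3 * ((k + 2) * ee)) * (2 - \<delta>)\<^sup>2 < 4 * real q"
proof -
  let ?\<mu> = "4 / (2 - \<delta>)\<^sup>2 - 1"
  have p: "(2 - \<delta>)\<^sup>2 > 0" using assms by simp
  have c0: "real c > 0" using c1 by simp
  have "0 < real c * ?\<mu>" using assms(3) by (rule le_less_trans[rotated]) simp
  then have \<mu>: "?\<mu> > 0" using c0 by (simp add: zero_less_mult_iff)
  have "real (1 + 3 * ((k + 2) * ee)) \<le> real ((3 * k + 7) * ee)"
    using ee_pos by (simp only: of_nat_le_iff) (simp add: algebra_simps)
  also have "\<dots> = real (3 * k + 7) * real ee" by (rule of_nat_mult)
  also have "\<dots> \<le> real c * ?\<mu> * real ee" using assms(3) by (intro mult_right_mono) auto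
  also have "\<dots> = ?\<mu> * real (c * ee)" by simp
  also have "\<dots> < ?\<mu> * real q"
  proof (rule mult_strict_left_mono[OF _ \<mu>])
    have "c * ee < q" using ee_le bound_less_q by linarith
    then show "real (c * ee) < real q" by (simp only: of_nat_less_iff)
  qed
  finally have "real (q + 1 + 3 * ((k + 2) * ee)) < real q * (4 / (2 - \<delta>)\<^sup>2)" by (simp add: algebra_simps)
  then have "real (q + 1 + 3 * ((k + 2) * ee)) * (2 - \<delta>)\<^sup>2 < real q * (4 / (2 - \<delta>)\<^sup>2) * (2 - \<delta>)\<^sup>2"
    using p by (rule mult_strict_right_mono)
  then show ?thesis using p by simp
qed

lemma bits_input:
  assumes "is_kcnf k n F"
  shows "bits (snd (initial (encode_cnf n F)) 0 a) \<le> YY"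
proof -
  interpret protocol n k F h q hn by (rule protocol_F[OF assms])
  have q: "n \<le> q" "k \<le> q" using n_less k_less by (auto simp: algebra_simps)
  have "\<bar>x\<bar> \<le> int q" if "x \<in> set (encode_cnf n F)" for x
  proof -
    have "x = int n \<or> x = int (length F) \<or> (\<exists>c\<in>set F. x = int (length c) \<or> x \<in> set c)"
      using that by (auto simp: encode_cnf_def)
    then show ?thesis
    proof (elim disjE bexE)
      fix c assume "c \<in> set F" "x = int (length c)"
      then show ?thesis using assms q(2) by (fastforce simp: is_kcnf_def)
    next
      fix c assume "c \<in> set F" "x \<in> set c"
      then have "\<bar>x\<bar> \<le> int n" using assms unfolding is_kcnf_def by blast
      then show ?thesis using q by linarith
    qed (use q Fq in auto)
  qed
  then have "\<bar>snd (initial (encode_cnf n F)) 0 a\<bar> \<le> \<bar>int q\<bar>"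
    by (auto simp: initial_def)
  then have "bits (snd (initial (encode_cnf n F)) 0 a) \<le> bits (int q)" by (rule bits_mono)
  also have "\<dots> \<le> q" by (rule bits_nat_le) (use q20 in auto)
  finally show ?thesis using q_le_big by (simp add: YY_def)
qed

lemma time_bound:
  assumes m: "m < q" and t: "t \<le> (2 * (3 + m * (k + 1)) + (3 + 2 * (NN * (q + 1) * big) + 1)) * YY ^ (cc + 3) + 100 * (tP + YY ^ cc)"
  shows "t \<le> 2 ^ hn * (200 * (16 * GG) ^ (cc + 6)) + 100 * tP"
proof -
  have Y: "YY \<le> 16 * GG" using GG_bounds by (simp add: YY_def)
  have NN: "NN \<le> 2 * (2 ^ hn * GG)"
  proof -
    have "2 ^ hn * q ^ dd \<le> 2 ^ hn * GG" "2 ^ hn * 1 \<le> 2 ^ hn * GG" using GG_bounds by (intro mult_left_mono; simp)+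
    then show ?thesis unfolding NN_def by linarith
  qed
  have "NN * (q + 1) * big \<le> 2 * (2 ^ hn * GG) * (2 * GG) * GG"
    by (intro mult_mono NN) (use GG_bounds in auto)
  also have "\<dots> = 4 * (2 ^ hn * GG ^ 3)" by (simp add: power3_eq_cube)
  finally have a: "NN * (q + 1) * big \<le> 4 * (2 ^ hn * GG ^ 3)" .
  have G3: "GG \<le> GG ^ 3" using GG_bounds by (intro self_le_power) auto
  have X: "GG ^ 3 \<le> 2 ^ hn * GG ^ 3" by simp
  have "m * (k + 1) \<le> big" using sq_le_big[of m "k + 1"] m k_less by linarith
  then have b: "m * (k + 1) \<le> 2 ^ hn * GG ^ 3" using GG_bounds(2) G3 X by linarith
  have "2 * (3 + m * (k + 1)) + (3 + 2 * (NN * (q + 1) * big) + 1) \<le> 20 * (2 ^ hn * GG ^ 3)"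
  proof -
    have "2 * (3 + u) + (3 + 2 * v + 1) \<le> 20 * x" if "v \<le> 4 * x" "u \<le> x" "1 \<le> x" for u v x :: nat
    proof -
      have "2 * (3 + u) + (3 + 2 * v + 1) = 10 + 2 * u + 2 * v" by simp
      then show ?thesis using that by linarith
    qed
    from this[OF a b] show ?thesis using GG_bounds(4) G3 X by linarith
  qed
  then have "(2 * (3 + m * (k + 1)) + (3 + 2 * (NN * (q + 1) * big) + 1)) * YY ^ (cc + 3) \<le> 20 * (2 ^ hn * GG ^ 3) * (16 * GG) ^ (cc + 3)"
    by (intro mult_mono power_mono Y) auto
  also have "\<dots> \<le> 20 * (2 ^ hn * (16 * GG) ^ 3) * (16 * GG) ^ (cc + 3)"
    by (intro mult_right_mono mult_left_mono power_mono) auto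
  also have "\<dots> = 2 ^ hn * (20 * (16 * GG) ^ (cc + 6))"
  proof -
    have "Z ^ (cc + 6) = Z ^ 3 * Z ^ (cc + 3)" for Z :: nat
      unfolding power_add[symmetric] by (rule arg_cong[where f = "power Z"]) simp
    then show ?thesis by (simp only: mult_ac)
  qed
  finally have c: "(2 * (3 + m * (k + 1)) + (3 + 2 * (NN * (q + 1) * big) + 1)) * YY ^ (cc + 3) \<le> 2 ^ hn * (20 * (16 * GG) ^ (cc + 6))" .
  have "YY ^ cc \<le> (16 * GG) ^ cc" by (rule power_mono[OF Y]) simp
  also have "\<dots> \<le> (16 * GG) ^ (cc + 6)" using GG_bounds by (intro power_increasing) auto
  also have "\<dots> \<le> 2 ^ hn * (16 * GG) ^ (cc + 6)" by simp
  finally have "YY ^ cc \<le> 2 ^ hn * (16 * GG) ^ (cc + 6)" .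
  then show ?thesis using t c by (simp add: algebra_simps)
qed

lemma algorithm_correct:
  assumes F: "is_kcnf k n F" and P: "diameter_approximation (2 - \<delta>) P" and \<delta>: "\<delta> > 0"
    and c\<mu>: "real (3 * k + 7) < real c * (4 / (2 - \<delta>)\<^sup>2 - 1)"
    and K: "below K P" "K \<ge> 2"
    and cc: "\<And>e. e \<in> {inlenE k, outlenE k c, outE k c, thresholdE k c, Inp (Var 0), Lit 0} \<Longrightarrow> comp_spec e cc"
  obtains t R tP RP d2 dinf xs where "runs (algorithm k c P K) (encode_cnf n F) t R" "R 0 \<noteq> 0 \<longleftrightarrow> satisfiable F"
    "is_instance d2 dinf xs" "length xs = NN" "\<And>x. x \<in> set xs \<Longrightarrow> vector_bits x \<le> 8 * GG\<^sup>2"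
    "runs P (encode_instance d2 dinf xs) tP RP"
    "t \<le> 2 ^ hn * (200 * (16 * GG) ^ (cc + 6)) + 100 * tP"
proof -
  interpret exprs n k F h q hn c YY "snd (initial (encode_cnf n F)) 0" by (rule exprs_F[OF F])
  have e: "E = ee" "w = ww" "d = dd" "ncols = big"
    by (simp_all add: E_def ee_def w_def W_def ww_def d_def dd_def big_def ncols_def)
  have N: "N = NN" by (simp add: N_def NA_def NB_def NN_def e)
  have o: "outlen = 3 + 2 * (NN * (q + 1) * big)" by (simp add: outlen_def N e)
  have ge1: "2 - \<delta> \<ge> 1" using P by (simp add: diameter_approximation_def)
  obtain t R tP RP where tR: "runs (algorithm k c P K) (encode_cnf n F) t R" "R 0 \<noteq> 0 \<longleftrightarrow> satisfiable F"
    "runs P (encode_instance (q + 1) ncols pts) tP RP"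
    "t \<le> (2 * (3 + m * (k + 1)) + (outlen + 1)) * YY ^ (cc + 3) + 100 * (tP + YY ^ cc)"
  proof (rule runs_algorithm[OF P \<delta> K cc])
    show "bits (int outlen) \<le> YY" unfolding o by (rule bits_out)
    show "N \<le> 2 ^ ncols" unfolding N e by (rule NN_le_pow)
    show "real (q + 1 + 3 * ((k + 2) * E)) * (2 - \<delta>)\<^sup>2 < 4 * real q" unfolding e by (rule gap[OF \<delta> ge1 c\<mu>])
  qed (use bits_input[OF F] in auto)
  show ?thesis
  proof (rule that[OF tR(1,2) _ _ _ tR(3)])
    show "is_instance (q + 1) ncols pts" by (rule is_instance_pts) (unfold N e, rule NN_le_pow)
    show "length pts = NN" by (simp add: length_pts N)
    have "(q + 1) * big \<le> (2 * GG) * GG" using GG_bounds by (intro mult_mono) auto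
    then show "vector_bits x \<le> 8 * GG\<^sup>2" if "x \<in> set pts" for x
      using vector_bits_pts[OF that] unfolding e power2_eq_square by simp
    have "m < q" using Fq by (simp add: m_def)
    then show "t \<le> 2 ^ hn * (200 * (16 * GG) ^ (cc + 6)) + 100 * tP"
      by (rule time_bound) (use tR(4) o in simp)
  qed
qed

lemma NN_ge: "2 ^ hn \<le> NN" and NN_le_GG: "NN \<le> 2 ^ hn * (2 * GG)"
proof -
  show "2 ^ hn \<le> NN" by (simp add: NN_def)
  have "2 ^ hn * q ^ dd \<le> 2 ^ hn * GG" "2 ^ hn * 1 \<le> 2 ^ hn * GG" using GG_bounds by (intro mult_left_mono; simp)+
  moreover have "2 ^ hn * (2 * GG) = 2 ^ hn * GG + 2 ^ hn * GG" by simp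
  ultimately show "NN \<le> 2 ^ hn * (2 * GG)" unfolding NN_def by linarith
qed

end

text \<open>
  The bound on the vector size must be a function of the number \<open>N\<close> of vectors, which is at least
  \<open>2\<^bsup>n/2\<^esup>\<close>.
\<close>

definition vector_size :: "nat \<Rightarrow> nat \<Rightarrow> nat \<Rightarrow> nat" where
  "vector_size k c N = Max ((\<lambda>n. 8 * (params.GG k c n)\<^sup>2) ` {..2 * floorlog 2 N})"

lemma subpolynomial_vector_size:
  assumes "k \<ge> 3" "c \<ge> 4 * k + 8"
  shows "subpolynomial (vector_size k c)"
  unfolding subpolynomial_def
proof (intro allI impI)
  fix \<gamma> :: real assume \<gamma>: "\<gamma> > 0"
  have "subexponential (\<lambda>n. 8 * (params.GG k c n)\<^sup>2)"
    by (intro subexponential_mult subexponential_const subexponential_power subexponential_GG assms)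
  \<comment> \<open>Half of \<gamma>, since \<open>n\<close> ranges up to twice the logarithm of
    \<open>N\<close>.\<close>
  then obtain C where C: "C > 0" "\<And>n. real (8 * (params.GG k c n)\<^sup>2) \<le> C * 2 powr (\<gamma> / 2 * real n)"
    using \<gamma> by (rule_tac subexponentialD[of _ "\<gamma> / 2"]) auto
  have "real (vector_size k c N) \<le> C * 2 powr \<gamma> * (real N powr \<gamma>)" if N: "N \<ge> 1" for N
  proof -
    have "vector_size k c N \<in> (\<lambda>n. 8 * (params.GG k c n)\<^sup>2) ` {..2 * floorlog 2 N}"
      unfolding vector_size_def by (rule Max_in) auto
    then obtain n where n: "n \<le> 2 * floorlog 2 N" "vector_size k c N = 8 * (params.GG k c n)\<^sup>2" by auto
    have "2 ^ (floorlog 2 N - 1) \<le> N" using floorlog_bounds[of N 2] N by simp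
    moreover have "floorlog 2 N \<ge> 1" using N floorlog_eq_zero_iff[of 2 N] by linarith
    then have "(2::nat) ^ floorlog 2 N = 2 * 2 ^ (floorlog 2 N - 1)" by (metis power_Suc Suc_diff_1 One_nat_def Suc_le_lessD)
    ultimately have "2 ^ floorlog 2 N \<le> 2 * N" by simp
    then have l: "2 powr real (floorlog 2 N) \<le> 2 * real N"
      by (subst powr_realpow) (simp, metis of_nat_le_iff of_nat_mult of_nat_numeral of_nat_power)
    have "real (vector_size k c N) \<le> C * 2 powr (\<gamma> / 2 * real n)" unfolding n(2) by (rule C(2))
    also have "\<dots> \<le> C * 2 powr (\<gamma> * real (floorlog 2 N))"
      using n(1) \<gamma> C(1) by (intro mult_left_mono powr_mono) (auto simp: field_simps)
    also have "2 powr (\<gamma> * real (floorlog 2 N)) = (2 powr real (floorlog 2 N)) powr \<gamma>"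
      by (simp add: powr_powr mult.commute)
    also have "C * \<dots> \<le> C * (2 * real N) powr \<gamma>"
      using l \<gamma> C(1) by (intro mult_left_mono powr_mono2) auto
    also have "(2 * real N) powr \<gamma> = 2 powr \<gamma> * real N powr \<gamma>" by (rule powr_mult)
    finally show ?thesis by simp
  qed
  then show "(\<lambda>N. real (vector_size k c N)) \<in> O(\<lambda>N. real N powr \<gamma>)"
    by (intro bigoI[of _ "C * 2 powr \<gamma>"] eventually_sequentiallyI[of 1]) auto
qed

lemma power_half_le: "real (2 ^ (n div 2 + 1)) \<le> 2 * 2 powr (real n / 2)"
proof -
  have "real (2 ^ (n div 2 + 1)) = 2 * 2 powr real (n div 2)" by (simp add: powr_realpow)
  also have "\<dots> \<le> 2 * 2 powr (real n / 2)" by (intro mult_left_mono powr_mono) auto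
  finally show ?thesis .
qed

lemma powr_diameter_bound:
  fixes \<epsilon> :: real
  assumes "0 < \<epsilon>" "\<epsilon> \<le> 1" "1 \<le> N" "real N \<le> real (2 ^ (n div 2 + 1)) * real G" "1 \<le> G"
  shows "real N powr (2 - \<epsilon>) \<le> 4 * real (G ^ 2) * 2 powr ((1 - \<epsilon> / 2) * real n)"
proof -
  have "real N \<le> (2 * real G) * 2 powr (real n / 2)"
    using assms(4) mult_right_mono[OF power_half_le[of n], of "real G"] by (simp add: mult_ac)
  then have "real N powr (2 - \<epsilon>) \<le> ((2 * real G) * 2 powr (real n / 2)) powr (2 - \<epsilon>)"
    using assms by (intro powr_mono2) auto
  also have "\<dots> = (2 * real G) powr (2 - \<epsilon>) * 2 powr (real n / 2 * (2 - \<epsilon>))"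
    by (simp add: powr_mult powr_powr)
  also have "\<dots> \<le> (2 * real G) powr 2 * 2 powr (real n / 2 * (2 - \<epsilon>))"
    using assms by (intro mult_right_mono powr_mono) auto
  also have "(2 * real G) powr 2 = 4 * real (G ^ 2)"
    using assms by (simp add: powr_numeral power_mult_distrib)
  also have "real n / 2 * (2 - \<epsilon>) = (1 - \<epsilon> / 2) * real n" by (simp add: field_simps)
  finally show ?thesis .
qed

text \<open>Time N^(2 - \<epsilon>) for N = 2^(n/2 + o(n)) means a saving of \<epsilon> / 2 in the
  exponent. Half of it is given up to absorb the subexponential factors, which leaves \<epsilon> /
  4.\<close>

lemma reduction_contradiction:
  fixes \<epsilon> \<delta> :: real
  assumes \<epsilon>: "0 < \<epsilon>" "\<epsilon> \<le> 1" and \<delta>: "\<delta> > 0" and k: "k \<ge> 3"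
    and P: "diameter_approximation (2 - \<delta>) P" "diameter_time P (\<lambda>N. real N powr (2 - \<epsilon>))"
  shows "\<exists>Q. solves_ksat k Q \<and> ksat_time k Q (\<lambda>n. 2 powr ((1 - \<epsilon> / 4) * real n))"
proof -
  have ge1: "2 - \<delta> \<ge> 1" using P by (simp add: diameter_approximation_def)
  have "(2 - \<delta>)\<^sup>2 < 2\<^sup>2" using ge1 \<delta> by (intro power_strict_mono) auto
  then have \<mu>: "4 / (2 - \<delta>)\<^sup>2 - 1 > 0" using ge1 by (simp add: field_simps)
  obtain c0 :: nat where c0: "real (3 * k + 7) / (4 / (2 - \<delta>)\<^sup>2 - 1) < real c0" using reals_Archimedean2 by blast
  define c where "c = c0 + 4 * k + 8"
  have "real (3 * k + 7) < real c0 * (4 / (2 - \<delta>)\<^sup>2 - 1)" using c0 \<mu> by (simp add: divide_less_eq)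
  also have "\<dots> \<le> real c * (4 / (2 - \<delta>)\<^sup>2 - 1)" using \<mu> by (intro mult_right_mono) (auto simp: c_def)
  finally have c\<mu>: "real (3 * k + 7) < real c * (4 / (2 - \<delta>)\<^sup>2 - 1)" .
  have ck: "c \<ge> 4 * k + 8" by (simp add: c_def)
  have par: "params k c" using k ck by (simp add: params_def)
  let ?G = "params.GG k c" and ?N = "params.NN k c"
  have hn: "params.hn n = n div 2 + 1" for n by (rule params.hn_def[OF par])
  obtain K0 where "below K0 P" using exists_below by blast
  then have K: "below (K0 + 2) P" "K0 + 2 \<ge> 2" by (auto intro: below_mono)
  let ?S = "{inlenE k, outlenE k c, outE k c, thresholdE k c, Inp (Var 0), Lit 0}"
  define cf where "cf e = (SOME c. comp_spec e c)" for e
  have cf: "comp_spec e (cf e)" for e unfolding cf_def using comp_spec_exists by (rule someI_ex)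
  define cc where "cc = (\<Sum>e\<in>?S. cf e)"
  have cc: "comp_spec e cc" if "e \<in> ?S" for e
  proof (rule comp_spec_mono[OF cf[of e]])
    show "cf e \<le> cc" unfolding cc_def by (rule member_le_sum) (use that in auto)
  qed
  let ?Q = "algorithm k c P (K0 + 2)"
  have run: "\<exists>t R tP RP d2 dinf xs. runs ?Q (encode_cnf n F) t R \<and> (R 0 \<noteq> 0 \<longleftrightarrow> satisfiable F) \<and>
      is_instance d2 dinf xs \<and> length xs = ?N n \<and> (\<forall>x\<in>set xs. vector_bits x \<le> 8 * (?G n)\<^sup>2) \<and>
      runs P (encode_instance d2 dinf xs) tP RP \<and>
      t \<le> 2 ^ (n div 2 + 1) * (200 * (16 * ?G n) ^ (cc + 6)) + 100 * tP" if F: "is_kcnf k n F" for n F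
    by (rule params.algorithm_correct[OF par F P(1) \<delta> c\<mu> K cc]) (simp, unfold hn, blast)
  have "solves_ksat k ?Q"
    unfolding solves_ksat_def using run by blast
  moreover have "ksat_time k ?Q (\<lambda>n. 2 powr ((1 - \<epsilon> / 4) * real n))"
  proof -
    obtain TP where TP: "TP \<in> O(\<lambda>N. real N powr (2 - \<epsilon>))" "\<forall>d2 dinf xs t R.
       is_instance d2 dinf xs \<and> (\<forall>x\<in>set xs. vector_bits x \<le> vector_size k c (length xs)) \<and>
       runs P (encode_instance d2 dinf xs) t R \<longrightarrow> real t \<le> TP (length xs)"
      using P(2) subpolynomial_vector_size[OF k ck] unfolding diameter_time_def by meson
    have NG: "2 ^ (n div 2 + 1) \<le> ?N n" "?N n \<le> 2 ^ (n div 2 + 1) * (2 * ?G n)" "1 \<le> ?G n" for n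
      using params.NN_ge[OF par, of n] params.NN_le_GG[OF par, of n] params.GG_bounds(4)[OF par, of n] unfolding hn by auto
    define U where "U n = 200 * (16 * ?G n) ^ (cc + 6)" for n
    define T where "T n = real (2 ^ (n div 2 + 1) * U n) + 100 * TP (?N n)" for n
    have time: "real t \<le> T n" if F: "is_kcnf k n F" and r: "runs ?Q (encode_cnf n F) t R" for n F t R
    proof -
      obtain t' R' tP RP d2 dinf xs where *: "runs ?Q (encode_cnf n F) t' R'"
        "is_instance d2 dinf xs" "length xs = ?N n" "\<forall>x\<in>set xs. vector_bits x \<le> 8 * (?G n)\<^sup>2"
        "runs P (encode_instance d2 dinf xs) tP RP"
        "t' \<le> 2 ^ (n div 2 + 1) * U n + 100 * tP"
        using run[OF F] unfolding U_def by blast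
      \<comment> \<open>\<open>ksat_time\<close> speaks of every run while \<open>run\<close>
        provides one; determinism identifies them.\<close>
      have "t = t'" using r *(1) exec_deterministic unfolding runs_def by blast
      \<comment> \<open>As \<open>N\<close> is at least \<open>2 ^ hn\<close>, this \<open>n\<close>
        is in the range of the maximum in \<open>vector_size\<close>.\<close>
      have "n div 2 + 2 \<le> floorlog 2 (?N n)"
        using floorlog_geI[of 2 "n div 2 + 2" "?N n"] NG(1)[of n] by simp
      then have n: "n \<le> 2 * floorlog 2 (?N n)" by simp
      have "8 * (?G n)\<^sup>2 \<le> vector_size k c (?N n)"
        unfolding vector_size_def by (rule Max_ge) (use n in auto)
      then have "\<forall>x\<in>set xs. vector_bits x \<le> vector_size k c (length xs)"
        using *(4) unfolding *(3) by (meson order_trans)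
      then have "real tP \<le> TP (length xs)" using TP(2) *(2,5) by blast
      moreover have "real t \<le> real (2 ^ (n div 2 + 1) * U n + 100 * tP)"
        using *(6) \<open>t = t'\<close> by (simp only: of_nat_le_iff)
      ultimately show ?thesis unfolding T_def *(3) by simp
    qed
    have G: "subexponential ?G" by (rule subexponential_GG[OF k ck])
    have "subexponential U"
      unfolding U_def by (intro subexponential_mult subexponential_const subexponential_power G)
    then obtain C1 where C1: "C1 > 0" "\<And>n. real (U n) \<le> C1 * 2 powr (1 / 4 * real n)"
      by (rule subexponentialD[of _ "1 / 4"]) auto
    have "subexponential (\<lambda>n. (2 * ?G n) ^ 2)"
      by (intro subexponential_mult subexponential_const subexponential_power G)
    then obtain C2 where C2: "C2 > 0" "\<And>n. real ((2 * ?G n) ^ 2) \<le> C2 * 2 powr (\<epsilon> / 4 * real n)"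
      using \<epsilon> by (rule_tac subexponentialD[of _ "\<epsilon> / 4"]) auto
    obtain C3 where C3: "C3 > 0" "eventually (\<lambda>N. norm (TP N) \<le> C3 * norm (real N powr (2 - \<epsilon>))) sequentially"
      using TP(1) by (elim landau_o.bigE)
    then obtain N0 where N0: "\<And>N. N \<ge> N0 \<Longrightarrow> norm (TP N) \<le> C3 * norm (real N powr (2 - \<epsilon>))"
      by (auto simp: eventually_sequentially)
    let ?f = "\<lambda>n. 2 powr ((1 - \<epsilon> / 4) * real n)"
    \<comment> \<open>Writing the instance takes 2^(n/2 + o(n)), at most of the order 2^(3 n / 4),
      which fits under the target because of \<open>\<epsilon> \<le> 1\<close>.\<close>
    have first: "real (2 ^ (n div 2 + 1) * U n) \<le> 2 * C1 * ?f n" for n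
    proof -
      have "real (2 ^ (n div 2 + 1) * U n) \<le> (2 * 2 powr (real n / 2)) * (C1 * 2 powr (1 / 4 * real n))"
        unfolding of_nat_mult[of "2 ^ (n div 2 + 1)"] by (intro mult_mono power_half_le C1) auto
      also have "\<dots> = 2 * C1 * 2 powr (real n / 2 + 1 / 4 * real n)" by (simp only: powr_add mult_ac)
      also have "\<dots> \<le> 2 * C1 * ?f n"
      proof (intro mult_left_mono powr_mono)
        have "real n / 2 + 1 / 4 * real n = 3 / 4 * real n" by simp
        also have "\<dots> \<le> (1 - \<epsilon> / 4) * real n" using \<epsilon> by (intro mult_right_mono) auto
        finally show "real n / 2 + 1 / 4 * real n \<le> (1 - \<epsilon> / 4) * real n" .
      qed (use C1 in auto)
      finally show ?thesis .
    qed
    have second: "\<bar>TP (?N n)\<bar> \<le> C3 * (4 * C2) * ?f n" if "n \<ge> 2 * N0" for n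
    proof -
      have "n div 2 \<le> 2 ^ (n div 2 + 1)" using less_exp[of "n div 2 + 1"] by linarith
      then have "N0 \<le> ?N n" using NG(1)[of n] that by linarith
      then have "\<bar>TP (?N n)\<bar> \<le> C3 * real (?N n) powr (2 - \<epsilon>)" using N0 by force
      also have "real (?N n) powr (2 - \<epsilon>) \<le> 4 * real ((2 * ?G n) ^ 2) * 2 powr ((1 - \<epsilon> / 2) * real n)"
      proof (rule powr_diameter_bound[OF \<epsilon>])
        show "1 \<le> ?N n" using NG(1)[of n] by (metis le_trans one_le_numeral one_le_power)
        show "real (?N n) \<le> real (2 ^ (n div 2 + 1)) * real (2 * ?G n)"
          using NG(2)[of n] by (simp only: of_nat_mult[symmetric] of_nat_le_iff)
        show "1 \<le> 2 * ?G n" using NG(3)[of n] by simp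
      qed
      also have "\<dots> \<le> 4 * (C2 * 2 powr (\<epsilon> / 4 * real n)) * 2 powr ((1 - \<epsilon> / 2) * real n)"
        using C2(2)[of n] by (intro mult_right_mono mult_left_mono) auto
      also have "\<dots> = 4 * C2 * 2 powr (\<epsilon> / 4 * real n + (1 - \<epsilon> / 2) * real n)" by (simp add: powr_add)
      also have "\<epsilon> / 4 * real n + (1 - \<epsilon> / 2) * real n = (1 - \<epsilon> / 4) * real n" by (simp add: field_simps)
      finally show ?thesis using C3(1) by simp
    qed
    have "T \<in> O(?f)"
    proof (rule bigoI)
      show "eventually (\<lambda>n. norm (T n) \<le> (2 * C1 + 100 * (C3 * (4 * C2))) * norm (?f n)) sequentially"
        using eventually_ge_at_top[of "2 * N0"]
      proof eventually_elim
        case (elim n)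
        have "norm (T n) \<le> real (2 ^ (n div 2 + 1) * U n) + 100 * \<bar>TP (?N n)\<bar>"
          unfolding T_def real_norm_def by (rule order_trans[OF abs_triangle_ineq]) (simp add: abs_mult)
        also have "\<dots> \<le> 2 * C1 * ?f n + 100 * (C3 * (4 * C2) * ?f n)"
          by (intro add_mono mult_left_mono first second elim) auto
        also have "\<dots> = (2 * C1 + 100 * (C3 * (4 * C2))) * norm (?f n)" by (simp add: algebra_simps)
        finally show ?case .
      qed
    qed
    then show ?thesis unfolding ksat_time_def using time by blast
  qed
  ultimately show ?thesis by blast
qed

theorem theorem6:
  fixes \<epsilon> \<delta> :: real
  assumes "SETH" and "\<epsilon> > 0" and "\<delta> > 0"
  shows "\<not> (\<exists>P. diameter_approximation (2 - \<delta>) P \<and>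
                diameter_time P (\<lambda>N. real N powr (2 - \<epsilon>)))"
proof
  assume "\<exists>P. diameter_approximation (2 - \<delta>) P \<and> diameter_time P (\<lambda>N. real N powr (2 - \<epsilon>))"
  then obtain P where P: "diameter_approximation (2 - \<delta>) P" "diameter_time P (\<lambda>N. real N powr (2 - \<epsilon>))" by blast
  \<comment> \<open>A larger saving could not be passed on, as the reduction itself takes more than
    2^(n/2). The time bound for \<epsilon> implies the one for the smaller value.\<close>
  define \<epsilon>' where "\<epsilon>' = min \<epsilon> 1"
  have \<epsilon>': "0 < \<epsilon>'" "\<epsilon>' \<le> 1" "\<epsilon>' \<le> \<epsilon>" using assms(2) by (auto simp: \<epsilon>'_def)
  have "(\<lambda>N. real N powr (2 - \<epsilon>)) \<in> O(\<lambda>N. real N powr (2 - \<epsilon>'))"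
    using \<epsilon>'(3) by (intro bigoI[of _ 1] eventually_sequentiallyI[of 1]) (auto intro: powr_mono)
  then have "T \<in> O(\<lambda>N. real N powr (2 - \<epsilon>'))" if "T \<in> O(\<lambda>N. real N powr (2 - \<epsilon>))" for T :: "nat \<Rightarrow> real"
    using that landau_o.big_trans by blast
  then have P': "diameter_time P (\<lambda>N. real N powr (2 - \<epsilon>'))"
    using P(2) unfolding diameter_time_def by meson
  have "\<epsilon>' / 4 > 0" using \<epsilon>' by simp
  then obtain k where "k \<ge> 3" "\<not> (\<exists>Q. solves_ksat k Q \<and> ksat_time k Q (\<lambda>n. 2 powr ((1 - \<epsilon>' / 4) * real n)))"
    using assms(1) unfolding SETH_def by blast
  then show False using reduction_contradiction[OF \<epsilon>'(1,2) assms(3) _ P(1) P'] by blast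
qed

end
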